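(* Let $k\geq 2$ and $d\geq 1$ be integers. Let $\mathcal{Y}_{d}$ be the family of all hypergraphs $Y_{f,q}$, where $q$ is an odd prime power and $f\in\mathbb{F}_q[x_1,x_2,\ldots,x_k]$ is an admissible polynomial of degree $d$. Then $$N^*_{Y_{f,q}}(\mathcal{O}_k^e)=\frac{q^{2k}}{2}+O(q^{2k-1})$$ holds uniformly for all $Y_{f,q}\in\mathcal{Y}_d$; that is, the implied constant depends only on $k$ and $d$ (not on $q$ or $f$). In particular, $\mathcal{Y}_{d}$ is a family of quasi-random $k$-uniform hypergraphs.
   Context: $\mathbb{F}_q$ is the finite field with $q$ elements and $\overline{\mathbb{F}_q}$ its algebraic closure. "Square in $\mathbb{F}_q$" includes $0$. Hypergraph $Y_{f,q}$: for an odd prime power $q$ and a symmetric polynomial $f\in\mathbb{F}_q[x_1,\ldots,x_k]$, $Y_{f,q}$ is the $k$-uniform hypergraph with vertex set $\mathbb{F}_q$ in which a $k$-element subset $\{a_1,\ldots,a_k\}\subset\mathbb{F}_q$ is an edge if and only if $f(a_1,\ldots,a_k)$ is a square in $\mathbb{F}_q$. Admissible: a symmetric polynomial $f\in\mathbb{F}_q[x_1,\ldots,x_k]$ of degree $d$ is admissible if (i) $f$ is not a constant multiple of the square of a polynomial in $\mathbb{F}_q[x_1,\ldots,x_k]$, and (ii) (primitive condition) when we write $f(x_1,\ldots,x_k)=\sum_{j=0}^{d}H_j(x_2,\ldots,x_k)x_1^j$, the polynomials $H_0,H_1,\ldots,H_d$ have no common zero over $\overline{\mathbb{F}_q}$ (i.e.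 no common zero in $\overline{\mathbb{F}_q}^{\,k-1}$). Even partial octahedra: the $k$-octahedron $\mathcal{O}_k$ is the $k$-uniform hypergraph on the $2k$ vertices $u_i(\varepsilon)$, $1\le i\le k$, $\varepsilon\in\{0,1\}$, whose edges are the $2^k$ sets $\{u_1(\varepsilon_1),\ldots,u_k(\varepsilon_k)\}$ with $\varepsilon_1,\ldots,\varepsilon_k\in\{0,1\}$. An even partial octahedron (EPO) is a $k$-uniform hypergraph on the same vertex set as $\mathcal{O}_k$ whose edge set meets the edge set of $\mathcal{O}_k$ in an even number of edges. $\mathcal{O}_k^e$ is the set of all EPOs on this vertex set. For $k$-uniform hypergraphs $G,H$, $N^*_G(H)$ is the number of labeled occurrences of $H$ as an induced subgraph of $G$ (i.e. injective maps $V(H)\to V(G)$ under which a $k$-subset of $V(H)$ is an edge of $H$ iff its image is an edge of $G$), and $N^*_G(\mathcal{O}_k^e)=\sum_{H\in\mathcal{O}_k^e}N^*_G(H)$. Thus $N^*_G(\mathcal{O}_k^e)$ is the number of $2k$-tuples of distinct vertices $(u_1(0),u_1(1),\ldots,u_k(0),u_k(1))$ of $G$ such that an even number of the $2^k$ sets $\{u_1(\varepsilon_1),\ldots,u_k(\varepsilon_k)\}$ are edges of $G$. Quasi-random: a family $\mathcal{G}$ of $k$-uniform hypergraphs with unbounded number of vertices is quasi-random if $N^*_G(\mathcal{O}_k^e)\le (1+o(1))\frac{n^{2k}}{2}$ for $G\in\mathcal{G}$ as $n=|V(G)|\to\infty$ (the $o(1)$ being uniform over the members of $\mathcal{G}$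 with $n$ vertices). *)

theory Defs
  imports
    Complex_Main
    "HOL-Library.FuncSet"
    "HOL-Library.Infinite_Typeclass"
    "HOL-Combinatorics.Permutations"
    "HOL-Algebra.Algebraic_Closure"
begin

section \<open>Polynomials in several variables\<close>

text \<open>
  A polynomial over a ring \<open>R\<close> in the variables \<open>x\<^sub>1, \<dots>, x\<^sub>k\<close> is an element of the library set
  \<open>(carrier R)[\<X>\<^bsub>{1..k}\<^esub>]\<close>: a function from monomials (multisets of variable indices) to
  coefficients. The library provides no product of two such polynomials, no total degree and no
  evaluation at a point.
\<close>

abbreviation mpolys :: "('a, 'b) ring_scheme \<Rightarrow> nat \<Rightarrow> (nat multiset \<Rightarrow> 'a) set"
  where "mpolys R k \<equiv> ring.indexed_pset R {1..k} (carrier R)"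

definition mpoly_mult ::
  "('a, 'b) ring_scheme \<Rightarrow> (nat multiset \<Rightarrow> 'a) \<Rightarrow> (nat multiset \<Rightarrow> 'a) \<Rightarrow> nat multiset \<Rightarrow> 'a"
  where "mpoly_mult R f g =
    (\<lambda>m. \<Oplus>\<^bsub>R\<^esub>m' \<in> {m'. m' \<subseteq># m}. f m' \<otimes>\<^bsub>R\<^esub> g (m - m'))"

definition mpoly_degree :: "('a, 'b) ring_scheme \<Rightarrow> (nat multiset \<Rightarrow> 'a) \<Rightarrow> nat"
  where "mpoly_degree R f = Max (insert 0 (size ` {m. f m \<noteq> \<zero>\<^bsub>R\<^esub>}))"

definition mpoly_eval :: "('a, 'b) ring_scheme \<Rightarrow> (nat multiset \<Rightarrow> 'a) \<Rightarrow> (nat \<Rightarrow> 'a) \<Rightarrow> 'a"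
  where "mpoly_eval R f a =
    (\<Oplus>\<^bsub>R\<^esub>m \<in> {m. f m \<noteq> \<zero>\<^bsub>R\<^esub>}. f m \<otimes>\<^bsub>R\<^esub> (\<Otimes>\<^bsub>R\<^esub>i \<in> set_mset m. a i [^]\<^bsub>R\<^esub> count m i))"

definition symmetric_mpoly :: "nat \<Rightarrow> (nat multiset \<Rightarrow> 'a) \<Rightarrow> bool"
  where "symmetric_mpoly k f \<longleftrightarrow> (\<forall>\<pi>. \<pi> permutes {1..k} \<longrightarrow> (\<forall>m. f (image_mset \<pi> m) = f m))"

text \<open>The polynomial \<open>H\<^sub>j(x\<^sub>2, \<dots>, x\<^sub>k)\<close> in \<open>f = \<Sum>\<^sub>j H\<^sub>j(x\<^sub>2, \<dots>, x\<^sub>k) x\<^sub>1\<^sup>j\<close>.\<close>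

definition x1_coeff ::
  "('a, 'b) ring_scheme \<Rightarrow> (nat multiset \<Rightarrow> 'a) \<Rightarrow> nat \<Rightarrow> nat multiset \<Rightarrow> 'a"
  where "x1_coeff R f j = (\<lambda>m. if 1 \<in># m then \<zero>\<^bsub>R\<^esub> else f (m + replicate_mset j 1))"

definition constant_multiple_of_square ::
  "('a, 'b) ring_scheme \<Rightarrow> nat \<Rightarrow> (nat multiset \<Rightarrow> 'a) \<Rightarrow> bool"
  where "constant_multiple_of_square R k f \<longleftrightarrow>
    (\<exists>c \<in> carrier R. \<exists>g \<in> mpolys R k. f = (\<lambda>m. c \<otimes>\<^bsub>R\<^esub> mpoly_mult R g g m))"

text \<open>
  \<open>field.alg_closure F\<close> is the library's algebraic closure of \<open>F\<close>, and \<open>ring.indexed_const F\<close>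
  is the embedding of \<open>F\<close> into it (\<open>field.alg_closureE\<close>).
\<close>

definition primitive_mpoly :: "'a ring \<Rightarrow> nat \<Rightarrow> (nat multiset \<Rightarrow> 'a) \<Rightarrow> bool"
  where "primitive_mpoly F k f \<longleftrightarrow>
    \<not> (\<exists>b \<in> {2..k} \<rightarrow> carrier (field.alg_closure F).
        \<forall>j \<le> mpoly_degree F f.
          mpoly_eval (field.alg_closure F) (\<lambda>m. ring.indexed_const F (x1_coeff F f j m)) b
            = \<zero>\<^bsub>field.alg_closure F\<^esub>)"

definition admissible :: "'a ring \<Rightarrow> nat \<Rightarrow> (nat multiset \<Rightarrow> 'a) \<Rightarrow> bool"
  where "admissible F k f \<longleftrightarrow>
    f \<in> mpolys F k \<and> symmetric_mpoly k f \<and>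
    \<not> constant_multiple_of_square F k f \<and> primitive_mpoly F k f"


section \<open>Hypergraphs\<close>

record 'v hypergraph =
  verts :: "'v set"
  edges :: "'v set set"

definition uniform_hypergraph :: "nat \<Rightarrow> 'v hypergraph \<Rightarrow> bool"
  where "uniform_hypergraph k G \<longleftrightarrow>
    finite (verts G) \<and> (\<forall>e \<in> edges G. e \<subseteq> verts G \<and> card e = k)"

text \<open>
  Labelled induced occurrences of \<open>H\<close> in \<open>G\<close>. The maps are extensional on \<open>verts H\<close>, so that each
  map \<open>V(H) \<rightarrow> V(G)\<close> is counted once.
\<close>

definition induced_count :: "nat \<Rightarrow> 'v hypergraph \<Rightarrow> 'w hypergraph \<Rightarrow> nat"
  where "induced_count k G H =
    card {\<phi> \<in> verts H \<rightarrow>\<^sub>E verts G. inj_on \<phi> (verts H) \<and>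
      (\<forall>e. e \<subseteq> verts H \<and> card e = k \<longrightarrow> (e \<in> edges H \<longleftrightarrow> \<phi> ` e \<in> edges G))}"

text \<open>The pair \<open>(i, \<epsilon>)\<close> is the vertex \<open>u\<^sub>i(\<epsilon>)\<close>.\<close>

definition octahedron :: "nat \<Rightarrow> (nat \<times> bool) hypergraph"
  where "octahedron k =
    \<lparr> verts = {1..k} \<times> UNIV, edges = {(\<lambda>i. (i, \<epsilon> i)) ` {1..k} | \<epsilon>. True} \<rparr>"

definition even_partial_octahedra :: "nat \<Rightarrow> (nat \<times> bool) hypergraph set"
  where "even_partial_octahedra k =
    {H. uniform_hypergraph k H \<and> verts H = verts (octahedron k) \<and>
        even (card (edges H \<inter> edges (octahedron k)))}"

definition epo_count :: "nat \<Rightarrow> 'v hypergraph \<Rightarrow> nat"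
  where "epo_count k G = (\<Sum>H \<in> even_partial_octahedra k. induced_count k G H)"

text \<open>The function \<open>\<delta>\<close> is the \<open>o(1)\<close> term; it depends on the number of vertices only.\<close>

definition quasi_random :: "nat \<Rightarrow> 'v hypergraph set \<Rightarrow> bool"
  where "quasi_random k \<G> \<longleftrightarrow>
    (\<forall>G \<in> \<G>. uniform_hypergraph k G) \<and>
    (\<forall>N. \<exists>G \<in> \<G>. card (verts G) > N) \<and>
    (\<exists>\<delta> :: nat \<Rightarrow> real. \<delta> \<longlonglongrightarrow> 0 \<and>
      (\<forall>G \<in> \<G>. real (epo_count k G)
         \<le> (1 + \<delta> (card (verts G))) * (real (card (verts G)) ^ (2 * k) / 2)))"


section \<open>The hypergraphs of a symmetric polynomial\<close>

definition square_in :: "('a, 'b) ring_scheme \<Rightarrow> 'a \<Rightarrow> bool"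
  where "square_in R x \<longleftrightarrow> (\<exists>y \<in> carrier R. x = y \<otimes>\<^bsub>R\<^esub> y)"

text \<open>
  An edge is the image of an injective enumeration \<open>a\<^sub>1, \<dots>, a\<^sub>k\<close> with \<open>f(a\<^sub>1, \<dots>, a\<^sub>k)\<close> a square;
  for symmetric \<open>f\<close> the choice of enumeration is immaterial.
\<close>

definition square_hypergraph :: "'a ring \<Rightarrow> nat \<Rightarrow> (nat multiset \<Rightarrow> 'a) \<Rightarrow> 'a hypergraph"
  where "square_hypergraph F k f =
    \<lparr> verts = carrier F,
      edges = {a ` {1..k} | a. a \<in> {1..k} \<rightarrow> carrier F \<and> inj_on a {1..k} \<and>
                 square_in F (mpoly_eval F f a)} \<rparr>"

text \<open>
  Finite fields are field structures on subsets of a type \<open>'a\<close>. If \<open>'a\<close> is infinite (for instance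
  \<open>nat\<close>), every finite field is isomorphic to one of these, so quantifying over \<open>'a ring\<close> inside a
  formula quantifies over all finite fields, with varying \<open>q\<close>. The order of a finite field is
  automatically a prime power.
\<close>

definition odd_finite_field :: "'a ring \<Rightarrow> bool"
  where "odd_finite_field F \<longleftrightarrow> field F \<and> finite (carrier F) \<and> odd (card (carrier F))"

definition square_hypergraph_family :: "nat \<Rightarrow> nat \<Rightarrow> 'a hypergraph set"
  where "square_hypergraph_family k d =
    {square_hypergraph F k f | F f.
       odd_finite_field F \<and> admissible F k f \<and> mpoly_degree F f = d}"

end

theory Submission
  imports Defs "HOL-Computational_Algebra.Polynomial" "HOL-Number_Theory.Residues"
begin

text \<open>
  Let \<open>\<chi>\<close> be the quadratic character and \<open>T\<close> the sum, over all \<open>2k\<close>-tuples \<open>u\<close> of field elements, of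
  the product of the \<open>2\<^sup>k\<close> values \<open>\<chi>(f(u\<^sub>\<epsilon>))\<close>. If all these values are nonzero, then, \<open>2\<^sup>k\<close> being even,
  their product is \<open>1\<close> or \<open>-1\<close> according to the parity of the number of edges. So the number of even
  octahedra is \<open>(q\<^bsup>2k\<^esup> + T) / 2\<close> up to the number of tuples with a repeated vertex or with some
  \<open>f(u\<^sub>\<epsilon>) = 0\<close>. Primitivity and symmetry say that \<open>f\<close> is a nonzero polynomial of degree at most \<open>d\<close> in
  each single variable, whatever values the others take in the algebraic closure (\<open>fibre_nonzero\<close>);
  hence there are \<open>O(q\<^bsup>2k-1\<^esup>)\<close> such tuples.

  To bound \<open>T\<close>, fix the \<open>2k - 2\<close> vertices \<open>u\<close> other than the two copies of \<open>x\<^sub>1\<close>. Both copies contribute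
  the same character sum, so \<open>T\<close> is the sum over \<open>u\<close> of the square of \<open>\<Sum>\<^sub>x \<chi>(P\<^sub>u(x))\<close>, where \<open>P\<^sub>u\<close> is the
  product of the \<open>2\<^bsup>k-1\<^esup>\<close> polynomials \<open>f(x, u\<^sub>\<epsilon>)\<close> (\<open>char_sum_eq\<close>). The inner sum is \<open>O(\<surd>q)\<close> by the Weil
  bound (\<open>weil\<close>) unless \<open>P\<^sub>u\<close> is a constant times a square, and it remains to see that this happens for
  only \<open>O(q\<^bsup>2k-3\<^esup>)\<close> tuples \<open>u\<close> (\<open>card_bad\<close>). If \<open>P\<^sub>u\<close> is a constant times a square, then either the
  factor \<open>f(x, v)\<close> with \<open>v = u\<^sub>0\<close> is one, or it shares a root with another factor \<open>f(x, u\<^sub>\<epsilon>)\<close>. The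
  second possibility is a nontrivial polynomial condition on one of the coordinates \<open>u\<^sub>i(1)\<close>. For the
  first, suppose that the polynomial that \<open>f\<close> induces on \<open>x\<^sub>1, \<dots>, x\<^sub>j\<close> is a constant times a square for
  many values of \<open>x\<^bsub>j+1\<^esub>\<close>. Its square root can be computed coefficient by coefficient, polynomially in
  \<open>x\<^bsub>j+1\<^esub>\<close> up to powers of the leading coefficient; these powers can be removed because no
  specialisation of \<open>x\<^bsub>j+1\<^esub>\<close> kills \<open>f\<close>. So the polynomial in \<open>x\<^sub>1, \<dots>, x\<^bsub>j+1\<^esub>\<close> is a constant times a
  square as well (\<open>square_of_many_square_specialisations\<close>). As \<open>f\<close> is not one, an induction on \<open>j\<close> leaves
  only \<open>O(q\<^bsup>k-2\<^esup>)\<close> exceptional \<open>v\<close> (\<open>card_square_fibres\<close>).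

  The Weil bound is obtained by Stepanov's method: an auxiliary polynomial of controlled degree, found
  by the pigeonhole principle, vanishes to high order at all \<open>x\<close> with \<open>g(x)\<^bsup>(q-1)/2\<^esup> = a\<close>. Taylor
  coefficients replace derivatives, so that the order of vanishing may exceed the characteristic.

  The fields of the theorem are structures on subsets of a type, while polynomial arithmetic is
  developed for type classes. The two are joined by the product of all fields on a given type, which
  is a commutative ring: a field \<open>L\<close> sits in it as the set of multiples of an idempotent \<open>e\<close>. Thus
  \<open>e * x = x\<close> expresses that \<open>x\<close> lies in \<open>L\<close>, and \<open>smult e p = p\<close> that \<open>p\<close> is a polynomial over \<open>L\<close>. Here
  \<open>L\<close> is the algebraic closure of \<open>F\<close>, and \<open>K\<close> is the copy of \<open>F\<close> inside it.
\<close>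

section \<open>Domains and fields cut out by an idempotent\<close>

text \<open>
  The multiples of \<open>e\<close> are assumed to form a domain with unit \<open>e\<close>. Its elements are the fixed points of
  multiplication by \<open>e\<close>; the unit \<open>1\<close> of the ambient ring is in general not among them, which is why
  powers with exponent \<open>0\<close> and linear factors carry an explicit \<open>e\<close> below.
\<close>

locale prime_idem =
  fixes e :: "'r::comm_ring_1"
  assumes idem: "e * e = e"
    and e_nonzero: "e \<noteq> 0"
    and no_zero_divisors: "e * x = x \<Longrightarrow> e * y = y \<Longrightarrow> x * y = 0 \<Longrightarrow> x = 0 \<or> y = 0"
begin

lemma e_idem_left [simp]: "e * (e * x) = e * x"
  by (simp add: idem flip: mult.assoc)

lemma mult_closed: "e * x = x \<Longrightarrow> e * (x * y) = x * y"
  by (metis mult.assoc)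

lemma power_closed: "e * x = x \<Longrightarrow> n > 0 \<Longrightarrow> e * x ^ n = x ^ n"
  by (cases n) (auto simp: mult_closed)

lemma power_nonzero: "e * x = x \<Longrightarrow> x \<noteq> 0 \<Longrightarrow> e * x ^ n \<noteq> 0"
proof (induction n)
  case 0 then show ?case using e_nonzero by simp
next
  case (Suc n)
  then show ?case
    using no_zero_divisors[of x "e * x ^ n"] by (metis e_idem_left mult.left_commute power_Suc)
qed

lemma cancel_left:
  assumes "e * x = x" "e * y = y" "e * z = z" "x \<noteq> 0" "x * y = x * z"
  shows "y = z"
proof -
  have "x * (y - z) = 0" using assms by (simp add: algebra_simps)
  moreover have "e * (y - z) = y - z" using assms by (simp add: algebra_simps)
  ultimately show ?thesis using no_zero_divisors[of x "y - z"] assms by auto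
qed

lemma coeff_closed: "smult e p = p \<Longrightarrow> e * coeff p i = coeff p i"
  by (metis coeff_smult)

lemma poly_closed: "smult e p = p \<Longrightarrow> e * poly p x = poly p x"
  by (metis poly_smult)

lemma smult_idem [simp]: "smult e (smult e p) = smult e p"
  by (simp add: idem)

lemma lead_coeff_mult_nonzero:
  assumes "smult e p = p" "smult e q = q" "p \<noteq> 0" "q \<noteq> 0"
  shows "coeff (p * q) (degree p + degree q) \<noteq> 0"
proof -
  have "coeff p (degree p) * coeff q (degree q) \<noteq> 0"
    using no_zero_divisors[of "coeff p (degree p)" "coeff q (degree q)"] assms
    by (metis coeff_closed leading_coeff_0_iff)
  then show ?thesis by (simp add: coeff_mult_degree_sum)
qed

lemma degree_mult:
  assumes "smult e p = p" "smult e q = q" "p \<noteq> 0" "q \<noteq> 0"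
  shows "degree (p * q) = degree p + degree q"
  using lead_coeff_mult_nonzero[OF assms] degree_mult_le[of p q] le_degree by (metis le_antisym)

lemma degree_power:
  assumes "smult e p = p" "p \<noteq> 0"
  shows "degree (smult e (p ^ n)) = n * degree p \<and> smult e (p ^ n) \<noteq> 0"
proof (induction n)
  case 0
  then show ?case using e_nonzero by simp
next
  case (Suc n)
  have eq: "smult e (p ^ Suc n) = p * smult e (p ^ n)" by simp
  show ?case unfolding eq
    using degree_mult[of p "smult e (p ^ n)"] lead_coeff_mult_nonzero[of p "smult e (p ^ n)"] Suc assms
    by (metis coeff_0 mult_Suc smult_idem)
qed

text \<open>
  Polynomials over the domain again form a domain of this kind, so that every cancellation law is at
  once available for polynomials, and for polynomials whose coefficients are polynomials.
\<close>

lemma prime_idem_poly: "prime_idem [:e:]"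
proof
  show "[:e:] * [:e:] = [:e:]" by (simp add: idem)
  show "[:e:] \<noteq> 0" using e_nonzero by simp
  show "x = 0 \<or> y = 0" if "[:e:] * x = x" "[:e:] * y = y" "x * y = 0" for x y
    using that lead_coeff_mult_nonzero[of x y] by (metis coeff_0 mult_pCons_left mult_zero_left add_0_right pCons_0_0)
qed

lemmas poly_cancel_left = prime_idem.cancel_left[OF prime_idem_poly, simplified]
lemmas poly_no_zero_divisors = prime_idem.no_zero_divisors[OF prime_idem_poly, simplified]

lemma factor_root:
  assumes p: "smult e p = p" and a: "e * a = a" and root: "poly p a = 0"
  obtains q where "smult e q = q" "p = [:- a, e:] * q"
proof -
  obtain q where q: "p = [:- a, 1:] * q"
    using root by (auto simp: poly_eq_0_iff_dvd elim: dvdE)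
  have "[:- a, e:] * smult e q = smult e [:- a, 1:] * smult e q" by (simp add: a)
  also have "\<dots> = smult e p" unfolding q mult_smult_left mult_smult_right smult_smult idem ..
  finally have "[:- a, e:] * smult e q = smult e p" .
  then show ?thesis using that[OF smult_idem] p by metis
qed

lemma linear_closed: "e * a = a \<Longrightarrow> smult e [:- a, e:] = [:- a, e:]" by (simp add: idem)

lemma linear_nonzero: "[:- a, e:] \<noteq> 0" using e_nonzero by simp

lemma degree_linear [simp]: "degree [:a, e:] = 1" using e_nonzero by simp

lemma roots_finite_card:
  assumes "smult e p = p" "p \<noteq> 0"
  shows "finite {x. e * x = x \<and> poly p x = 0} \<and> card {x. e * x = x \<and> poly p x = 0} \<le> degree p"
  using assms
proof (induction "degree p" arbitrary: p rule: less_induct)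
  case less
  show ?case
  proof (cases "\<exists>a. e * a = a \<and> poly p a = 0")
    case False
    then have "{x. e * x = x \<and> poly p x = 0} = {}" by auto
    then show ?thesis by (metis card.empty finite.emptyI zero_le)
  next
    case True
    then obtain a where a: "e * a = a" "poly p a = 0" by blast
    then obtain q where q: "smult e q = q" "p = [:- a, e:] * q"
      using factor_root less.prems by blast
    have qn: "q \<noteq> 0" using q less.prems by auto
    have deg: "degree p = Suc (degree q)"
      using degree_mult[OF linear_closed[OF a(1)] q(1) linear_nonzero qn]
      unfolding q(2)[symmetric] degree_linear by simp
    have IH: "finite {x. e * x = x \<and> poly q x = 0}" "card {x. e * x = x \<and> poly q x = 0} \<le> degree q"
      using less.hyps[of q] deg q qn by auto
    have "{x. e * x = x \<and> poly p x = 0} \<subseteq> insert a {x. e * x = x \<and> poly q x = 0}"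
    proof
      fix x assume "x \<in> {x. e * x = x \<and> poly p x = 0}"
      then have x: "e * x = x" "poly p x = 0" by auto
      have "(x - a) * poly q x = 0" using x q by (simp add: algebra_simps)
      moreover have "e * (x - a) = x - a" using x a by (simp add: algebra_simps)
      ultimately have "x - a = 0 \<or> poly q x = 0"
        using no_zero_divisors poly_closed[OF q(1)] by blast
      then show "x \<in> insert a {x. e * x = x \<and> poly q x = 0}" using x by auto
    qed
    then show ?thesis using IH deg
      by (metis (no_types, lifting) card_insert_le_m1 card_mono diff_Suc_1 finite.insertI finite_subset le_trans zero_less_Suc)
  qed
qed

lemma poly_zero_if_many_roots:
  assumes "smult e p = p" "finite Y" "\<And>y. y \<in> Y \<Longrightarrow> e * y = y \<and> poly p y = 0" "degree p < card Y"
  shows "p = 0"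
proof (rule ccontr)
  assume "p \<noteq> 0"
  then have "finite {x. e * x = x \<and> poly p x = 0}" "card {x. e * x = x \<and> poly p x = 0} \<le> degree p"
    using roots_finite_card assms by auto
  moreover have "Y \<subseteq> {x. e * x = x \<and> poly p x = 0}" using assms by auto
  ultimately have "card Y \<le> degree p" using card_mono le_trans by blast
  then show False using assms by simp
qed

end

text \<open>
  Inverses and roots make the domain an algebraically closed field, in which common roots stand for
  common factors.
\<close>

locale closed_idem =
  fixes e :: "'r::comm_ring_1"
  assumes e_idem: "e * e = e"
    and e_neq_0: "e \<noteq> 0"
    and inverse_ex: "e * x = x \<Longrightarrow> x \<noteq> 0 \<Longrightarrow> \<exists>y. e * y = y \<and> x * y = e"
    and root_ex: "smult e p = p \<Longrightarrow> degree p > 0 \<Longrightarrow> \<exists>a. e * a = a \<and> poly p a = 0"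

sublocale closed_idem \<subseteq> prime_idem e
proof
  show "e * e = e" "e \<noteq> 0" by (fact e_idem e_neq_0)+
  fix x y assume *: "e * x = x" "e * y = y" "x * y = 0"
  show "x = 0 \<or> y = 0"
  proof (rule ccontr)
    assume "\<not> (x = 0 \<or> y = 0)"
    then obtain z where "x * z = e" using inverse_ex * by blast
    then have "y = z * (x * y)" using * by (metis mult.assoc mult.commute)
    then show False using * \<open>\<not> (x = 0 \<or> y = 0)\<close> by simp
  qed
qed

context closed_idem
begin

definition const_square :: "'r poly \<Rightarrow> bool"
  where "const_square p \<longleftrightarrow> (\<exists>c h. e * c = c \<and> smult e h = h \<and> p = smult c (h * h))"

lemma const_squareI: "e * c = c \<Longrightarrow> smult e h = h \<Longrightarrow> p = smult c (h * h) \<Longrightarrow> const_square p"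
  unfolding const_square_def by blast

lemma const_square_const: assumes "smult e p = p" "degree p = 0" shows "const_square p"
proof -
  obtain a where a: "p = [:a:]" using assms degree_eq_zeroE by blast
  have "e * a = a" using assms a by (metis coeff_closed coeff_pCons_0)
  moreover have "smult e [:e:] = [:e:]" by (simp add: idem)
  moreover have "p = smult a ([:e:] * [:e:])" using a \<open>e * a = a\<close>
    by (simp add: idem mult.commute)
  ultimately show ?thesis using const_squareI by blast
qed

lemma const_square_mult_square:
  assumes "const_square p" "smult e h = h" shows "const_square (h * h * p)"
proof -
  obtain c g where g: "e * c = c" "smult e g = g" "p = smult c (g * g)" using assms const_square_def by blast
  have "smult e (h * g) = h * g" using assms by (metis mult_smult_left)
  moreover have "h * h * p = smult c ((h * g) * (h * g))" using g by (simp add: mult_ac)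
  ultimately show ?thesis using const_squareI g by blast
qed

text \<open>
  Every root of \<open>A\<close> is a root of \<open>S\<close> and so a double root of \<open>A * G\<close>; as \<open>G\<close> does not vanish there, it is a
  double root of \<open>A\<close>. The factors \<open>(x - a)\<^sup>2\<close> can therefore be split off one after the other.
\<close>

lemma const_square_of_coprime_product:
  assumes "smult e A = A" "smult e G = G" "smult e S = S" "e * c = c"
    and "A * G = smult c (S * S)"
    and "\<And>a. e * a = a \<Longrightarrow> poly A a = 0 \<Longrightarrow> poly G a \<noteq> 0"
  shows "const_square A"
  using assms
proof (induction "degree A" arbitrary: A S rule: less_induct)
  case less
  show ?case
  proof (cases "degree A = 0")
    case True then show ?thesis using const_square_const less.prems by blast
  next
    case False
    then obtain a where a: "e * a = a" "poly A a = 0" using root_ex less.prems by blast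
    define l where "l = [:- a, e:]"
    have l: "smult e l = l" "l \<noteq> 0" "degree l = 1" "poly l a = 0"
      using linear_closed[OF a(1)] linear_nonzero a(1) by (auto simp: l_def mult.commute)
    have Ga: "poly G a \<noteq> 0" using less.prems(6) a unfolding l_def by blast
    have An: "A \<noteq> 0" using False by auto
    have Gn: "G \<noteq> 0" using Ga by auto
    obtain A1 where A1: "smult e A1 = A1" "A = l * A1" using factor_root less.prems(1) a unfolding l_def by blast
    have cn: "c \<noteq> 0" using poly_no_zero_divisors[of A G] less.prems An Gn by auto
    have "c * (poly S a * poly S a) = 0"
      using arg_cong[OF less.prems(5), of "\<lambda>p. poly p a"] a by simp
    then have "poly S a * poly S a = 0"
      using no_zero_divisors[of c] less.prems(4) cn poly_closed[OF less.prems(3)] mult_closed by blast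
    then have "poly S a = 0" using no_zero_divisors poly_closed[OF less.prems(3)] by blast
    then obtain S1 where S1: "smult e S1 = S1" "S = l * S1" using factor_root less.prems(3) a unfolding l_def by blast
    have "l * (A1 * G) = l * smult c (l * S1 * S1)"
      using less.prems(5) unfolding A1(2) S1(2) by (simp add: mult_ac)
    then have eq1: "A1 * G = smult c (l * S1 * S1)"
      using poly_cancel_left[of l "A1 * G" "smult c (l * S1 * S1)"] l less.prems A1
      by (metis mult_smult_left smult_smult)
    have "poly A1 a * poly G a = 0"
      using arg_cong[OF eq1, of "\<lambda>p. poly p a"] l(4) by simp
    then have "poly A1 a = 0"
      using no_zero_divisors Ga poly_closed A1(1) less.prems(2) by blast
    then obtain A2 where A2: "smult e A2 = A2" "A1 = l * A2" using factor_root A1(1) a unfolding l_def by blast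
    have "l * (A2 * G) = l * smult c (S1 * S1)"
      using eq1 unfolding A2(2) by (simp add: mult_ac)
    then have eq2: "A2 * G = smult c (S1 * S1)"
      using poly_cancel_left[of l "A2 * G" "smult c (S1 * S1)"] l less.prems A2
      by (metis mult_smult_left smult_smult)
    have n: "A1 \<noteq> 0" "A2 \<noteq> 0" using An A1 A2 by auto
    have "degree A = Suc (Suc (degree A2))"
      using degree_mult[OF l(1) A1(1) l(2)] degree_mult[OF l(1) A2(1) l(2)] n l(3)
      unfolding A1(2) A2(2) by simp
    moreover have "poly G b \<noteq> 0" if "e * b = b" "poly A2 b = 0" for b
      using less.prems(6)[OF that(1)] that(2) A1 A2 by simp
    ultimately have "const_square A2"
      using less.hyps[of A2 S1] A2(1) S1(1) less.prems(2,4) eq2 by simp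
    then have "const_square (l * l * A2)" using const_square_mult_square l by blast
    then show ?thesis using A1(2) A2(2) by (simp add: mult_ac)
  qed
qed

text \<open>
  Each root of \<open>r\<close> is a root of \<open>s\<close>, and the common linear factor cancels, until \<open>r\<close> is constant.
\<close>

lemma const_square_of_square_multiple:
  assumes "smult e f = f" "smult e r = r" "smult e s = s" "e * c = c" "r \<noteq> 0"
    and "f * (r * r) = smult c (s * s)"
  shows "const_square f"
  using assms
proof (induction "degree r" arbitrary: r s rule: less_induct)
  case less
  show ?case
  proof (cases "degree r = 0")
    case True
    then obtain a where ra: "r = [:a:]" using degree_eq_zeroE by blast
    have a: "e * a = a" "a \<noteq> 0" using less.prems(2,5) ra by auto
    then obtain b where b: "e * b = b" "a * b = e" using inverse_ex by blast
    have "smult (b * b) (f * (r * r)) = smult (b * b * (a * a)) f" using ra by (simp add: mult_ac)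
    also have "b * b * (a * a) = e" using b idem by (metis mult.assoc mult.commute)
    finally have "f = smult (b * b * c) (s * s)" using less.prems by simp
    moreover have "e * (b * b * c) = b * b * c" using b by (metis mult.assoc)
    ultimately show ?thesis using const_squareI less.prems by blast
  next
    case False
    then obtain a where a: "e * a = a" "poly r a = 0" using root_ex less.prems by blast
    define l where "l = [:- a, e:]"
    have l: "smult e l = l" "l \<noteq> 0" "degree l = 1" "poly l a = 0"
      using linear_closed[OF a(1)] linear_nonzero a(1) by (auto simp: l_def mult.commute)
    obtain r1 where r1: "smult e r1 = r1" "r = l * r1" using factor_root less.prems(2) a unfolding l_def by blast
    show ?thesis
    proof (cases "c = 0")
      case True
      then have "f * (r * r) = 0" using less.prems by simp
      then have "f = 0" using poly_no_zero_divisors less.prems(1,2,5) by (metis mult_smult_left)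
      then show ?thesis using const_square_const by simp
    next
      case cn: False
      have "c * (poly s a * poly s a) = 0"
        using arg_cong[OF less.prems(6), of "\<lambda>p. poly p a"] a by simp
      then have "poly s a * poly s a = 0"
        using no_zero_divisors[of c] less.prems(4) cn poly_closed[OF less.prems(3)] mult_closed by blast
      then have "poly s a = 0" using no_zero_divisors poly_closed[OF less.prems(3)] by blast
      then obtain s1 where s1: "smult e s1 = s1" "s = l * s1" using factor_root less.prems(3) a unfolding l_def by blast
      have "(l * l) * (f * (r1 * r1)) = (l * l) * smult c (s1 * s1)"
        using less.prems(6) unfolding r1(2) s1(2) by (simp add: mult_ac)
      moreover have "smult e (l * l) = l * l" "l * l \<noteq> 0"
        using l poly_no_zero_divisors by (metis mult_smult_left, blast)
      ultimately have "f * (r1 * r1) = smult c (s1 * s1)"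
        using poly_cancel_left[of "l * l" "f * (r1 * r1)" "smult c (s1 * s1)"] less.prems
        by (metis mult_smult_left smult_smult)
      moreover have rn: "r1 \<noteq> 0" using less.prems r1 by auto
      moreover have "degree r1 < degree r" using degree_mult[OF l(1) r1(1) l(2) rn] r1 l(3) by simp
      ultimately show ?thesis using less.hyps[of r1 s1] less.prems(1,4) r1(1) s1(1) by blast
    qed
  qed
qed

end

section \<open>Taylor expansion\<close>

text \<open>
  The expansion of \<open>p(X + T)\<close> in powers of \<open>T\<close>. The coefficient of \<open>T\<^sup>i\<close> is the \<open>i\<close>-th Hasse derivative
  of \<open>p\<close>, which records vanishing orders in every characteristic.
\<close>

definition taylor :: "'a::comm_ring_1 poly \<Rightarrow> 'a poly poly"
  where "taylor p = poly (map_poly (\<lambda>c. [:[:c:]:]) p) [:[:0, 1:], 1:]"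

lemma taylor_0 [simp]: "taylor 0 = 0"
  by (simp add: taylor_def)

lemma taylor_pCons: "taylor (pCons c p) = [:[:c:]:] + [:[:0, 1:], 1:] * taylor p"
  by (simp add: taylor_def map_poly_pCons)

lemma taylor_add: "taylor (p + q) = taylor p + taylor q"
proof (induction p q rule: poly_induct2)
  case (pCons a p b q)
  have "taylor (pCons a p + pCons b q) = [:[:a:]:] + [:[:b:]:] + [:[:0, 1:], 1:] * (taylor p + taylor q)"
    by (simp add: taylor_pCons pCons)
  then show ?case by (simp only: taylor_pCons distrib_left add_ac)
qed simp

lemma taylor_smult: "taylor (smult c p) = smult [:c:] (taylor p)"
  by (induction p) (simp_all add: taylor_pCons smult_add_right mult_ac)

lemma taylor_diff: "taylor (p - q) = taylor p - taylor q"
  using taylor_add[of "p - q" q] by simp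

lemma taylor_mult: "taylor (p * q) = taylor p * taylor q"
  by (induction p) (simp_all add: taylor_pCons taylor_add taylor_smult algebra_simps)

lemma taylor_1 [simp]: "taylor 1 = 1"
  using taylor_pCons[of 1 0] by (simp add: one_pCons)

lemma taylor_power: "taylor (p ^ n) = taylor p ^ n"
  by (induction n) (simp_all add: taylor_mult)

lemma coeff_taylor_0: "coeff (taylor p) 0 = p"
  by (induction p) (simp_all add: taylor_pCons)

lemma degree_coeff_taylor: "degree (coeff (taylor p) i) \<le> degree p"
proof (induction p arbitrary: i)
  case 0
  then show ?case by simp
next
  case (pCons c p)
  show ?case
  proof (cases "p = 0")
    case True
    then show ?thesis by (cases i) (simp_all add: taylor_pCons)
  next
    case False
    have "coeff (taylor (pCons c p)) i
      = [:if i = 0 then c else 0:] + pCons 0 (coeff (taylor p) i) + (if i = 0 then 0 else coeff (taylor p) (i - 1))"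
      by (cases i) (simp_all add: taylor_pCons)
    moreover have "degree (pCons 0 (coeff (taylor p) i)) \<le> Suc (degree p)"
      using pCons.IH[of i] by (simp add: degree_pCons_le le_trans[OF degree_pCons_le])
    ultimately show ?thesis using False pCons.IH[of "i - 1"]
      by (auto intro!: degree_add_le)
  qed
qed

lemma coeff_pcompose_shift: "coeff (pcompose p [:x, 1:]) i = poly (coeff (taylor p) i) x"
proof (induction p arbitrary: i)
  case 0
  then show ?case by simp
next
  case (pCons c p)
  then show ?case by (cases i) (simp_all add: pcompose_pCons taylor_pCons coeff_taylor_0)
qed

lemma pcompose_power: "pcompose (p ^ n) r = pcompose p r ^ n"
  by (induction n) (simp_all add: pcompose_mult pcompose_1)

definition semiring_closed :: "'a::comm_ring_1 set \<Rightarrow> bool"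
  where "semiring_closed S \<longleftrightarrow> 0 \<in> S \<and> 1 \<in> S \<and> (\<forall>x\<in>S. \<forall>y\<in>S. x + y \<in> S \<and> x * y \<in> S)"

lemma semiring_closedD:
  assumes "semiring_closed S"
  shows "0 \<in> S" "1 \<in> S" "x \<in> S \<Longrightarrow> y \<in> S \<Longrightarrow> x + y \<in> S" "x \<in> S \<Longrightarrow> y \<in> S \<Longrightarrow> x * y \<in> S"
  using assms by (auto simp: semiring_closed_def)

lemma semiring_closed_sum:
  assumes "semiring_closed S" "\<And>i. i \<in> I \<Longrightarrow> f i \<in> S"
  shows "sum f I \<in> S"
  using assms(2) by (induction I rule: infinite_finite_induct) (auto simp: semiring_closedD[OF assms(1)])

lemma semiring_closed_power: "semiring_closed S \<Longrightarrow> x \<in> S \<Longrightarrow> x ^ n \<in> S"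
  by (induction n) (auto simp: semiring_closedD)

definition polys_over :: "'a::comm_ring_1 set \<Rightarrow> 'a poly set"
  where "polys_over S = {p. \<forall>i. coeff p i \<in> S}"

lemma polys_over_pCons:
  assumes "semiring_closed S" shows "pCons c p \<in> polys_over S \<longleftrightarrow> c \<in> S \<and> p \<in> polys_over S"
proof -
  have "(\<forall>i. coeff (pCons c p) i \<in> S) \<longleftrightarrow> coeff (pCons c p) 0 \<in> S \<and> (\<forall>i. coeff (pCons c p) (Suc i) \<in> S)"
    by (metis not0_implies_Suc)
  then show ?thesis by (simp add: polys_over_def)
qed

lemma semiring_closed_polys_over:
  assumes "semiring_closed S" shows "semiring_closed (polys_over S)"
  unfolding semiring_closed_def polys_over_def
  by (auto simp: coeff_mult semiring_closedD[OF assms] coeff_1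
      intro!: semiring_closed_sum[OF assms] semiring_closedD(3,4)[OF assms])

lemma taylor_over:
  assumes "semiring_closed S" "p \<in> polys_over S"
  shows "taylor p \<in> polys_over (polys_over S)"
  using assms(2)
proof (induction p)
  case 0
  then show ?case using semiring_closedD(1)[OF assms(1)] by (simp add: polys_over_def)
next
  case (pCons c p)
  note S1 = semiring_closed_polys_over[OF assms(1)]
  note S2 = semiring_closed_polys_over[OF S1]
  note D = semiring_closedD[OF assms(1)] semiring_closedD[OF S1] semiring_closedD[OF S2]
  show ?case
    using pCons polys_over_pCons[OF assms(1)] polys_over_pCons[OF S1] unfolding taylor_pCons
    by (intro D) (auto simp: D)
qed

text \<open>
  Every contribution to the coefficient of \<open>T\<^sup>i\<close> in \<open>P\<^sup>N\<close> takes a coefficient other than the constant one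
  from at most \<open>i\<close> of the \<open>N\<close> factors, so it contains the constant coefficient of \<open>P\<close> at least \<open>N - i\<close>
  times. The degree of the cofactor \<open>W i\<close> is bounded independently of \<open>N\<close>; this is what makes the
  derivatives of \<open>g\<^bsup>(q-1)/2\<^esup>\<close> cheap in the construction of the auxiliary polynomial.
\<close>

lemma coeff_power_structure:
  fixes P :: "'a::comm_ring_1 poly poly"
  assumes S: "semiring_closed S" and P: "P \<in> polys_over S" and deg: "\<And>i. degree (coeff P i) \<le> m"
  shows "\<exists>W. \<forall>i\<le>N. coeff (P ^ N) i = coeff P 0 ^ (N - i) * W i \<and> degree (W i) \<le> i * m \<and> W i \<in> S"
proof (induction N)
  case 0
  then show ?case using semiring_closedD(2)[OF S] by (intro exI[of _ "\<lambda>_. 1"]) (simp add: semiring_closedD)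
next
  case (Suc N)
  then obtain W where W: "\<And>i. i \<le> N \<Longrightarrow> coeff (P ^ N) i = coeff P 0 ^ (N - i) * W i"
    "\<And>i. i \<le> N \<Longrightarrow> degree (W i) \<le> i * m" "\<And>i. i \<le> N \<Longrightarrow> W i \<in> S" by blast
  define g where "g = coeff P 0"
  have PS: "coeff P i \<in> S" for i using P by (auto simp: polys_over_def)
  have degg: "degree g \<le> m" using deg g_def by auto
  have PN: "degree (coeff (P ^ M) i) \<le> M * m" for M i
  proof (induction M arbitrary: i)
    case 0 then show ?case by (simp add: coeff_1)
  next
    case (Suc M)
    have "degree (coeff P j * coeff (P ^ M) (i - j)) \<le> Suc M * m" for j
      using degree_mult_le[of "coeff P j" "coeff (P ^ M) (i - j)"] deg[of j] Suc[of "i - j"] by simp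
    then show ?case by (simp add: coeff_mult degree_sum_le)
  qed
  \<comment> \<open>The case \<open>i = N + 1\<close>, in which no power of the constant coefficient is to be split off,
    is covered by the degree of the coefficient itself.\<close>
  define V where "V i = (if i \<le> N then W i + (\<Sum>t<i. g ^ (i - t - 1) * W t * coeff P (i - t))
      else coeff (P ^ Suc N) i)" for i
  have "coeff (P ^ Suc N) i = g ^ (Suc N - i) * V i \<and> degree (V i) \<le> i * m \<and> V i \<in> S" if i: "i \<le> Suc N" for i
  proof (cases "i \<le> N")
    case False
    then have iN: "i = Suc N" using i by simp
    have "P ^ Suc N \<in> polys_over S"
      using semiring_closed_power[OF semiring_closed_polys_over[OF S] P] .
    then show ?thesis using PN[of "Suc N" "Suc N"] unfolding V_def iN by (auto simp: polys_over_def)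
  next
    case True
    have "coeff (P ^ Suc N) i = (\<Sum>t\<le>i. coeff (P ^ N) t * coeff P (i - t))"
      by (simp add: coeff_mult power_Suc2 del: power_Suc)
    also have "\<dots> = coeff (P ^ N) i * g + (\<Sum>t<i. coeff (P ^ N) t * coeff P (i - t))"
      by (simp add: lessThan_Suc_atMost[symmetric] g_def)
    also have "coeff (P ^ N) i * g = g ^ (Suc N - i) * W i"
      using W(1)[OF True] True by (simp add: g_def Suc_diff_le mult_ac)
    also have "(\<Sum>t<i. coeff (P ^ N) t * coeff P (i - t)) = (\<Sum>t<i. g ^ (Suc N - i) * (g ^ (i - t - 1) * W t * coeff P (i - t)))"
    proof (rule sum.cong)
      fix t assume "t \<in> {..<i}"
      then have t: "t < i" "t \<le> N" "N - t = (Suc N - i) + (i - t - 1)" using True by auto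
      show "coeff (P ^ N) t * coeff P (i - t) = g ^ (Suc N - i) * (g ^ (i - t - 1) * W t * coeff P (i - t))"
        unfolding W(1)[OF t(2)] g_def[symmetric] t(3) by (simp add: power_add mult_ac)
    qed simp
    finally have "coeff (P ^ Suc N) i = g ^ (Suc N - i) * V i"
      using True by (simp add: V_def distrib_left sum_distrib_left)
    moreover have "degree (V i) \<le> i * m"
    proof -
      have "degree (g ^ (i - t - 1) * W t * coeff P (i - t)) \<le> i * m" if t: "t < i" for t
      proof -
        have "degree (g ^ (i - t - 1) * W t * coeff P (i - t))
          \<le> degree (g ^ (i - t - 1)) + degree (W t) + degree (coeff P (i - t))"
          by (meson add_mono degree_mult_le le_refl le_trans)
        also have "\<dots> \<le> m * (i - t - 1) + t * m + m"
          using degree_power_le[of g "i - t - 1"] degg W(2)[of t] deg[of "i - t"] t True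
          by (intro add_mono) (auto intro: le_trans[OF _ mult_le_mono1])
        also have "\<dots> = ((i - t - 1) + t + 1) * m" by (simp add: algebra_simps)
        also have "(i - t - 1) + t + 1 = i" using t by simp
        finally show ?thesis .
      qed
      then show ?thesis using W(2)[OF True] True
        unfolding V_def by (auto intro!: degree_add_le degree_sum_le)
    qed
    moreover have "V i \<in> S"
      using True PS W(3) semiring_closed_power[OF S PS[of 0]] unfolding V_def g_def
      by (auto intro!: semiring_closedD(3,4)[OF S] semiring_closed_sum[OF S])
    ultimately show ?thesis by blast
  qed
  then show ?case unfolding g_def by blast
qed

lemma frobenius_add:
  fixes a b E :: "'s::comm_ring_1"
  assumes "\<And>i. 0 < i \<Longrightarrow> i < q \<Longrightarrow> of_nat (q choose i) * E = 0" and "q > 0"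
  shows "E * (a + b) ^ q = E * (a ^ q + b ^ q)"
proof -
  have "E * (a + b) ^ q = (\<Sum>k\<le>q. (of_nat (q choose k) * E) * (a ^ k * b ^ (q - k)))"
    by (simp add: binomial_ring sum_distrib_left mult_ac)
  also have "\<dots> = (\<Sum>k\<in>{0, q}. (of_nat (q choose k) * E) * (a ^ k * b ^ (q - k)))"
    by (rule sum.mono_neutral_right) (auto simp: assms)
  also have "\<dots> = E * (a ^ q + b ^ q)" using assms(2) by (simp add: algebra_simps)
  finally show ?thesis .
qed

section \<open>Stepanov's method\<close>

locale finite_field_idem = closed_idem e for e :: "'r::comm_ring_1" +
  fixes K :: "'r set" and q :: nat
  assumes K_closed: "x \<in> K \<Longrightarrow> e * x = x"
    and K_finite: "finite K" and K_card: "card K = q" and q_odd: "odd q"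
    and K_add: "x \<in> K \<Longrightarrow> y \<in> K \<Longrightarrow> x + y \<in> K"
    and K_mult: "x \<in> K \<Longrightarrow> y \<in> K \<Longrightarrow> x * y \<in> K"
    and K_uminus: "x \<in> K \<Longrightarrow> - x \<in> K"
    and K_0: "0 \<in> K" and K_e: "e \<in> K"
    and K_pow: "x \<in> K \<Longrightarrow> x ^ q = x"
begin

lemma q_ge_3: "q \<ge> 3"
proof -
  have "card {0, e} \<le> q" unfolding K_card[symmetric] using K_0 K_e K_finite by (intro card_mono) auto
  then have "q \<ge> 2" using e_nonzero by (simp add: card_insert_if)
  then show ?thesis using q_odd by (cases "q = 2") auto
qed

lemma K_diff: "x \<in> K \<Longrightarrow> y \<in> K \<Longrightarrow> x - y \<in> K"
  using K_add[of x "- y"] K_uminus by simp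

lemma e_power: "n > 0 \<Longrightarrow> e ^ n = e"
  by (induction n) (auto simp: idem, metis One_nat_def idem mult.right_neutral neq0_conv power_0)

text \<open>
  The polynomial \<open>(X + 1)\<^sup>q - X\<^sup>q - 1\<close> has degree less than \<open>q\<close> and vanishes on the \<open>q\<close> elements of \<open>K\<close>.
  This yields the Frobenius identity without reference to the characteristic.
\<close>

lemma binomial_vanish:
  assumes "0 < i" "i < q" shows "of_nat (q choose i) * e = 0"
proof -
  define p where "p = (\<Sum>i\<in>{1..<q}. monom (of_nat (q choose i) * e) i)"
  have co: "coeff p j = (if 0 < j \<and> j < q then of_nat (q choose j) * e else 0)" for j
    unfolding p_def by (auto simp: coeff_sum sum.delta)
  have sp: "smult e p = p" by (rule poly_eqI) (auto simp: co, metis idem mult.assoc mult.commute)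
  have root: "poly p x = 0" if x: "x \<in> K" for x
  proof -
    have "x + e = (x + e) ^ q" using x K_add K_e K_pow by simp
    also have "\<dots> = (\<Sum>k\<le>q. of_nat (q choose k) * x ^ k * e ^ (q - k))" by (simp add: binomial_ring)
    also have "{..q} = insert 0 (insert q {1..<q})" using assms by auto
    also have "(\<Sum>k\<in>insert 0 (insert q {1..<q}). of_nat (q choose k) * x ^ k * e ^ (q - k))
        = e + (x + (\<Sum>k\<in>{1..<q}. of_nat (q choose k) * x ^ k * e ^ (q - k)))"
      using assms x K_pow e_power[of q] by simp
    also have "(\<Sum>k\<in>{1..<q}. of_nat (q choose k) * x ^ k * e ^ (q - k)) = poly p x"
      unfolding p_def poly_sum by (rule sum.cong) (auto simp: poly_monom e_power mult_ac)
    finally show ?thesis by simp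
  qed
  have "degree p \<le> q - 1" by (rule degree_le) (auto simp: co)
  then have "p = 0"
    using poly_zero_if_many_roots[OF sp K_finite] root K_closed K_card assms by fastforce
  then show ?thesis using co[of i] assms by simp
qed

lemma frobenius_poly: "smult e ((a + b) ^ q) = smult e (a ^ q + b ^ q)"
proof -
  have "[:e:] * (a + b) ^ q = [:e:] * (a ^ q + b ^ q)"
    by (rule frobenius_add) (use binomial_vanish q_ge_3 in \<open>auto simp: of_nat_poly mult.commute\<close>)
  then show ?thesis by simp
qed

text \<open>
  By Frobenius, \<open>f\<^sup>q = f(0)\<^sup>q + X\<^sup>q (\<dots>)\<close>, and \<open>f(0)\<^sup>q = f(0)\<close>.
\<close>

lemma power_q_poly:
  assumes "smult e f = f" "coeff f 0 \<in> K"
  shows "\<exists>w. f ^ q = [:coeff f 0:] + monom 1 q * w"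
proof -
  obtain c f' where f: "f = pCons c f'" by (cases f)
  have c: "c \<in> K" "c ^ q = c" using assms f K_pow by auto
  have "f = [:c:] + monom 1 1 * f'" using f by (simp add: monom_Suc)
  then have "smult e (f ^ q) = smult e ([:c:] ^ q + (monom 1 1 * f') ^ q)" using frobenius_poly by metis
  also have "[:c:] ^ q = [:c:]" using c(2) by (simp add: poly_const_pow)
  also have "(monom 1 1 * f') ^ q = monom 1 q * f' ^ q" by (simp add: power_mult_distrib monom_power)
  finally have "smult e (f ^ q) = [:c:] + monom 1 q * smult e (f' ^ q)"
    using K_closed[OF c(1)] by (simp add: smult_add_right)
  moreover have "smult e (f ^ q) = f ^ q"
    using assms(1) q_ge_3 by (cases q) (auto, metis mult_smult_left)
  ultimately have "f ^ q = [:coeff f 0:] + monom 1 q * smult e (f' ^ q)" using f by simp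
  then show ?thesis by blast
qed

text \<open>
  By Frobenius, \<open>(X + x)\<^bsup>jq\<^esup> = (X\<^sup>q + x)\<^sup>j\<close> for \<open>x \<in> K\<close>: to order less than \<open>q\<close> at \<open>x\<close>, the power \<open>X\<^bsup>jq\<^esup>\<close>
  behaves like the constant \<open>x\<^sup>j\<close>.
\<close>

lemma shift_power:
  assumes "x \<in> K"
  shows "\<exists>w. smult e ([:x, 1:] ^ (j * q)) = smult e ([:x ^ j:] + monom 1 q * w)"
proof (induction j)
  case 0
  then show ?case by (intro exI[of _ 0]) (simp add: one_pCons)
next
  case (Suc j)
  then obtain w where w: "smult e ([:x, 1:] ^ (j * q)) = smult e ([:x ^ j:] + monom 1 q * w)" by blast
  have "smult e ([:x, 1:] ^ q) = smult e (([:x:] + monom 1 1) ^ q)" by (simp add: monom_Suc one_pCons)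
  also have "\<dots> = smult e ([:x:] ^ q + monom 1 1 ^ q)" by (rule frobenius_poly)
  also have "[:x:] ^ q = [:x:]" using assms K_pow by (simp add: poly_const_pow)
  finally have 1: "smult e ([:x, 1:] ^ q) = smult e ([:x:] + monom 1 q)" by (simp add: monom_power)
  have "smult e ([:x, 1:] ^ (Suc j * q)) = smult e ([:x, 1:] ^ q) * smult e ([:x, 1:] ^ (j * q))"
    by (simp add: power_add idem)
  also have "\<dots> = smult e (([:x:] + monom 1 q) * ([:x ^ j:] + monom 1 q * w))"
    unfolding 1 w by (simp add: idem)
  also have "([:x:] + monom 1 q) * ([:x ^ j:] + monom 1 q * w)
      = [:x ^ Suc j:] + monom 1 q * ([:x:] * w + ([:x ^ j:] + monom 1 q * w))"
    by (simp add: algebra_simps)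
  finally show ?case by blast
qed

lemma monom_mult_zero: "monom 1 k * p = 0 \<Longrightarrow> p = (0 :: 'r poly)"
  by (rule poly_eqI) (metis add_diff_cancel_left' coeff_0 coeff_monom_mult mult_1 not_add_less1)

text \<open>
  This guarantees that the auxiliary polynomial is not zero. Split off the terms with \<open>j = 0\<close> and write
  the relation as \<open>h\<^sub>0 = - h\<^sub>1 g\<^sup>n\<close>. Squaring and multiplying by \<open>g\<close> gives \<open>h\<^sub>0\<^sup>2 g = h\<^sub>1\<^sup>2 g\<^sup>q\<close>, which reads
  \<open>r\<^sub>0\<^sup>2 g = g(0) s\<^sub>0\<^sup>2\<close> modulo \<open>X\<^sup>q\<close>. Both sides have degree less than \<open>q\<close>, so they are equal; as \<open>g\<close> is
  not a constant times a square, \<open>r\<^sub>0 = s\<^sub>0 = 0\<close>, and a factor \<open>X\<^sup>q\<close> cancels.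
\<close>

lemma stepanov_nonzero:
  assumes g: "smult e g = g" "coeff g 0 \<in> K" "coeff g 0 \<noteq> 0" "degree g \<le> m" "\<not> const_square g"
    and n: "q = 2 * n + 1" and b: "2 * b + m < q"
    and r: "\<And>j. j < J \<Longrightarrow> smult e (r j) = r j \<and> degree (r j) \<le> b"
    and s: "\<And>j. j < J \<Longrightarrow> smult e (s j) = s j \<and> degree (s j) \<le> b"
    and zero: "(\<Sum>j<J. (r j + s j * g ^ n) * monom 1 (j * q)) = 0"
  shows "\<forall>j<J. r j = 0 \<and> s j = 0"
  using r s zero
proof (induction J arbitrary: r s)
  case 0
  then show ?case by simp
next
  case (Suc J)
  define R where "R = (\<Sum>j<J. r (Suc j) * monom 1 (j * q))"
  define S where "S = (\<Sum>j<J. s (Suc j) * monom 1 (j * q))"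
  define h1 where "h1 = s 0 + monom 1 q * S"
  define h0 where "h0 = r 0 + monom 1 q * R"
  have split: "(\<Sum>j<Suc J. (r j + s j * g ^ n) * monom 1 (j * q))
      = (r 0 + s 0 * g ^ n) + monom 1 q * (\<Sum>j<J. (r (Suc j) + s (Suc j) * g ^ n) * monom 1 (j * q))"
  proof -
    have "monom (1::'r) (Suc j * q) = monom 1 q * monom 1 (j * q)" for j by (simp add: mult_monom)
    then show ?thesis unfolding sum.lessThan_Suc_shift sum_distrib_left
      by (simp only: mult_0 monom_0 mult.left_commute flip: one_pCons) simp
  qed
  have R': "(\<Sum>j<J. (r (Suc j) + s (Suc j) * g ^ n) * monom 1 (j * q)) = R + S * g ^ n"
    unfolding R_def S_def sum_distrib_right sum.distrib[symmetric]
    by (intro sum.cong refl) (simp only: distrib_right mult.assoc mult.commute[of "g ^ n"])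
  have "h0 + h1 * g ^ n = 0"
    using Suc.prems(3) unfolding split R' h0_def h1_def by (simp add: algebra_simps)
  then have h0: "h0 = - (h1 * g ^ n)" by (simp add: add_eq_0_iff2)
  obtain w where w: "g ^ q = [:coeff g 0:] + monom 1 q * w" using power_q_poly g by blast
  have "h0 * h0 * g = h1 * h1 * g ^ q"
  proof -
    have 1: "h0 * h0 = (h1 * g ^ n) * (h1 * g ^ n)" unfolding h0 by simp
    have 2: "g ^ q = g * (g ^ n * g ^ n)" unfolding n by (simp add: mult_2 power_add)
    show ?thesis unfolding 1 2 by (simp only: mult_ac)
  qed
  then have "(r 0 * r 0) * g - smult (coeff g 0) (s 0 * s 0)
      = monom 1 q * (s 0 * s 0 * w + (2 * s 0 * S + monom 1 q * S * S) * ([:coeff g 0:] + monom 1 q * w)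
          - (2 * r 0 * R + monom 1 q * R * R) * g)"
    unfolding w h0_def h1_def by (simp add: algebra_simps)
  then obtain z where z: "(r 0 * r 0) * g - smult (coeff g 0) (s 0 * s 0) = monom 1 q * z" by blast
  have "degree ((r 0 * r 0) * g) \<le> 2 * b + m"
    using degree_mult_le[of "r 0 * r 0" g] degree_mult_le[of "r 0" "r 0"] Suc.prems(1)[of 0] g(4) by simp
  moreover have "degree (smult (coeff g 0) (s 0 * s 0)) \<le> 2 * b + m"
    using degree_smult_le[of "coeff g 0" "s 0 * s 0"] degree_mult_le[of "s 0" "s 0"] Suc.prems(2)[of 0] by simp
  ultimately have "degree (monom 1 q * z) < q"
    unfolding z[symmetric] using b by (meson degree_diff_le le_less_trans)
  then have "coeff z i = 0" for i
    using coeff_monom_mult[of 1 q z "i + q"] coeff_eq_0[of "monom 1 q * z" "i + q"] by simp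
  then have "z = 0" by (simp add: poly_eqI)
  then have eq: "g * (r 0 * r 0) = smult (coeff g 0) (s 0 * s 0)" using z by (simp add: mult.commute)
  have r0: "r 0 = 0"
    using const_square_of_square_multiple[OF g(1) _ _ K_closed[OF g(2)] _ eq] Suc.prems(1,2)[of 0] g(5) by blast
  have s0: "s 0 = 0"
  proof (rule ccontr)
    assume nz: "s 0 \<noteq> 0"
    have cl: "smult e (s 0) = s 0" using Suc.prems(2) by simp
    have prod: "[:coeff g 0:] * (s 0 * s 0) = 0" using eq r0 by simp
    have cl2: "smult e (s 0 * s 0) = s 0 * s 0" using cl by (metis mult_smult_left)
    have nz2: "s 0 * s 0 \<noteq> 0" using poly_no_zero_divisors[OF cl cl] nz by blast
    have cl3: "smult e [:coeff g 0:] = [:coeff g 0:]" using K_closed[OF g(2)] by simp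
    have "[:coeff g 0:] = 0" using poly_no_zero_divisors[OF cl3 cl2 prod] nz2 by blast
    then show False using g(3) by simp
  qed
  have "(r 0 + s 0 * g ^ n) + monom 1 q * (\<Sum>j<J. (r (Suc j) + s (Suc j) * g ^ n) * monom 1 (j * q)) = 0"
    using Suc.prems(3) split by (simp only:)
  then have "monom 1 q * (\<Sum>j<J. (r (Suc j) + s (Suc j) * g ^ n) * monom 1 (j * q)) = 0"
    by (simp only: r0 s0 mult_zero_left add_0_left)
  then have "(\<Sum>j<J. (r (Suc j) + s (Suc j) * g ^ n) * monom 1 (j * q)) = 0"
    by (rule monom_mult_zero)
  moreover have "smult e (r (Suc j)) = r (Suc j) \<and> degree (r (Suc j)) \<le> b"
    "smult e (s (Suc j)) = s (Suc j) \<and> degree (s (Suc j)) \<le> b" if "j < J" for j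
    using Suc.prems(1)[OF Suc_mono[OF that]] Suc.prems(2)[OF Suc_mono[OF that]] .
  ultimately have "\<forall>j<J. r (Suc j) = 0 \<and> s (Suc j) = 0"
    by (intro Suc.IH[of "\<lambda>j. r (Suc j)" "\<lambda>j. s (Suc j)"])
  then show ?case using r0 s0 by (metis less_Suc_eq_0_disj)
qed

end

context prime_idem
begin

text \<open>
  A linear factor \<open>X - x\<close> can be split off \<open>l\<close> times, and being invertible at the other points it does
  not affect the orders of vanishing there.
\<close>

lemma vanishing_order_degree:
  assumes "finite S" "\<And>x. x \<in> S \<Longrightarrow> e * x = x" "smult e R = R" "R \<noteq> 0"
    and "\<And>x i. x \<in> S \<Longrightarrow> i < l \<Longrightarrow> coeff (pcompose R [:x, 1:]) i = 0"
  shows "l * card S \<le> degree R"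
  using assms
proof (induction S arbitrary: R rule: finite_induct)
  case empty
  then show ?case by simp
next
  case (insert x S)
  have "monom 1 l dvd pcompose R [:x, 1:]"
    using insert.prems(4) monom_1_dvd_iff' by blast
  then obtain Q where Q: "pcompose R [:x, 1:] = monom 1 l * Q" by (auto elim: dvdE)
  have "R = pcompose (pcompose R [:x, 1:]) [:- x, 1:]"
    by (simp add: pcompose_pCons flip: pcompose_assoc)
  also have "\<dots> = pcompose (monom 1 1 ^ l) [:- x, 1:] * pcompose Q [:- x, 1:]"
    unfolding Q pcompose_mult by (simp add: monom_power)
  also have "pcompose (monom 1 1 ^ l) [:- x, 1:] = [:- x, 1:] ^ l"
    unfolding pcompose_power by (simp add: monom_Suc pcompose_pCons pcompose_1)
  finally have RQ: "R = [:- x, 1:] ^ l * pcompose Q [:- x, 1:]" .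
  define R1 where "R1 = smult e (pcompose Q [:- x, 1:])"
  have x: "e * x = x" using insert.prems(1) by simp
  have lin: "smult e [:- x, e:] = [:- x, e:]" using linear_closed[OF x] .
  have e_lin: "smult e ([:- x, 1:] ^ l) = smult e ([:- x, e:] ^ l)"
  proof (induction l)
    case (Suc l)
    have "smult e ([:- x, 1:] ^ Suc l) = smult e [:- x, 1:] * smult e ([:- x, 1:] ^ l)"
      unfolding power_Suc mult_smult_left mult_smult_right smult_smult idem ..
    also have "\<dots> = [:- x, e:] * smult e ([:- x, e:] ^ l)" using Suc x by simp
    finally show ?case by simp
  qed simp
  have "R = smult e R" using insert.prems(2) by simp
  also have "\<dots> = smult e ([:- x, 1:] ^ l) * R1"
    unfolding R1_def RQ[symmetric] mult_smult_left mult_smult_right smult_smult idem using RQ by simp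
  finally have R: "R = smult e ([:- x, e:] ^ l) * R1" using e_lin by simp
  have R1: "smult e R1 = R1" "R1 \<noteq> 0"
    using R insert.prems(3) by (simp add: R1_def idem, metis mult_zero_right)
  have d: "degree (smult e ([:- x, e:] ^ l)) = l" "smult e ([:- x, e:] ^ l) \<noteq> 0"
    using degree_power[OF lin linear_nonzero, of l] unfolding degree_linear by simp_all
  have degR: "degree R = l + degree R1"
    using degree_mult[OF smult_idem R1(1) d(2) R1(2)] unfolding d(1) R[symmetric] .
  have "coeff (pcompose R1 [:y, 1:]) i = 0" if y: "y \<in> S" and i: "i < l" for y i
    using i
  proof (induction i rule: less_induct)
    case (less i)
    define Z where "Z = pcompose R1 [:y, 1:]"
    define P where "P = pcompose (smult e ([:- x, e:] ^ l)) [:y, 1:]"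
    have "P * Z = pcompose R [:y, 1:]" unfolding P_def Z_def pcompose_mult[symmetric] R[symmetric] ..
    \<comment> \<open>Only the constant coefficient of \<open>P\<close> contributes, since the lower coefficients of \<open>Z\<close> vanish
      by induction.\<close>
    then have "0 = coeff (P * Z) i" using insert.prems(4)[of y i] y less.prems by simp
    also have "\<dots> = (\<Sum>t\<le>i. coeff P t * coeff Z (i - t))" by (simp add: coeff_mult)
    also have "\<dots> = (\<Sum>t\<in>{0}. coeff P t * coeff Z (i - t))"
      by (rule sum.mono_neutral_right) (use less in \<open>auto simp: Z_def\<close>)
    finally have 1: "coeff P 0 * coeff Z i = 0" by simp
    have yx: "e * y = y" "y \<noteq> x" using y insert by auto
    have "coeff P 0 = e * (y - x) ^ l"
      unfolding P_def coeff_pcompose_shift coeff_taylor_0 using x yx by (simp add: poly_power mult.commute)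
    moreover have "e * (y - x) = y - x" using x yx by (simp add: algebra_simps)
    ultimately have 2: "coeff P 0 \<noteq> 0" "e * coeff P 0 = coeff P 0" using power_nonzero[of "y - x" l] yx by auto
    have "smult e Z = Z" using R1(1) by (metis Z_def pcompose_smult)
    then have "e * coeff Z i = coeff Z i" by (rule coeff_closed)
    then show ?case using 1 2 no_zero_divisors Z_def by blast
  qed
  then have "l * card S \<le> degree R1" using insert.IH[of R1] R1 insert.prems(1) by blast
  then show ?case using degR insert by simp
qed

end

lemma smult_sum_right: "smult c (sum f A) = (\<Sum>i\<in>A. smult c (f i))"
  by (induction A rule: infinite_finite_induct) (simp_all add: smult_add_right)

context finite_field_idem
begin

text \<open>
  The subring of all ring elements whose component in the field lies in \<open>K\<close>. Unlike \<open>K\<close> it contains \<open>1\<close>,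
  so that it is closed under powers and under empty products.
\<close>

definition K1 :: "'r set" where "K1 = {x. e * x \<in> K}"

lemma K1_closed: "semiring_closed K1"
proof -
  have "e * (x * y) \<in> K" if "e * x \<in> K" "e * y \<in> K" for x y
    using K_mult[OF that] by (metis idem mult.assoc mult.commute)
  then show ?thesis using K_0 K_e K_add unfolding semiring_closed_def K1_def by (auto simp: distrib_left)
qed

lemma K_sub_K1: "x \<in> K \<Longrightarrow> x \<in> K1"
  using K_closed by (simp add: K1_def)

text \<open>
  The polynomial left over from the \<open>i\<close>-th Taylor coefficient of \<open>g\<^sup>N z\<close> after division by \<open>g\<^bsup>N-i\<^esup>\<close>, where
  \<open>W\<close> describes the Taylor coefficients of \<open>g\<^sup>N\<close> as in \<open>coeff_power_structure\<close>.
\<close>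

definition hasse :: "'r poly \<Rightarrow> (nat \<Rightarrow> 'r poly) \<Rightarrow> nat \<Rightarrow> 'r poly \<Rightarrow> 'r poly"
  where "hasse g W i z = (\<Sum>t\<le>i. g ^ (i - t) * W t * coeff (taylor z) (i - t))"

lemma hasse_diff: "hasse g W i (z - z') = hasse g W i z - hasse g W i z'"
  by (simp add: hasse_def taylor_diff algebra_simps sum_subtractf)

lemma hasse_degree:
  assumes "degree g \<le> m" "\<And>t. t \<le> i \<Longrightarrow> degree (W t) \<le> t * m" "degree z \<le> b"
  shows "degree (hasse g W i z) \<le> i * m + b"
proof -
  have "degree (g ^ (i - t) * W t * coeff (taylor z) (i - t)) \<le> i * m + b" if t: "t \<le> i" for t
  proof -
    have "degree (g ^ (i - t) * W t * coeff (taylor z) (i - t))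
      \<le> degree (g ^ (i - t)) + degree (W t) + degree (coeff (taylor z) (i - t))"
      by (meson add_mono degree_mult_le le_refl le_trans)
    also have "\<dots> \<le> m * (i - t) + t * m + b"
      using degree_power_le[of g "i - t"] assms(1) assms(2)[OF t] degree_coeff_taylor[of z "i - t"] assms(3)
      by (intro add_mono) (auto intro: le_trans[OF _ mult_le_mono1] le_trans)
    also have "m * (i - t) + t * m = i * m" using t by (metis add.commute distrib_right le_add_diff_inverse mult.commute)
    finally show ?thesis .
  qed
  then show ?thesis unfolding hasse_def by (auto intro!: degree_sum_le)
qed

lemma hasse_over:
  assumes S: "semiring_closed S" and "g \<in> polys_over S" "\<And>t. t \<le> i \<Longrightarrow> W t \<in> polys_over S" "z \<in> polys_over S"
  shows "hasse g W i z \<in> polys_over S"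
proof -
  note S1 = semiring_closed_polys_over[OF S]
  have "coeff (taylor z) j \<in> polys_over S" for j
    using taylor_over[OF S assms(4)] unfolding polys_over_def[of "polys_over S"] by blast
  then show ?thesis unfolding hasse_def
    using assms(2,3) by (auto intro!: semiring_closed_sum[OF S1] semiring_closedD(4)[OF S1] semiring_closed_power[OF S1])
qed

lemma coeff_taylor_power_mult:
  assumes W: "\<And>i. i \<le> N \<Longrightarrow> coeff (taylor g ^ N) i = g ^ (N - i) * W i" and i: "i \<le> N"
  shows "coeff (taylor (g ^ N * z)) i = g ^ (N - i) * hasse g W i z"
proof -
  have "coeff (taylor (g ^ N * z)) i = (\<Sum>t\<le>i. coeff (taylor g ^ N) t * coeff (taylor z) (i - t))"
    by (simp add: taylor_mult taylor_power coeff_mult)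
  also have "\<dots> = (\<Sum>t\<le>i. g ^ (N - i) * (g ^ (i - t) * W t * coeff (taylor z) (i - t)))"
  proof (rule sum.cong)
    fix t assume "t \<in> {..i}"
    then have t: "t \<le> N" "N - t = (N - i) + (i - t)" using i by auto
    show "coeff (taylor g ^ N) t * coeff (taylor z) (i - t) = g ^ (N - i) * (g ^ (i - t) * W t * coeff (taylor z) (i - t))"
      unfolding W[OF t(1)] t(2) by (simp add: power_add mult_ac)
  qed simp
  finally show ?thesis by (simp add: hasse_def sum_distrib_left)
qed

lemma coeff_shift_mult_monom:
  assumes "x \<in> K" "i < q"
  shows "e * coeff (pcompose (z * monom 1 (j * q)) [:x, 1:]) i = e * (x ^ j * coeff (pcompose z [:x, 1:]) i)"
proof -
  obtain w where w: "smult e ([:x, 1:] ^ (j * q)) = smult e ([:x ^ j:] + monom 1 q * w)"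
    using shift_power[OF assms(1)] by blast
  let ?Z = "pcompose z [:x, 1:]"
  have "pcompose (monom 1 1 ^ (j * q)) [:x, 1:] = [:x, 1:] ^ (j * q)"
    unfolding pcompose_power by (simp add: monom_Suc pcompose_pCons pcompose_1)
  then have "smult e (pcompose (z * monom 1 (j * q)) [:x, 1:]) = ?Z * smult e ([:x, 1:] ^ (j * q))"
    by (simp add: pcompose_mult monom_power)
  also have "\<dots> = smult e (smult (x ^ j) ?Z + monom 1 q * (w * ?Z))"
    unfolding w by (simp add: algebra_simps smult_add_right)
  finally have "coeff (smult e (pcompose (z * monom 1 (j * q)) [:x, 1:])) i
      = coeff (smult e (smult (x ^ j) ?Z + monom 1 q * (w * ?Z))) i" by simp
  then show ?thesis using assms(2) by (simp add: coeff_monom_mult)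
qed

text \<open>
  The auxiliary polynomial is \<open>R = g\<^sup>l \<Sum>\<^sub>j (r\<^sub>j + s\<^sub>j g\<^sup>n) X\<^bsup>jq\<^esup>\<close> with \<open>r\<^sub>j, s\<^sub>j\<close> of degree less than \<open>B\<close>. At
  a point \<open>x \<in> K\<close> with \<open>g(x)\<^sup>n = a\<close> its \<open>i\<close>-th Taylor coefficient is \<open>g(x)\<^bsup>l-i\<^esup> \<sigma>\<^sub>i(x)\<close>, where \<open>\<sigma>\<^sub>i\<close> has
  degree less than \<open>l m + B + J\<close> and depends additively on the \<open>r\<^sub>j, s\<^sub>j\<close>. There are \<open>2 J B\<close> free
  coefficients in \<open>K\<close> and at most \<open>l (l m + B + J)\<close> coefficients of \<open>\<sigma>\<^sub>0, \<dots>, \<sigma>\<^bsub>l-1\<^esub>\<close>; if the former number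
  is larger, two choices have the same \<open>\<sigma>\<^sub>i\<close>, and their difference makes \<open>R\<close> vanish to order \<open>l\<close> at all
  these points.
\<close>

lemma stepanov_count:
  assumes g: "smult e g = g" "\<And>i. coeff g i \<in> K" "coeff g 0 \<noteq> 0" "degree g \<le> m" "\<not> const_square g"
    and n: "q = 2 * n + 1" and B: "B \<ge> 1" "2 * B + m < q + 2" and l: "l \<le> q"
    and a: "a \<in> K" and count: "l * (l * m + B + J) < 2 * J * B"
  shows "l * card {x\<in>K. poly g x ^ n = a} \<le> l * m + B + n * m + J * q"
proof -
  define M where "M = l * m + B + J"
  \<comment> \<open>A vector \<open>u\<close> of coefficients in \<open>K\<close> encodes all \<open>r\<^sub>j\<close> (first index true) and \<open>s\<^sub>j\<close> (first index
    false).\<close>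
  define rr where "rr c u j = (\<Sum>b<B. monom (u (c, j, b)) b)" for c :: bool and u :: "bool \<times> nat \<times> nat \<Rightarrow> 'r" and j
  have co_rr: "coeff (rr c u j) b = (if b < B then u (c, j, b) else 0)" for c u j b
    unfolding rr_def by (auto simp: coeff_sum sum.delta)
  note K1p = semiring_closed_polys_over[OF K1_closed]
  have gK1: "g \<in> polys_over K1" using g(2) K_sub_K1 by (auto simp: polys_over_def)
  have tg: "taylor g \<in> polys_over (polys_over K1)" using taylor_over[OF K1_closed gK1] .
  have tdeg: "degree (coeff (taylor g) i) \<le> m" for i using degree_coeff_taylor[of g i] g(4) by simp
  have exW: "\<exists>W. \<forall>i\<le>N. coeff (taylor g ^ N) i = g ^ (N - i) * W i \<and> degree (W i) \<le> i * m \<and> W i \<in> polys_over K1" for N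
    using coeff_power_structure[OF K1p tg tdeg, of N] by (simp add: coeff_taylor_0)
  obtain W1 where W1: "\<And>i. i \<le> l \<Longrightarrow> coeff (taylor g ^ l) i = g ^ (l - i) * W1 i"
    "\<And>i. i \<le> l \<Longrightarrow> degree (W1 i) \<le> i * m" "\<And>i. i \<le> l \<Longrightarrow> W1 i \<in> polys_over K1" using exW[of l] by blast
  obtain W2 where W2: "\<And>i. i \<le> l + n \<Longrightarrow> coeff (taylor g ^ (l + n)) i = g ^ (l + n - i) * W2 i"
    "\<And>i. i \<le> l + n \<Longrightarrow> degree (W2 i) \<le> i * m" "\<And>i. i \<le> l + n \<Longrightarrow> W2 i \<in> polys_over K1" using exW[of "l + n"] by blast
  define \<sigma> where "\<sigma> r s i = (\<Sum>j<J. (hasse g W1 i (r j) + smult a (hasse g W2 i (s j))) * monom 1 j)"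
    for r s :: "nat \<Rightarrow> 'r poly" and i
  have \<sigma>_diff: "\<sigma> (\<lambda>j. r j - r' j) (\<lambda>j. s j - s' j) i = \<sigma> r s i - \<sigma> r' s' i" for r r' s s' i
    by (simp add: \<sigma>_def hasse_diff smult_diff_right algebra_simps sum_subtractf)
  define D where "D = ((UNIV :: bool set) \<times> {..<J} \<times> {..<B}) \<rightarrow>\<^sub>E K"
  define T where "T = ({..<l} \<times> {..<M}) \<rightarrow>\<^sub>E K"
  define \<Phi> where "\<Phi> u = restrict (\<lambda>(i, N). e * coeff (\<sigma> (rr True u) (rr False u) i) N) ({..<l} \<times> {..<M})" for u
  have cardD: "card D = q ^ (2 * J * B)"
    unfolding D_def by (simp add: card_PiE K_card card_cartesian_product mult.assoc)
  have cardT: "card T = q ^ (l * M)"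
    unfolding T_def by (simp add: card_PiE K_card card_cartesian_product)
  have \<Phi>T: "\<Phi> ` D \<subseteq> T"
  proof
    fix v assume "v \<in> \<Phi> ` D"
    then obtain u where u: "u \<in> D" "v = \<Phi> u" by blast
    have rrK: "rr c u j \<in> polys_over K1" if "j < J" for c j
      using u(1) that semiring_closedD(1)[OF K1_closed] K_sub_K1 unfolding polys_over_def D_def by (auto simp: co_rr)
    have aK: "[:a:] \<in> polys_over K1"
      using K_sub_K1[OF a] polys_over_pCons[OF K1_closed, of a 0] semiring_closedD(1)[OF K1p] by simp
    have mK: "monom 1 j \<in> polys_over K1" for j
      using semiring_closedD(1,2)[OF K1_closed] by (auto simp: polys_over_def)
    have "\<sigma> (rr True u) (rr False u) i \<in> polys_over K1" if i: "i < l" for i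
    proof -
      have "hasse g W1 i (rr True u j) + [:a:] * hasse g W2 i (rr False u j) \<in> polys_over K1" if j: "j < J" for j
        using hasse_over[OF K1_closed gK1, of i W1 "rr True u j"] hasse_over[OF K1_closed gK1, of i W2 "rr False u j"]
          W1(3) W2(3) i rrK[OF j] aK
        by (intro semiring_closedD(3,4)[OF K1p]) auto
      then show ?thesis unfolding \<sigma>_def
        by (intro semiring_closed_sum[OF K1p] semiring_closedD(4)[OF K1p] mK) simp
    qed
    then show "v \<in> T" unfolding u(2) \<Phi>_def T_def by (auto simp: polys_over_def K1_def)
  qed
  have "card (\<Phi> ` D) \<le> q ^ (l * M)"
    using card_mono[OF _ \<Phi>T] cardT K_finite unfolding T_def by (simp add: finite_PiE)
  also have "\<dots> < card D"
    unfolding cardD M_def using count q_ge_3 by (intro power_strict_increasing) auto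
  finally have "\<not> inj_on \<Phi> D" by (rule pigeonhole)
  then obtain u u' where u: "u \<in> D" "u' \<in> D" "u \<noteq> u'" "\<Phi> u = \<Phi> u'" unfolding inj_on_def by blast
  define r where "r j = rr True u j - rr True u' j" for j
  define s where "s j = rr False u j - rr False u' j" for j
  have rrL: "smult e (rr c v j) = rr c v j" if "v \<in> D" "j < J" for c v j
    using that K_closed unfolding D_def by (intro poly_eqI) (auto simp: co_rr)
  have rr_deg: "degree (rr c v j) \<le> B - 1" for c v j
    using B(1) by (intro degree_le) (auto simp: co_rr)
  have r: "smult e (r j) = r j \<and> degree (r j) \<le> B - 1" and s: "smult e (s j) = s j \<and> degree (s j) \<le> B - 1"
    if "j < J" for j
    using rrL[OF u(1) that] rrL[OF u(2) that] rr_deg unfolding r_def s_def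
    by (auto simp: smult_diff_right intro: degree_diff_le)
  have \<sigma>0: "smult e (\<sigma> r s i) = 0" if i: "i < l" for i
  proof (rule poly_eqI)
    fix N
    show "coeff (smult e (\<sigma> r s i)) N = coeff 0 N"
    proof (cases "N < M")
      case True
      then have "e * coeff (\<sigma> (rr True u) (rr False u) i) N = e * coeff (\<sigma> (rr True u') (rr False u') i) N"
        using fun_cong[OF u(4), of "(i, N)"] i by (simp add: \<Phi>_def)
      then show ?thesis unfolding r_def s_def \<sigma>_diff by (simp add: algebra_simps)
    next
      case False
      have "degree (\<sigma> r s i) \<le> l * m + (B - 1) + (J - 1)"
        unfolding \<sigma>_def
      proof (rule degree_sum_le)
        fix j assume "j \<in> {..<J}"
        then have j: "j < J" by simp
        have "degree (hasse g W1 i (r j)) \<le> i * m + (B - 1)" "degree (hasse g W2 i (s j)) \<le> i * m + (B - 1)"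
          using W1(2) W2(2) i r[OF j] s[OF j] by (auto intro!: hasse_degree g(4))
        then have "degree (hasse g W1 i (r j) + smult a (hasse g W2 i (s j))) \<le> i * m + (B - 1)"
          by (meson degree_add_le degree_smult_le le_trans)
        then have "degree ((hasse g W1 i (r j) + smult a (hasse g W2 i (s j))) * monom 1 j) \<le> i * m + (B - 1) + j"
          by (meson add_mono degree_mult_le degree_monom_le le_trans)
        moreover have "i * m \<le> l * m" using i by simp
        ultimately show "degree ((hasse g W1 i (r j) + smult a (hasse g W2 i (s j))) * monom 1 j) \<le> l * m + (B - 1) + (J - 1)"
          using j by linarith
      qed simp
      moreover have "J > 0" using count by (cases J) auto
      ultimately have "degree (\<sigma> r s i) < N" using False B(1) unfolding M_def by linarith
      then show ?thesis by (simp add: coeff_eq_0)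
    qed
  qed
  define w where "w j = g ^ l * r j + g ^ (l + n) * s j" for j
  define R where "R = (\<Sum>j<J. w j * monom 1 (j * q))"
  have R_eq: "R = g ^ l * (\<Sum>j<J. (r j + s j * g ^ n) * monom 1 (j * q))"
    unfolding R_def w_def by (simp add: sum_distrib_left algebra_simps power_add)
  have nz: "(\<Sum>j<J. (r j + s j * g ^ n) * monom 1 (j * q)) \<noteq> 0"
  proof
    assume "(\<Sum>j<J. (r j + s j * g ^ n) * monom 1 (j * q)) = 0"
    then have z: "\<forall>j<J. r j = 0 \<and> s j = 0"
      using B by (intro stepanov_nonzero[OF g(1,2,3,4,5) n, of "B - 1" J r s] r s) auto
    have "u (c, j, b) = u' (c, j, b)" if "j < J" "b < B" for c j b
      using that z co_rr[of c u j b] co_rr[of c u' j b] unfolding r_def s_def by (cases c) auto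
    then have "u x = u' x" if "x \<in> UNIV \<times> {..<J} \<times> {..<B}" for x
      using that by (cases x) auto
    then have "u = u'" using u(1,2) unfolding D_def by (intro PiE_ext[of u _ _ u']) auto
    then show False using u(3) by simp
  qed
  have closed_sum: "smult e (\<Sum>j<J. (r j + s j * g ^ n) * monom 1 (j * q)) = (\<Sum>j<J. (r j + s j * g ^ n) * monom 1 (j * q))"
    unfolding smult_sum_right
  proof (rule sum.cong)
    fix j assume "j \<in> {..<J}"
    then have 1: "smult e (r j) = r j" "smult e (s j) = s j" using r s by auto
    have "smult e ((r j + s j * g ^ n) * monom 1 (j * q)) = (smult e (r j) + smult e (s j) * g ^ n) * monom 1 (j * q)"
      by (simp only: mult_smult_left smult_add_right[symmetric])
    then show "smult e ((r j + s j * g ^ n) * monom 1 (j * q)) = (r j + s j * g ^ n) * monom 1 (j * q)"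
      unfolding 1 .
  qed simp
  have gn0: "g \<noteq> 0" using g(3) by auto
  have R_eq2: "R = smult e (g ^ l) * (\<Sum>j<J. (r j + s j * g ^ n) * monom 1 (j * q))"
    unfolding R_eq mult_smult_left mult_smult_right[symmetric] closed_sum ..
  have RL: "smult e R = R" unfolding R_eq2 mult_smult_left[symmetric] smult_idem ..
  have "smult e (g ^ l) \<noteq> 0" using degree_power[OF g(1) gn0, of l] by blast
  then have Rn: "R \<noteq> 0"
    using poly_no_zero_divisors[OF smult_idem closed_sum, of "g ^ l"] nz unfolding R_eq2 by argo
  have Rdeg: "degree R \<le> l * m + B + n * m + J * q"
    unfolding R_def
  proof (rule degree_sum_le)
    fix j assume "j \<in> {..<J}"
    then have j: "j < J" by simp
    have "degree (g ^ N * z) \<le> N * m + (B - 1)" if "degree z \<le> B - 1" for N z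
    proof -
      have "degree (g ^ N * z) \<le> degree (g ^ N) + degree z" by (rule degree_mult_le)
      also have "\<dots> \<le> m * N + (B - 1)"
        using degree_power_le[of g N] g(4) that by (intro add_mono) (auto intro: le_trans[OF _ mult_le_mono1])
      finally show ?thesis by (simp add: mult.commute)
    qed
    then have "degree (g ^ l * r j) \<le> l * m + (B - 1)" "degree (g ^ (l + n) * s j) \<le> (l + n) * m + (B - 1)"
      using r[OF j] s[OF j] by auto
    then have "degree (w j) \<le> l * m + B + n * m"
      unfolding w_def by (intro degree_add_le) (auto simp: algebra_simps)
    then have "degree (w j * monom 1 (j * q)) \<le> l * m + B + n * m + j * q"
      by (meson add_mono degree_mult_le degree_monom_le le_trans)
    also have "\<dots> \<le> l * m + B + n * m + J * q" using j by simp
    finally show "degree (w j * monom 1 (j * q)) \<le> l * m + B + n * m + J * q" .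
  qed simp
  have "l * card {x\<in>K. poly g x ^ n = a} \<le> degree R"
  proof (rule vanishing_order_degree[OF _ _ RL Rn])
    show "finite {x\<in>K. poly g x ^ n = a}" using K_finite by simp
    show "e * x = x" if "x \<in> {x\<in>K. poly g x ^ n = a}" for x using that K_closed by simp
    fix x i assume "x \<in> {x\<in>K. poly g x ^ n = a}" and i: "i < l"
    then have x: "x \<in> K" "poly g x ^ n = a" by auto
    have wi: "coeff (pcompose (w j) [:x, 1:]) i
        = poly g x ^ (l - i) * poly (hasse g W1 i (r j) + smult a (hasse g W2 i (s j))) x" for j
    proof -
      have "coeff (taylor (w j)) i = g ^ (l - i) * hasse g W1 i (r j) + g ^ (l + n - i) * hasse g W2 i (s j)"
        unfolding w_def taylor_add coeff_add
        using coeff_taylor_power_mult[of l g W1 i "r j"] coeff_taylor_power_mult[of "l + n" g W2 i "s j"] W1(1) W2(1) i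
        by simp
      moreover have "l + n - i = (l - i) + n" using i by simp
      ultimately show ?thesis unfolding coeff_pcompose_shift by (simp add: x(2) power_add algebra_simps)
    qed
    have "e * coeff (pcompose R [:x, 1:]) i = (\<Sum>j<J. e * coeff (pcompose (w j * monom 1 (j * q)) [:x, 1:]) i)"
      by (simp add: R_def pcompose_sum coeff_sum sum_distrib_left)
    also have "\<dots> = (\<Sum>j<J. e * (x ^ j * coeff (pcompose (w j) [:x, 1:]) i))"
      using coeff_shift_mult_monom[OF x(1)] i l by simp
    also have "\<dots> = poly g x ^ (l - i) * poly (smult e (\<sigma> r s i)) x"
      unfolding wi \<sigma>_def by (simp add: poly_sum poly_monom sum_distrib_left mult_ac)
    also have "\<dots> = 0" unfolding \<sigma>0[OF i] by simp
    finally have "e * coeff (pcompose R [:x, 1:]) i = 0" .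
    moreover have "smult e (pcompose R [:x, 1:]) = pcompose R [:x, 1:]" using RL by (metis pcompose_smult)
    ultimately show "coeff (pcompose R [:x, 1:]) i = 0" using coeff_closed by metis
  qed
  then show ?thesis using Rdeg by simp
qed

end

section \<open>The Weil bound for the quadratic character\<close>

context finite_field_idem
begin

definition half :: nat where "half = (q - 1) div 2"

lemma q_half: "q = 2 * half + 1"
  using q_odd unfolding half_def by (auto elim: oddE)

lemma half_pos: "half \<ge> 1"
  using q_half q_ge_3 by linarith

text \<open>
  The quadratic character, in the form of Euler's criterion.
\<close>

definition chi :: "'r \<Rightarrow> int"
  where "chi x = (if x = 0 then 0 else if x ^ half = e then 1 else - 1)"

lemma e_neq_minus_e: "e \<noteq> - e"
proof
  assume "e = - e"
  then have "2 * e = 0" by (metis add_eq_0_iff mult_2)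
  then have "of_nat q * e = e"
  proof -
    obtain h where h: "q = 2 * h + 1" using q_odd by (auto elim: oddE)
    have "of_nat q * e = of_nat h * (2 * e) + e" unfolding h by (simp add: algebra_simps)
    then show ?thesis using \<open>2 * e = 0\<close> by simp
  qed
  moreover have "of_nat q * e = 0" using binomial_vanish[of 1] q_ge_3 by simp
  ultimately show False using e_nonzero by simp
qed

lemma pow_half_closed: "x \<in> K \<Longrightarrow> e * x ^ half = x ^ half"
  using power_closed[of x half] K_closed half_pos by simp

lemma pow_half:
  assumes "x \<in> K" "x \<noteq> 0" shows "x ^ half = e \<or> x ^ half = - e"
proof -
  let ?y = "x ^ half"
  have x: "e * x = x" and y: "e * ?y = ?y" using assms K_closed pow_half_closed by auto
  have "x = x ^ (2 * half + 1)" using K_pow[OF assms(1)] q_half by simp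
  also have "\<dots> = x * (?y * ?y)" by (simp add: mult_2 power_add)
  finally have "x * (?y * ?y - e) = 0" using x by (simp add: algebra_simps)
  moreover have "e * (?y * ?y - e) = ?y * ?y - e" using y mult_closed[OF y, of ?y] by (simp add: algebra_simps idem)
  ultimately have "?y * ?y - e = 0" using no_zero_divisors[OF x] assms(2) by blast
  moreover have "(?y - e) * (?y + e) = ?y * ?y - e" using y by (simp add: algebra_simps idem)
  ultimately have "(?y - e) * (?y + e) = 0" by simp
  moreover have "e * (?y - e) = ?y - e" "e * (?y + e) = ?y + e" using y by (simp_all add: algebra_simps idem)
  ultimately have "?y - e = 0 \<or> ?y + e = 0" using no_zero_divisors by blast
  then show ?thesis by (auto simp: add_eq_0_iff2)
qed

lemma chi_mult:
  assumes "x \<in> K" "y \<in> K" shows "chi (x * y) = chi x * chi y"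
proof (cases "x = 0 \<or> y = 0")
  case True then show ?thesis by (auto simp: chi_def)
next
  case False
  then have nz: "x \<noteq> 0" "y \<noteq> 0" "x * y \<noteq> 0" using no_zero_divisors K_closed assms by blast+
  have "x ^ half = e \<or> x ^ half = - e" "y ^ half = e \<or> y ^ half = - e" using pow_half assms nz by auto
  then show ?thesis
    by (elim disjE) (simp_all add: chi_def power_mult_distrib idem nz e_neq_minus_e e_neq_minus_e[symmetric])
qed

lemma K_prod: "finite I \<Longrightarrow> I \<noteq> {} \<Longrightarrow> (\<And>i. i \<in> I \<Longrightarrow> f i \<in> K) \<Longrightarrow> prod f I \<in> K"
  by (induction I rule: finite_ne_induct) (auto intro: K_mult)

lemma chi_prod:
  assumes "finite I" "I \<noteq> {}" "\<And>i. i \<in> I \<Longrightarrow> f i \<in> K"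
  shows "chi (prod f I) = (\<Prod>i\<in>I. chi (f i))"
  using assms by (induction I rule: finite_ne_induct) (auto simp: chi_mult K_prod)

lemma abs_chi_le: "\<bar>chi x\<bar> \<le> 1"
  by (simp add: chi_def)

lemma poly_in_K:
  assumes "\<And>i. coeff g i \<in> K" "x \<in> K" shows "poly g x \<in> K"
proof -
  have "x ^ i * c \<in> K" if "c \<in> K" for i c
    using that by (induction i) (auto simp: mult.assoc intro: K_mult assms)
  then have "coeff g i * x ^ i \<in> K" for i using assms(1) by (simp add: mult.commute)
  then have "(\<Sum>i\<in>I. coeff g i * x ^ i) \<in> K" for I
    by (induction I rule: infinite_finite_induct) (auto intro: K_add K_0)
  then show ?thesis by (simp add: poly_altdef)
qed

lemma exists_stepanov_parameter:
  fixes s :: real assumes "s \<ge> 0"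
  obtains t :: nat where "2 * real t \<le> s" "s < 2 * real t + 2"
proof -
  have "2 * real (nat \<lfloor>s / 2\<rfloor>) \<le> s" "s < 2 * real (nat \<lfloor>s / 2\<rfloor>) + 2"
    using assms by linarith+
  then show ?thesis using that by blast
qed

text \<open>
  With \<open>s = \<surd>q\<close>, the parameters are \<open>l = 2 t\<close>, \<open>t\<close> the integer part of \<open>s / 2\<close>, \<open>J = t + m + 2\<close> and
  \<open>B = (q - 1)/2 - m\<close>. The terms \<open>2 t B\<close> on both sides of the counting condition cancel, and what
  remains is \<open>(m + 2) (q - 1 - 2 m)\<close> against \<open>4 t\<^sup>2 m + 2 t J\<close>, that is, roughly \<open>(m + 2) q\<close> against
  \<open>(m + 1/2) q\<close>. The resulting bound is \<open>J q / l\<close> plus lower terms, and \<open>J / l\<close> exceeds \<open>1/2\<close> by \<open>O(1/s)\<close>.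
\<close>

lemma stepanov_bound:
  assumes g: "smult e g = g" "\<And>i. coeff g i \<in> K" "coeff g 0 \<noteq> 0" "degree g \<le> m" "\<not> const_square g"
    and large: "q \<ge> 16 * (m + 2) ^ 2" and a: "a \<in> K"
  shows "real (card {x\<in>K. poly g x ^ half = a}) \<le> real q / 2 + (4 * real m + 7) * sqrt (real q)"
proof -
  define s where "s = sqrt (real q)"
  define c where "c = m + 2"
  have ss: "s * s = real q" unfolding s_def by simp
  have s4: "s \<ge> 4 * real c"
  proof -
    have "(4 * real c) ^ 2 = real (16 * (m + 2) ^ 2)"
      by (simp add: c_def power2_eq_square algebra_simps)
    then have "(4 * real c) ^ 2 \<le> real q" using large by linarith
    then show ?thesis unfolding s_def by (rule real_le_rsqrt)
  qed
  have c2: "c \<ge> 2" by (simp add: c_def)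
  obtain t where t: "2 * real t \<le> s" "s < 2 * real t + 2"
    using exists_stepanov_parameter[of s] s4 by auto
  have t1: "t \<ge> 1" using t s4 c2 by (cases t) auto
  have tt: "4 * (real t * real t) \<le> real q"
    using mult_mono[OF t(1) t(1)] ss s4 by simp
  have cs: "real c * s \<le> real q / 4" using mult_right_mono[OF s4, of s] ss s4 by simp
  have cc: "2 * (real c * real c) \<le> real q / 8" using mult_mono[OF s4 s4] ss s4 by simp
  have hm: "half > m"
  proof -
    have "16 * (m + 2) \<le> 16 * (m + 2) ^ 2" by (simp add: power2_eq_square)
    then have "16 * (m + 2) \<le> q" using large by (rule le_trans)
    then have "16 * (m + 2) \<le> 2 * half + 1" using q_half by (rule ord_le_eq_trans)
    then show ?thesis by simp
  qed
  define B where "B = half - m"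
  define l where "l = 2 * t"
  define J where "J = t + c"
  have B1: "B \<ge> 1" "2 * B + m < q + 2" using hm q_half by (auto simp: B_def)
  have rB: "2 * real B = real q - 1 - 2 * real m" using hm q_half by (simp add: B_def of_nat_diff)
  have "real (4 * t * t) \<le> real q" using tt by simp
  then have "4 * t * t \<le> q" by linarith
  moreover have "2 * t \<le> 4 * t * t" using t1 by simp
  ultimately have lq: "l \<le> q" unfolding l_def by linarith
  have "real (l * (l * m + B + J)) < real (2 * J * B)"
  proof -
    have "real (l * (l * m + B + J)) = 4 * (real t * real t) * real m + 2 * real t * real B + 2 * (real t * real t) + 2 * real t * real c"
      by (simp add: l_def J_def algebra_simps)
    also have "\<dots> \<le> real q * real m + 2 * real t * real B + real q / 2 + real c * s"
      using tt t(1) mult_right_mono[OF tt, of "real m"] mult_right_mono[OF t(1), of "real c"]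
      by (simp add: algebra_simps)
    also have "\<dots> < 2 * real t * real B + real c * (real q - 1 - 2 * real m)"
    proof -
      have "real c * (1 + 2 * real m) \<le> 2 * (real c * real c)"
        using mult_left_mono[of "1 + 2 * real m" "2 * real c" "real c"] by (simp add: c_def)
      moreover have "real c * real q = real q * real m + 2 * real q" by (simp add: c_def algebra_simps)
      moreover have "real q > 0" using q_ge_3 by simp
      ultimately have "real q * real m + real q / 2 + real c * s < real c * real q - real c * (1 + 2 * real m)"
        using cs cc by linarith
      then show ?thesis by (simp add: algebra_simps)
    qed
    also have "\<dots> = real (2 * J * B)" unfolding rB[symmetric] by (simp add: J_def algebra_simps)
    finally show ?thesis .
  qed
  then have count: "l * (l * m + B + J) < 2 * J * B" by linarith
  let ?N = "card {x\<in>K. poly g x ^ half = a}"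
  have "l * ?N \<le> l * m + B + half * m + J * q"
    by (rule stepanov_count[OF g q_half B1 lq a count])
  then have "real (l * ?N) \<le> real (l * m + B + half * m + J * q)" by linarith
  then have "2 * real t * real ?N \<le> 2 * real t * real m + real B + real half * real m + real t * real q + real c * real q"
    by (simp add: l_def J_def algebra_simps)
  also have "real B \<le> real q / 2" using rB by simp
  also have "real half * real m \<le> real q * real m / 2"
    using q_half mult_right_mono[of "real half" "real q / 2" "real m"] by simp
  finally have "2 * real t * (real ?N - real q / 2 - real m) \<le> (real q * (1 + real m + 2 * real c)) / 2"
    by (simp add: algebra_simps)
  also have "\<dots> \<le> real q * (2 * real m + 3)"
    using q_ge_3 by (simp add: c_def algebra_simps)
  finally have main: "2 * real t * (real ?N - real q / 2 - real m) \<le> s * s * (2 * real m + 3)" unfolding ss .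
  have "real ?N - real q / 2 - real m \<le> 2 * s * (2 * real m + 3)"
  proof (rule ccontr)
    assume "\<not> ?thesis"
    then have "real ?N - real q / 2 - real m > 2 * s * (2 * real m + 3)" by simp
    moreover have "2 * s * (2 * real m + 3) > 0" using s4 c2 by simp
    moreover have "2 * real t \<ge> s / 2" using t(2) s4 c2 by simp
    moreover have "s > 0" using s4 c2 by simp
    ultimately have "(s / 2) * (2 * s * (2 * real m + 3)) < 2 * real t * (real ?N - real q / 2 - real m)"
      by (intro mult_le_less_imp_less) auto
    then show False using main by (simp add: algebra_simps)
  qed
  moreover have "real m \<le> s" using s4 c2 by (simp add: c_def)
  ultimately show ?thesis unfolding s_def[symmetric] by (simp add: algebra_simps)
qed

lemma sum_chi_trivial: "\<bar>\<Sum>x\<in>K. chi (f x)\<bar> \<le> int q"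
proof -
  have "\<bar>\<Sum>x\<in>K. chi (f x)\<bar> \<le> (\<Sum>x\<in>K. \<bar>chi (f x)\<bar>)" by (rule sum_abs)
  also have "\<dots> \<le> (\<Sum>x\<in>K. 1)" by (rule sum_mono) (simp add: abs_chi_le)
  finally show ?thesis using K_card by simp
qed

text \<open>
  The values \<open>e\<close> and \<open>- e\<close> of \<open>g\<^bsup>(q-1)/2\<^esup>\<close> and the at most \<open>m\<close> zeros of \<open>g\<close> exhaust \<open>K\<close>, so the upper bounds
  for the first two also bound both of them from below.
\<close>

lemma weil_nonzero_const:
  assumes g: "smult e g = g" "\<And>i. coeff g i \<in> K" "coeff g 0 \<noteq> 0" "degree g \<le> m" "\<not> const_square g"
    and large: "q \<ge> 16 * (m + 2) ^ 2"
  shows "\<bar>real_of_int (\<Sum>x\<in>K. chi (poly g x))\<bar> \<le> (9 * real m + 14) * sqrt (real q)"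
proof -
  define S where "S a = {x\<in>K. poly g x ^ half = a}" for a
  define Z where "Z = {x\<in>K. poly g x = 0}"
  have gK: "poly g x \<in> K" if "x \<in> K" for x using poly_in_K g(2) that by blast
  have fin: "finite (S a)" "finite Z" for a using K_finite by (auto simp: S_def Z_def)
  have h0: "(0::'r) ^ half = 0" using half_pos by (simp add: power_0_left)
  have me: "- e \<noteq> 0" using e_nonzero by simp
  have K_eq: "K = S e \<union> S (- e) \<union> Z"
    using pow_half gK unfolding S_def Z_def by blast
  have disj: "S e \<inter> S (- e) = {}" "(S e \<union> S (- e)) \<inter> Z = {}"
    using e_neq_minus_e e_nonzero h0 me unfolding S_def Z_def by auto
  have "q = card (S e) + card (S (- e)) + card Z"
    unfolding K_card[symmetric] using disj fin
    by (subst K_eq, subst card_Un_disjoint) (auto simp: card_Un_disjoint)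
  then have total: "real q = real (card (S e)) + real (card (S (- e))) + real (card Z)" by simp
  have "g \<noteq> 0" using g(3) by auto
  then have fc: "finite {x. e * x = x \<and> poly g x = 0}" "card {x. e * x = x \<and> poly g x = 0} \<le> degree g"
    using roots_finite_card[OF g(1)] by auto
  have "Z \<subseteq> {x. e * x = x \<and> poly g x = 0}" using K_closed by (auto simp: Z_def)
  then have "card Z \<le> degree g" using card_mono[OF fc(1)] fc(2) le_trans by blast
  then have Zm: "real (card Z) \<le> real m" using g(4) by simp
  have "(\<Sum>x\<in>K. chi (poly g x)) = (\<Sum>x\<in>S e. chi (poly g x)) + (\<Sum>x\<in>S (- e). chi (poly g x)) + (\<Sum>x\<in>Z. chi (poly g x))"
    using disj fin by (subst K_eq, subst sum.union_disjoint) (auto simp: sum.union_disjoint)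
  also have "(\<Sum>x\<in>S e. chi (poly g x)) = (\<Sum>x\<in>S e. 1)"
    by (rule sum.cong) (use e_nonzero h0 in \<open>auto simp: S_def chi_def\<close>)
  also have "(\<Sum>x\<in>S (- e). chi (poly g x)) = (\<Sum>x\<in>S (- e). - 1)"
    by (rule sum.cong) (use e_nonzero h0 e_neq_minus_e in \<open>auto simp: S_def chi_def\<close>)
  also have "(\<Sum>x\<in>Z. chi (poly g x)) = 0" by (rule sum.neutral) (auto simp: Z_def chi_def)
  finally have sum: "real_of_int (\<Sum>x\<in>K. chi (poly g x)) = real (card (S e)) - real (card (S (- e)))" by simp
  have bound: "real (card (S e)) \<le> real q / 2 + (4 * real m + 7) * sqrt (real q)"
    "real (card (S (- e))) \<le> real q / 2 + (4 * real m + 7) * sqrt (real q)"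
    unfolding S_def using stepanov_bound[OF g large] K_e K_uminus by auto
  have "real m \<le> real m * sqrt (real q)" using q_ge_3 mult_left_mono[of 1 "sqrt (real q)" "real m"] by simp
  moreover have "(4 * real m + 7) * sqrt (real q) = 4 * (real m * sqrt (real q)) + 7 * sqrt (real q)"
    "(9 * real m + 14) * sqrt (real q) = 9 * (real m * sqrt (real q)) + 14 * sqrt (real q)"
    by (simp_all add: algebra_simps)
  ultimately show ?thesis unfolding sum abs_le_iff using bound total Zm by linarith
qed

text \<open>
  For small \<open>q\<close> the bound is trivial. Otherwise \<open>g\<close> has a non-zero in \<open>K\<close>, and a translation moves it
  to \<open>0\<close>.
\<close>

lemma weil:
  assumes g: "smult e g = g" "\<And>i. coeff g i \<in> K" "degree g \<le> m" "\<not> const_square g"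
  shows "\<bar>real_of_int (\<Sum>x\<in>K. chi (poly g x))\<bar> \<le> (9 * real m + 14) * sqrt (real q)"
proof (cases "q \<ge> 16 * (m + 2) ^ 2")
  case False
  moreover have "(4 * (real m + 2)) ^ 2 = real (16 * (m + 2) ^ 2)"
    by (simp add: power2_eq_square algebra_simps)
  ultimately have "real q \<le> (4 * (real m + 2)) ^ 2" by linarith
  then have s: "sqrt (real q) \<le> 4 * (real m + 2)" by (simp add: real_le_lsqrt)
  have "\<bar>real_of_int (\<Sum>x\<in>K. chi (poly g x))\<bar> \<le> real q"
    using sum_chi_trivial[of "poly g"] by linarith
  also have "\<dots> = sqrt (real q) * sqrt (real q)" by simp
  also have "\<dots> \<le> (4 * (real m + 2)) * sqrt (real q)" using s by (intro mult_right_mono) auto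
  also have "\<dots> \<le> (9 * real m + 14) * sqrt (real q)" by (intro mult_right_mono) auto
  finally show ?thesis .
next
  case True
  have gn: "g \<noteq> 0" using g(4) const_square_const[of 0] by auto
  have "m < q"
  proof -
    have "m < 16 * (m + 2) ^ 2" by (simp add: power2_eq_square)
    then show ?thesis using True by simp
  qed
  then obtain a where a: "a \<in> K" "poly g a \<noteq> 0"
    using poly_zero_if_many_roots[OF g(1) K_finite] K_closed K_card gn g(3)
    by (metis le_less_trans)
  define h where "h = pcompose g [:a, 1:]"
  have h1: "smult e h = h" unfolding h_def using g(1) by (metis pcompose_smult)
  have h2: "coeff h i \<in> K" for i
  proof -
    have "g \<in> polys_over K1" using g(2) K_sub_K1 by (auto simp: polys_over_def)
    then have "coeff (taylor g) i \<in> polys_over K1"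
      using taylor_over[OF K1_closed] unfolding polys_over_def[of "polys_over K1"] by blast
    moreover have "poly p a \<in> K1" if "p \<in> polys_over K1" for p
      using that unfolding poly_altdef polys_over_def
      by (auto intro!: semiring_closed_sum[OF K1_closed] semiring_closedD(4)[OF K1_closed]
          semiring_closed_power[OF K1_closed] K_sub_K1[OF a(1)])
    ultimately have "coeff h i \<in> K1" unfolding h_def coeff_pcompose_shift by blast
    then show ?thesis using coeff_closed[OF h1, of i] by (simp add: K1_def)
  qed
  have h3: "coeff h 0 \<noteq> 0" unfolding h_def coeff_pcompose_shift coeff_taylor_0 by (rule a)
  have h4: "degree h \<le> m" using degree_pcompose_le[of g "[:a, 1:]"] g(3) unfolding h_def by simp
  have gh: "g = pcompose h [:- a, 1:]" unfolding h_def by (simp add: pcompose_pCons flip: pcompose_assoc)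
  have h5: "\<not> const_square h"
  proof
    assume "const_square h"
    then obtain c k where k: "e * c = c" "smult e k = k" "h = smult c (k * k)" unfolding const_square_def by blast
    have "g = smult c (pcompose k [:- a, 1:] * pcompose k [:- a, 1:])"
      unfolding gh k(3) pcompose_smult pcompose_mult ..
    moreover have "smult e (pcompose k [:- a, 1:]) = pcompose k [:- a, 1:]" using k(2) by (metis pcompose_smult)
    ultimately show False using const_squareI k(1) g(4) by blast
  qed
  have "(\<Sum>x\<in>K. chi (poly h x)) = (\<Sum>x\<in>K. chi (poly g (a + x)))"
    by (simp add: h_def poly_pcompose)
  also have "\<dots> = (\<Sum>x\<in>K. chi (poly g x))"
    by (rule sum.reindex_bij_witness[of _ "\<lambda>x. x - a" "\<lambda>x. a + x"]) (auto intro: K_add K_diff a)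
  finally show ?thesis using weil_nonzero_const[OF h1 h2 h3 h4 h5 True] by simp
qed

end

section \<open>Square roots from many specialisations\<close>

definition eval_coeffs :: "'a::comm_ring_1 poly poly \<Rightarrow> 'a \<Rightarrow> 'a poly"
  where "eval_coeffs G y = map_poly (\<lambda>c. poly c y) G"

lemma coeff_eval_coeffs [simp]: "coeff (eval_coeffs G y) i = poly (coeff G i) y"
  by (simp add: eval_coeffs_def coeff_map_poly)

lemma degree_eval_coeffs_le: "degree (eval_coeffs G y) \<le> degree G"
  by (rule degree_le) (simp add: coeff_eq_0)

lemma eval_coeffs_smult: "eval_coeffs (smult c G) y = smult (poly c y) (eval_coeffs G y)"
  by (rule poly_eqI) simp

lemma eval_coeffs_mult: "eval_coeffs (G * H) y = eval_coeffs G y * eval_coeffs H y"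
  by (rule poly_eqI) (simp add: coeff_mult poly_sum)

declare sum.cong [fundef_cong]

text \<open>
  The recursion for the coefficients of a square root \<open>X\<^sup>M + b\<^sub>1 X\<^bsup>M-1\<^esup> + \<dots>\<close> of \<open>G / c\<close>, where \<open>c\<close> is the
  leading coefficient of \<open>G\<close> and \<open>g i\<close> its coefficient at distance \<open>i\<close> from the top. The value at \<open>i\<close> is
  \<open>c\<^sup>i b\<^sub>i\<close>, which clears the denominators; \<open>\<eta>\<close> stands for one half and \<open>u\<close> for one.
\<close>

function sqrt_coeff :: "'a::comm_ring_1 \<Rightarrow> 'a \<Rightarrow> 'a \<Rightarrow> (nat \<Rightarrow> 'a) \<Rightarrow> nat \<Rightarrow> 'a" where
  "sqrt_coeff u \<eta> c g i = (if i = 0 then u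
     else \<eta> * (c ^ (i - 1) * g i - (\<Sum>a\<in>{1..<i}. sqrt_coeff u \<eta> c g a * sqrt_coeff u \<eta> c g (i - a))))"
  by auto
termination by (relation "measure (\<lambda>(_, _, _, _, i). i)") auto

declare sqrt_coeff.simps [simp del]

lemma coeff_square_monic:
  fixes h :: "'a::comm_ring_1 poly"
  assumes deg: "degree h \<le> M" and i: "i \<le> M"
  shows "coeff (h * h) (2 * M - i) = (\<Sum>a\<le>i. coeff h (M - a) * coeff h (M - (i - a)))"
proof -
  have "coeff (h * h) (2 * M - i) = (\<Sum>j\<le>2 * M - i. coeff h j * coeff h (2 * M - i - j))" by (rule coeff_mult)
  also have "\<dots> = (\<Sum>j\<in>{M - i..M}. coeff h j * coeff h (2 * M - i - j))"
  proof (rule sum.mono_neutral_right)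
    show "{M - i..M} \<subseteq> {..2 * M - i}" using i by auto
    show "\<forall>j\<in>{..2 * M - i} - {M - i..M}. coeff h j * coeff h (2 * M - i - j) = 0"
    proof
      fix j assume j: "j \<in> {..2 * M - i} - {M - i..M}"
      then have "j > M \<or> 2 * M - i - j > M" using i by auto
      then show "coeff h j * coeff h (2 * M - i - j) = 0" using deg by (auto simp: coeff_eq_0)
    qed
  qed simp
  also have "\<dots> = (\<Sum>a\<le>i. coeff h (M - a) * coeff h (M - (i - a)))"
    using i by (intro sum.reindex_bij_witness[of _ "\<lambda>a. M - a" "\<lambda>j. M - j"])
      (auto intro!: arg_cong2[of _ _ _ _ "(*)"] arg_cong[of _ _ "coeff h"])
  finally show ?thesis .
qed

context prime_idem
begin

lemma degree_smult_nonzero: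
  assumes "e * c = c" "c \<noteq> 0" "smult e p = p"
  shows "degree (smult c p) = degree p"
proof (cases "p = 0")
  case False
  then have "c * coeff p (degree p) \<noteq> 0"
    using no_zero_divisors[OF assms(1) coeff_closed[OF assms(3)]] assms(2) leading_coeff_0_iff by blast
  then have "degree p \<le> degree (smult c p)" by (metis coeff_smult le_degree)
  then show ?thesis using degree_smult_le[of c p] by simp
qed simp

lemma poly_poly_closed_iff: "smult [:e:] G = G \<longleftrightarrow> (\<forall>i. smult e (coeff G i) = coeff G i)"
  by (metis (no_types, lifting) coeff_smult mult_pCons_left mult_zero_left add.right_neutral pCons_0_0 poly_eqI)

lemma eval_coeffs_closed: "smult [:e:] G = G \<Longrightarrow> smult e (eval_coeffs G y) = eval_coeffs G y"
  by (rule poly_eqI) (metis coeff_eval_coeffs coeff_smult poly_closed poly_poly_closed_iff)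

text \<open>
  Here the outer variable is \<open>X\<close> and the coefficients are polynomials in \<open>y\<close>. Among the coefficients of \<open>h\<close>
  of maximal degree \<open>m\<close> take the one with the highest index \<open>i\<^sub>0\<close>: in the coefficient of \<open>h\<^sup>2\<close> at
  \<open>2 i\<^sub>0\<close> every other product has degree less than \<open>2 m\<close>.
\<close>

lemma square_root_coeff_degree:
  assumes h: "smult [:e:] h = h" and l: "e * l = l" "l \<noteq> 0"
    and deg: "\<And>i. degree (coeff (smult [:l:] (h * h)) i) \<le> d"
  shows "2 * degree (coeff h i) \<le> d"
proof -
  define m where "m = Max ((\<lambda>i. degree (coeff h i)) ` {..degree h})"
  have le_m: "degree (coeff h i) \<le> m" for i
  proof (cases "i \<le> degree h")
    case True then show ?thesis unfolding m_def by (intro Max_ge) auto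
  next
    case False then show ?thesis by (simp add: coeff_eq_0)
  qed
  have "2 * m \<le> d"
  proof (cases "m = 0")
    case False
    have "m \<in> (\<lambda>i. degree (coeff h i)) ` {..degree h}" unfolding m_def by (intro Max_in) auto
    then obtain i1 where i1: "degree (coeff h i1) = m" by auto
    define P where "P i \<longleftrightarrow> degree (coeff h i) = m" for i
    have bound: "\<forall>y. P y \<longrightarrow> y \<le> degree h"
      using False unfolding P_def by (metis coeff_eq_0 degree_0 not_le)
    define i0 where "i0 = (GREATEST i. P i)"
    have i0: "degree (coeff h i0) = m"
      using GreatestI_nat[of P i1, OF _ bound[rule_format]] i1 unfolding i0_def P_def by blast
    have gt: "degree (coeff h i) < m" if "i > i0" for i
    proof -
      have "\<not> P i" using Greatest_le_nat[of P i, OF _ bound[rule_format]] that unfolding i0_def by fastforce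
      then show ?thesis using le_m[of i] unfolding P_def by simp
    qed
    have cl: "smult e (coeff h i) = coeff h i" for i using h poly_poly_closed_iff by blast
    have nz: "coeff h i0 \<noteq> 0" using i0 False by auto
    define A where "A = coeff h i0 * coeff h i0"
    define B where "B = (\<Sum>j\<in>{..2 * i0} - {i0}. coeff h j * coeff h (2 * i0 - j))"
    have degA: "degree A = 2 * m" using degree_mult[OF cl cl nz nz] i0 unfolding A_def by simp
    have degB: "degree B < 2 * m" unfolding B_def
    proof (rule degree_sum_less)
      fix j assume "j \<in> {..2 * i0} - {i0}"
      then have "j > i0 \<or> 2 * i0 - j > i0" by auto
      then have "degree (coeff h j) + degree (coeff h (2 * i0 - j)) < 2 * m"
        using gt[of j] gt[of "2 * i0 - j"] le_m[of j] le_m[of "2 * i0 - j"] by linarith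
      then show "degree (coeff h j * coeff h (2 * i0 - j)) < 2 * m"
        using degree_mult_le le_less_trans by blast
    qed (use False in simp)
    have "coeff (h * h) (2 * i0) = A + B"
      unfolding coeff_mult A_def B_def by (subst sum.remove[of _ i0]) (auto simp: mult_2)
    then have "degree (coeff (h * h) (2 * i0)) = 2 * m" using degA degB degree_add_eq_left by metis
    moreover have "smult e (coeff (h * h) (2 * i0)) = coeff (h * h) (2 * i0)"
      using h poly_poly_closed_iff by (metis mult_smult_left)
    ultimately have "degree (smult l (coeff (h * h) (2 * i0))) = 2 * m" using degree_smult_nonzero[OF l] by metis
    then show ?thesis using deg[of "2 * i0"] by simp
  qed simp
  then show ?thesis using le_m[of i] by linarith
qed

lemma smult_cancel:
  assumes "smult e l = l" "l \<noteq> 0" "smult [:e:] U = U" "smult [:e:] V = V" "smult l U = smult l V"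
  shows "U = V"
proof (rule poly_eqI)
  fix i
  have "l * coeff U i = l * coeff V i" using assms(5) by (metis coeff_smult)
  then show "coeff U i = coeff V i"
    using poly_cancel_left[OF assms(1) _ _ assms(2)] assms(3,4) poly_poly_closed_iff by blast
qed

lemma factor_root_synthetic:
  assumes p: "smult e p = p" and a: "e * a = a" and root: "poly p a = 0"
  shows "p = [:- a, e:] * smult e (synthetic_div p a)"
proof -
  have "smult e p = smult e ([:- a, 1:] * synthetic_div p a)"
    using synthetic_div_correct'[of a p] root by simp
  also have "\<dots> = smult e [:- a, 1:] * smult e (synthetic_div p a)"
    unfolding mult_smult_left mult_smult_right smult_smult idem ..
  also have "smult e [:- a, 1:] = [:- a, e:]" using a by simp
  finally show ?thesis using p by simp
qed

end

context closed_idem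
begin

text \<open>
  Induction on the degree of \<open>A\<close>. At a root \<open>y\<close> of \<open>A\<close> either \<open>C\<close> vanishes, and \<open>X - y\<close> cancels from \<open>A\<close> and
  \<open>C\<close>; or \<open>H\<close> vanishes, then \<open>(X - y)\<^sup>2\<close> divides the right-hand side and, as \<open>G\<close> does not vanish at \<open>y\<close>,
  also \<open>A\<close>. Once \<open>A\<close> is constant, so is \<open>C\<close>, since a root of \<open>C\<close> would be a zero of \<open>G\<close>.
\<close>

lemma remove_square_multiplier:
  assumes "smult e A = A" "smult e C = C" "smult [:e:] G = G" "smult [:e:] H = H" "A \<noteq> 0"
    and "smult A G = smult C (H * H)"
    and nz: "\<And>y. e * y = y \<Longrightarrow> eval_coeffs G y \<noteq> 0"
  shows "\<exists>l h. e * l = l \<and> smult [:e:] h = h \<and> (\<forall>i. coeff H i = 0 \<longrightarrow> coeff h i = 0) \<and> G = smult [:l:] (h * h)"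
  using assms(1,2,4,5,6)
proof (induction "degree A" arbitrary: A C H rule: less_induct)
  case less
  note A = less.prems(1) and C = less.prems(2) and H = less.prems(3) and An = less.prems(4) and eq = less.prems(5)
  note G = assms(3)
  have eq_at: "smult (poly A y) (eval_coeffs G y) = smult (poly C y) (eval_coeffs H y * eval_coeffs H y)" for y
    using arg_cong[OF eq, of "\<lambda>G. eval_coeffs G y"] by (simp only: eval_coeffs_smult eval_coeffs_mult)
  show ?case
  proof (cases "degree A = 0")
    case True
    then obtain a where a: "A = [:a:]" using degree_eq_zeroE by blast
    have a': "e * a = a" "a \<noteq> 0" using A An a by auto
    obtain b where b: "e * b = b" "a * b = e" using inverse_ex a' by blast
    have "degree C = 0"
    proof (rule ccontr)
      assume "degree C \<noteq> 0"
      then obtain y where y: "e * y = y" "poly C y = 0" using root_ex C by blast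
      then have "[:a:] * eval_coeffs G y = 0" using eq_at[of y] a by simp
      then show False
        using poly_no_zero_divisors[of "[:a:]" "eval_coeffs G y"] a' nz[OF y(1)] eval_coeffs_closed[OF G] by auto
    qed
    then obtain c where c: "C = [:c:]" using degree_eq_zeroE by blast
    have c': "e * c = c" using C c by (metis coeff_closed coeff_pCons_0)
    have "smult [:b:] (smult A G) = smult [:b:] (smult C (H * H))" using eq by simp
    then have "smult [:b * a:] G = smult [:b * c:] (H * H)" unfolding a c by (simp add: mult.commute)
    moreover have "b * a = e" using b by (simp add: mult.commute)
    ultimately have "G = smult [:b * c:] (H * H)" using G by simp
    moreover have "e * (b * c) = b * c" using mult_closed[OF b(1)] .
    ultimately show ?thesis using H by blast
  next
    case False
    then obtain y where y: "e * y = y" "poly A y = 0" using root_ex A by blast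
    define l where "l = [:- y, e:]"
    have l: "smult e l = l" "l \<noteq> 0" "degree l = 1" "poly l y = 0"
      using linear_closed[OF y(1)] linear_nonzero y(1) by (auto simp: l_def mult.commute)
    obtain A1 where A1: "smult e A1 = A1" "A = l * A1" using factor_root A y unfolding l_def by blast
    have A1n: "A1 \<noteq> 0" using An A1 by auto
    have degA1: "degree A = Suc (degree A1)"
      using degree_mult[OF l(1) A1(1) l(2) A1n] A1(2) l(3) by simp
    have closedHH: "smult [:e:] (K * L) = K * L" if "smult [:e:] K = K" for K L :: "'r poly poly"
      using that by (metis mult_smult_left)
    have closedS: "smult [:e:] (smult D K) = smult D K" if "smult [:e:] K = K" for D and K :: "'r poly poly"
      using that by (metis mult.commute smult_smult)
    show ?thesis
    proof (cases "poly C y = 0")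
      case True
      obtain C1 where C1: "smult e C1 = C1" "C = l * C1" using factor_root C y(1) True unfolding l_def by blast
      have "smult l (smult A1 G) = smult l (smult C1 (H * H))" using eq unfolding A1(2) C1(2) by simp
      then have "smult A1 G = smult C1 (H * H)"
        by (rule smult_cancel[OF l(1,2) closedS[OF G] closedS[OF closedHH[OF H]]])
      then show ?thesis using less.hyps[of A1 C1 H] degA1 A1 C1 H A1n by simp
    next
      case Cn: False
      have "[:poly C y:] * (eval_coeffs H y * eval_coeffs H y) = 0" using eq_at[of y] y by simp
      moreover have Hy: "smult e (eval_coeffs H y) = eval_coeffs H y" using eval_coeffs_closed[OF H] .
      moreover have "smult e (eval_coeffs H y * eval_coeffs H y) = eval_coeffs H y * eval_coeffs H y"
        using Hy by (metis mult_smult_left)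
      moreover have "smult e [:poly C y:] = [:poly C y:]" "[:poly C y:] \<noteq> 0" using poly_closed[OF C] Cn by auto
      ultimately have "eval_coeffs H y * eval_coeffs H y = 0" using poly_no_zero_divisors by blast
      then have H0: "eval_coeffs H y = 0" using poly_no_zero_divisors Hy by blast
      define H1 where "H1 = map_poly (\<lambda>c. smult e (synthetic_div c y)) H"
      have co: "coeff H1 i = smult e (synthetic_div (coeff H i) y)" for i
        unfolding H1_def by (simp add: coeff_map_poly)
      have H1: "smult [:e:] H1 = H1" unfolding poly_poly_closed_iff co by (simp add: idem)
      have H_eq: "H = smult l H1"
      proof (rule poly_eqI)
        fix i
        have "poly (coeff H i) y = 0" using arg_cong[OF H0, of "\<lambda>p. coeff p i"] by simp
        moreover have "smult e (coeff H i) = coeff H i" using H poly_poly_closed_iff by blast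
        ultimately have "coeff H i = [:- y, e:] * smult e (synthetic_div (coeff H i) y)"
          using factor_root_synthetic y(1) by blast
        then show "coeff H i = coeff (smult l H1) i" unfolding coeff_smult co l_def .
      qed
      have "smult l (smult A1 G) = smult l (smult (C * l) (H1 * H1))"
        using eq unfolding A1(2) H_eq by (simp add: mult_ac)
      then have eq1: "smult A1 G = smult (C * l) (H1 * H1)"
        by (rule smult_cancel[OF l(1,2) closedS[OF G] closedS[OF closedHH[OF H1]]])
      have "[:poly A1 y:] * eval_coeffs G y = 0"
        using arg_cong[OF eq1, of "\<lambda>G. eval_coeffs G y"] l(4) by (simp add: eval_coeffs_smult)
      moreover have "smult e [:poly A1 y:] = [:poly A1 y:]" using poly_closed[OF A1(1)] by simp
      ultimately have "[:poly A1 y:] = 0"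
        using poly_no_zero_divisors nz[OF y(1)] eval_coeffs_closed[OF G] by blast
      then have "poly A1 y = 0" by simp
      then obtain A2 where A2: "smult e A2 = A2" "A1 = l * A2" using factor_root A1(1) y(1) unfolding l_def by blast
      have A2n: "A2 \<noteq> 0" using A1n A2 by auto
      have degA2: "degree A1 = Suc (degree A2)"
        using degree_mult[OF l(1) A2(1) l(2) A2n] A2(2) l(3) by simp
      have "smult l (smult A2 G) = smult l (smult C (H1 * H1))"
        using eq1 unfolding A2(2) by (simp add: mult_ac)
      then have "smult A2 G = smult C (H1 * H1)"
        by (rule smult_cancel[OF l(1,2) closedS[OF G] closedS[OF closedHH[OF H1]]])
      then have "\<exists>l h. e * l = l \<and> smult [:e:] h = h \<and> (\<forall>i. coeff H1 i = 0 \<longrightarrow> coeff h i = 0) \<and> G = smult [:l:] (h * h)"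
        using less.hyps[of A2 C H1] degA1 degA2 A2 C H1 A2n by simp
      moreover have "coeff H1 i = 0" if "coeff H i = 0" for i using that co by simp
      ultimately show ?thesis by blast
    qed
  qed
qed

lemma monic_square_root:
  assumes "e * l = l" "smult e h = h" "P = smult l (h * h)" "P \<noteq> 0"
  shows "\<exists>h'. smult e h' = h' \<and> (\<forall>i. coeff h i = 0 \<longrightarrow> coeff h' i = 0) \<and> degree P = 2 * degree h'
    \<and> coeff h' (degree h') = e \<and> P = smult (coeff P (degree P)) (h' * h')"
proof -
  have hn: "h \<noteq> 0" "l \<noteq> 0" using assms by auto
  define a where "a = coeff h (degree h)"
  have a: "e * a = a" "a \<noteq> 0" using coeff_closed[OF assms(2)] hn by (auto simp: a_def)
  obtain b where b: "e * b = b" "a * b = e" using inverse_ex a by blast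
  have bn: "b \<noteq> 0" using b e_nonzero by auto
  define h' where "h' = smult b h"
  have h': "smult e h' = h'" using b by (simp add: h'_def)
  have deg: "degree h' = degree h" unfolding h'_def by (rule degree_smult_nonzero[OF b(1) bn assms(2)])
  have "coeff h' (degree h) = e" unfolding h'_def using b by (simp add: a_def mult.commute)
  then have lead: "coeff h' (degree h') = e" using deg by simp
  have "smult a h' = smult e h" using b by (simp add: h'_def)
  then have h_eq: "h = smult a h'" using assms(2) by simp
  have P: "P = smult (l * (a * a)) (h' * h')" unfolding assms(3) by (subst (1 2) h_eq) simp
  have c: "e * (l * (a * a)) = l * (a * a)" using assms(1) mult_closed by blast
  have cn: "l * (a * a) \<noteq> 0" using P assms(4) by auto
  have hn': "h' \<noteq> 0" using lead e_nonzero by auto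
  have hh: "smult e (h' * h') = h' * h'" using h' by (metis mult_smult_left)
  have "degree P = degree (h' * h')" unfolding P by (rule degree_smult_nonzero[OF c cn hh])
  then have degP: "degree P = 2 * degree h'" using degree_mult[OF h' h' hn' hn'] by simp
  have "coeff (h' * h') (degree h' + degree h') = e * e" unfolding coeff_mult_degree_sum lead ..
  then have "coeff P (2 * degree h') = l * (a * a) * e" unfolding P by (simp add: mult_2 idem)
  then have "coeff P (degree P) = l * (a * a) * e" using degP by simp
  then have "coeff P (degree P) = l * (a * a)" using c by (simp add: mult.commute)
  then show ?thesis using h' degP lead P by (intro exI[of _ h']) (auto simp: h'_def)
qed

text \<open>
  Let \<open>c(y)\<close> be the leading coefficient and \<open>2 M\<close> the degree of \<open>G\<close>. The recursion \<open>sqrt_coeff\<close> produces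
  \<open>B\<^sub>i(y)\<close> of degree at most \<open>i d\<close> such that, at every \<open>y \<in> Y\<close> with \<open>c(y) \<noteq> 0\<close>, the coefficients of the
  monic square root of \<open>G(y) / c(y)\<close> are \<open>B\<^sub>i(y) / c(y)\<^sup>i\<close>. With \<open>H\<close> built from \<open>B\<^sub>i c\<^bsup>M-i\<^esup>\<close>, the identity
  \<open>c\<^bsup>2M\<^esup> G = c H\<^sup>2\<close> holds at more points than the degree in \<open>y\<close> of its coefficients, hence identically,
  and \<open>remove_square_multiplier\<close> applies. The support condition passes from the specialisations to \<open>H\<close>
  by the same argument.
\<close>

lemma square_of_many_square_specialisations:
  assumes two: "e + e \<noteq> 0"
    and G: "smult [:e:] G = G" "\<And>i. degree (coeff G i) \<le> d" "degree G \<le> N"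
    and Y: "finite Y" "\<And>y. y \<in> Y \<Longrightarrow> e * y = y" "card Y > (N + 2) * d"
    and sq: "\<And>y. y \<in> Y \<Longrightarrow> \<exists>l h. e * l = l \<and> smult e h = h \<and> (\<forall>i. coeff h i \<noteq> 0 \<longrightarrow> i \<in> E)
      \<and> eval_coeffs G y = smult l (h * h)"
    and nz: "\<And>y. e * y = y \<Longrightarrow> eval_coeffs G y \<noteq> 0"
  shows "\<exists>l h. e * l = l \<and> smult [:e:] h = h \<and> (\<forall>i. coeff h i \<noteq> 0 \<longrightarrow> i \<in> E)
    \<and> G = smult [:l:] (h * h) \<and> (\<forall>i. 2 * degree (coeff h i) \<le> d)"
proof -
  have Gcl: "smult e (coeff G i) = coeff G i" for i using G(1) poly_poly_closed_iff by blast
  define c where "c = coeff G (degree G)"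
  have "G \<noteq> 0" using nz[of 0] by (auto simp: eval_coeffs_def)
  then have cn: "c \<noteq> 0" by (simp add: c_def)
  have ccl: "smult e c = c" and cdeg: "degree c \<le> d" using Gcl G(2) by (auto simp: c_def)
  define Y' where "Y' = {y \<in> Y. poly c y \<noteq> 0}"
  have "card (Y - Y') \<le> d"
  proof -
    have "Y - Y' \<subseteq> {x. e * x = x \<and> poly c x = 0}" using Y(2) by (auto simp: Y'_def)
    then show ?thesis
      using roots_finite_card[OF ccl cn] card_mono[of "{x. e * x = x \<and> poly c x = 0}" "Y - Y'"] cdeg by linarith
  qed
  moreover have "card Y = card Y' + card (Y - Y')"
  proof -
    have "Y' \<subseteq> Y" by (auto simp: Y'_def)
    then show ?thesis using card_mono[OF Y(1)] card_Diff_subset[of Y' Y] finite_subset[OF _ Y(1)] by simp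
  qed
  ultimately have Y'card: "card Y' > (N + 1) * d" using Y(3) by simp
  have Y'fin: "finite Y'" using Y(1) by (simp add: Y'_def)
  have roots: "\<exists>h. smult e h = h \<and> (\<forall>i. coeff h i \<noteq> 0 \<longrightarrow> i \<in> E) \<and> degree G = 2 * degree h
      \<and> coeff h (degree h) = e \<and> eval_coeffs G y = smult (poly c y) (h * h)" if "y \<in> Y'" for y
  proof -
    have y: "y \<in> Y" "poly c y \<noteq> 0" using that by (auto simp: Y'_def)
    obtain l h where h: "e * l = l" "smult e h = h" "\<forall>i. coeff h i \<noteq> 0 \<longrightarrow> i \<in> E" "eval_coeffs G y = smult l (h * h)"
      using sq[OF y(1)] by blast
    have "coeff (eval_coeffs G y) (degree G) \<noteq> 0" using y by (simp add: c_def)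
    then have "degree (eval_coeffs G y) = degree G"
      using le_degree degree_eval_coeffs_le by (metis le_antisym)
    then show ?thesis
      using monic_square_root[OF h(1,2,4) nz[OF Y(2)[OF y(1)]]] h(3) by (auto simp: c_def)
  qed
  have "Y' \<noteq> {}" using Y'card by auto
  then obtain M where M: "degree G = 2 * M" using roots by blast
  define root where "root y = (SOME h. smult e h = h \<and> (\<forall>i. coeff h i \<noteq> 0 \<longrightarrow> i \<in> E) \<and> degree G = 2 * degree h
      \<and> coeff h (degree h) = e \<and> eval_coeffs G y = smult (poly c y) (h * h))" for y
  have root: "smult e (root y) = root y" "\<And>i. coeff (root y) i \<noteq> 0 \<Longrightarrow> i \<in> E" "degree (root y) = M"
    "coeff (root y) M = e" "eval_coeffs G y = smult (poly c y) (root y * root y)" if "y \<in> Y'" for y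
    using someI_ex[OF roots[OF that]] M unfolding root_def[symmetric] by auto
  have "e * (e + e) = e + e" by (simp only: distrib_left idem)
  then obtain \<eta> where \<eta>: "e * \<eta> = \<eta>" "(e + e) * \<eta> = e" using inverse_ex two by blast
  define B where "B = sqrt_coeff [:e:] [:\<eta>:] c (\<lambda>i. coeff G (2 * M - i))"
  have B0: "B 0 = [:e:]" unfolding B_def by (subst sqrt_coeff.simps) simp
  have BS: "B i = [:\<eta>:] * (c ^ (i - 1) * coeff G (2 * M - i) - (\<Sum>a\<in>{1..<i}. B a * B (i - a)))" if "i > 0" for i
    using that unfolding B_def by (subst sqrt_coeff.simps) simp
  have Bcl: "smult e (B i) = B i" for i
  proof (cases "i = 0")
    case True then show ?thesis by (simp add: B0 idem)
  next
    case False
    have "smult e [:\<eta>:] = [:\<eta>:]" using \<eta> by simp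
    moreover have "i > 0" using False by simp
    ultimately show ?thesis unfolding BS[OF \<open>i > 0\<close>] mult_smult_left[symmetric] by (simp only:)
  qed
  have Bdeg: "degree (B i) \<le> i * d" for i
  proof (induction i rule: less_induct)
    case (less i)
    show ?case
    proof (cases "i = 0")
      case False
      have "degree (c ^ (i - 1) * coeff G (2 * M - i)) \<le> degree (c ^ (i - 1)) + degree (coeff G (2 * M - i))"
        by (rule degree_mult_le)
      also have "\<dots> \<le> d * (i - 1) + d"
        using degree_power_le[of c "i - 1"] cdeg G(2) by (intro add_mono) (auto intro: le_trans[OF _ mult_le_mono1])
      also have "\<dots> = i * d" using False by (cases i) (auto simp: algebra_simps)
      finally have 1: "degree (c ^ (i - 1) * coeff G (2 * M - i)) \<le> i * d" .
      have "degree (B a * B (i - a)) \<le> i * d" if a: "a \<in> {1..<i}" for a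
      proof -
        have "degree (B a * B (i - a)) \<le> a * d + (i - a) * d"
          using less[of a] less[of "i - a"] a degree_mult_le[of "B a" "B (i - a)"] by fastforce
        also have "\<dots> = i * d" using a by (simp flip: distrib_right)
        finally show ?thesis .
      qed
      then have "degree (c ^ (i - 1) * coeff G (2 * M - i) - (\<Sum>a\<in>{1..<i}. B a * B (i - a))) \<le> i * d"
        using 1 by (intro degree_diff_le degree_sum_le) auto
      moreover have "i > 0" using False by simp
      ultimately show ?thesis unfolding BS[OF \<open>i > 0\<close>]
        by (intro order_trans[OF degree_mult_le]) simp
    qed (simp add: B0)
  qed
  have Beval: "poly (B i) y = poly c y ^ i * coeff (root y) (M - i)" if y: "y \<in> Y'" and i: "i \<le> M" for i y
    using i
  proof (induction i rule: less_induct)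
    case (less i)
    define b where "b a = coeff (root y) (M - a)" for a
    have bcl: "e * b a = b a" for a using coeff_closed root(1)[OF y] by (auto simp: b_def)
    show ?case
    proof (cases "i = 0")
      case True then show ?thesis by (simp add: B0 root(4)[OF y])
    next
      case False
      define S where "S = (\<Sum>a\<in>{1..<i}. b a * b (i - a))"
      have "(\<Sum>a\<le>i. b a * b (i - a)) = b 0 * b i + (b i * b 0 + S)"
      proof -
        have "{..i} = insert 0 (insert i {1..<i})" using False by auto
        then show ?thesis using False by (simp add: S_def)
      qed
      also have "\<dots> = 2 * b i + S" using bcl[of i] root(4)[OF y] by (simp add: b_def mult.commute)
      finally have sum: "(\<Sum>a\<le>i. b a * b (i - a)) = 2 * b i + S" .
      have sq: "coeff (root y * root y) (2 * M - i) = 2 * b i + S"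
      proof -
        have "coeff (root y * root y) (2 * M - i) = (\<Sum>a\<le>i. b a * b (i - a))"
          unfolding b_def by (rule coeff_square_monic) (use root(3)[OF y] less.prems in auto)
        then show ?thesis using sum by simp
      qed
      have "poly (coeff G (2 * M - i)) y = coeff (eval_coeffs G y) (2 * M - i)" by simp
      also have "\<dots> = poly c y * (2 * b i + S)" unfolding root(5)[OF y] coeff_smult sq ..
      finally have Gi: "poly (coeff G (2 * M - i)) y = poly c y * (2 * b i + S)" .
      have "(\<Sum>a\<in>{1..<i}. poly (B a * B (i - a)) y) = (\<Sum>a\<in>{1..<i}. poly c y ^ i * (b a * b (i - a)))"
      proof (rule sum.cong)
        fix a assume a: "a \<in> {1..<i}"
        then have "poly (B a) y = poly c y ^ a * b a" "poly (B (i - a)) y = poly c y ^ (i - a) * b (i - a)"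
          using less.IH[of a] less.IH[of "i - a"] less.prems by (auto simp: b_def)
        moreover have "poly c y ^ i = poly c y ^ a * poly c y ^ (i - a)" using a by (simp flip: power_add)
        ultimately show "poly (B a * B (i - a)) y = poly c y ^ i * (b a * b (i - a))" by (simp add: mult_ac)
      qed simp
      also have "\<dots> = poly c y ^ i * S" by (simp add: S_def sum_distrib_left)
      finally have Ssum: "(\<Sum>a\<in>{1..<i}. poly (B a * B (i - a)) y) = poly c y ^ i * S" .
      have ci: "poly c y ^ (i - 1) * poly c y = poly c y ^ i" using False by (cases i) (auto simp: mult.commute)
      have "poly (B i) y = \<eta> * (poly c y ^ (i - 1) * (poly c y * (2 * b i + S)) - poly c y ^ i * S)"
        using BS[of i] False Gi Ssum by (simp add: poly_sum)
      also have "poly c y ^ (i - 1) * (poly c y * (2 * b i + S)) = poly c y ^ i * (2 * b i + S)"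
        by (simp only: ci mult.assoc[symmetric])
      also have "\<eta> * (poly c y ^ i * (2 * b i + S) - poly c y ^ i * S) = poly c y ^ i * (2 * \<eta> * b i)"
        by (simp add: algebra_simps)
      also have "2 * \<eta> * b i = b i"
      proof -
        have "(e + e) * \<eta> = \<eta> + \<eta>" unfolding distrib_right \<eta>(1) ..
        then have "2 * \<eta> = e" using \<eta>(2) by (simp only: mult_2)
        then show ?thesis using bcl[of i] by simp
      qed
      finally show ?thesis by (simp add: b_def)
    qed
  qed
  define H where "H = (\<Sum>j\<le>M. monom (B (M - j) * c ^ j) j)"
  have coH: "coeff H j = (if j \<le> M then B (M - j) * c ^ j else 0)" for j
    unfolding H_def by (auto simp: coeff_sum sum.delta)
  have Hcl: "smult [:e:] H = H"
    unfolding poly_poly_closed_iff coH using Bcl by (auto, metis mult_smult_left)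
  have Heval: "eval_coeffs H y = smult (poly c y ^ M) (root y)" if y: "y \<in> Y'" for y
  proof (rule poly_eqI)
    fix j
    show "coeff (eval_coeffs H y) j = coeff (smult (poly c y ^ M) (root y)) j"
    proof (cases "j \<le> M")
      case True
      then have "poly c y ^ M = poly c y ^ (M - j) * poly c y ^ j" by (simp flip: power_add)
      then show ?thesis using True Beval[OF y, of "M - j"] by (simp add: coH mult_ac)
    next
      case False
      then show ?thesis using root(3)[OF y] by (simp add: coH coeff_eq_0)
    qed
  qed
  have Hsupp: "coeff H j = 0" if "j \<notin> E" for j
  proof (cases "j \<le> M")
    case True
    have "B (M - j) = 0"
    proof (rule poly_zero_if_many_roots[OF Bcl Y'fin])
      fix y assume y: "y \<in> Y'"
      have "coeff (root y) j = 0" using root(2)[OF y] that by blast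
      then show "e * y = y \<and> poly (B (M - j)) y = 0"
        using Beval[OF y, of "M - j"] True Y(2) y by (simp add: Y'_def)
    next
      have "degree (B (M - j)) \<le> M * d" using Bdeg[of "M - j"] by (meson diff_le_self le_trans mult_le_mono1)
      also have "\<dots> \<le> (N + 1) * d" using M G(3) by (intro mult_le_mono1) simp
      finally show "degree (B (M - j)) < card Y'" using Y'card by simp
    qed
    then show ?thesis by (simp add: coH)
  qed (simp add: coH)
  have Hdeg: "degree (coeff H j) \<le> M * d" for j
  proof (cases "j \<le> M")
    case True
    have "degree (B (M - j) * c ^ j) \<le> degree (B (M - j)) + degree (c ^ j)" by (rule degree_mult_le)
    also have "\<dots> \<le> (M - j) * d + d * j"
      using Bdeg degree_power_le[of c j] cdeg by (intro add_mono) (auto intro: le_trans[OF _ mult_le_mono1])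
    also have "\<dots> = M * d" using True by (metis add.commute distrib_right le_add_diff_inverse mult.commute)
    finally show ?thesis using True by (simp add: coH)
  qed (simp add: coH)
  have key: "smult (c ^ (2 * M)) G = smult c (H * H)"
  proof (rule poly_eqI)
    fix i
    define D where "D = coeff (smult (c ^ (2 * M)) G) i - coeff (smult c (H * H)) i"
    have HHcl: "smult e (coeff (H * H) i) = coeff (H * H) i"
      using Hcl poly_poly_closed_iff by (metis mult_smult_left)
    have Dcl: "smult e D = D"
      unfolding D_def smult_diff_right coeff_smult
      using Gcl[of i] HHcl by (metis mult_smult_right)
    have deg1: "degree (coeff (smult (c ^ (2 * M)) G) i) \<le> (2 * M + 1) * d"
    proof -
      have "degree (c ^ (2 * M) * coeff G i) \<le> degree (c ^ (2 * M)) + degree (coeff G i)" by (rule degree_mult_le)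
      also have "\<dots> \<le> d * (2 * M) + d"
        using degree_power_le[of c "2 * M"] cdeg G(2) by (intro add_mono) (auto intro: le_trans[OF _ mult_le_mono1])
      finally show ?thesis by (simp add: algebra_simps)
    qed
    have "degree (coeff (H * H) i) \<le> M * d + M * d"
      unfolding coeff_mult
      by (intro degree_sum_le) (auto intro: le_trans[OF degree_mult_le] add_mono Hdeg)
    then have deg2: "degree (coeff (smult c (H * H)) i) \<le> (2 * M + 1) * d"
      using degree_mult_le[of c "coeff (H * H) i"] cdeg by (simp add: algebra_simps)
    have "D = 0"
    proof (rule poly_zero_if_many_roots[OF Dcl Y'fin])
      fix y assume y: "y \<in> Y'"
      have p2: "poly (c ^ (2 * M)) y = poly c y ^ M * poly c y ^ M" by (simp add: mult_2 power_add)
      have "eval_coeffs (smult (c ^ (2 * M)) G) y = eval_coeffs (smult c (H * H)) y"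
        unfolding p2 eval_coeffs_smult eval_coeffs_mult Heval[OF y] root(5)[OF y]
        by (simp only: mult_smult_left mult_smult_right smult_smult mult_ac)
      then have "poly D y = 0" unfolding D_def by (metis coeff_eval_coeffs poly_diff right_minus_eq)
      then show "e * y = y \<and> poly D y = 0" using Y(2) y by (simp add: Y'_def)
    next
      have "degree D \<le> (2 * M + 1) * d" unfolding D_def by (rule degree_diff_le[OF deg1 deg2])
      also have "\<dots> \<le> (N + 1) * d" using M G(3) by (intro mult_le_mono1) simp
      finally show "degree D < card Y'" using Y'card by simp
    qed
    then show "coeff (smult (c ^ (2 * M)) G) i = coeff (smult c (H * H)) i" by (simp add: D_def)
  qed
  have "smult e (c ^ (2 * M)) \<noteq> 0" using degree_power[OF ccl cn] by blast
  moreover have "smult (smult e (c ^ (2 * M))) G = smult c (H * H)"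
  proof -
    have "smult (smult e (c ^ (2 * M))) G = smult [:e:] (smult (c ^ (2 * M)) G)" by simp
    also have "\<dots> = smult (c ^ (2 * M)) (smult [:e:] G)" by (simp add: mult.commute)
    finally show ?thesis using key G(1) by simp
  qed
  ultimately obtain l h where h: "e * l = l" "smult [:e:] h = h" "\<forall>i. coeff H i = 0 \<longrightarrow> coeff h i = 0" "G = smult [:l:] (h * h)"
    using remove_square_multiplier[OF smult_idem ccl G(1) Hcl _ _ nz] by blast
  have "l \<noteq> 0" using h(4) \<open>G \<noteq> 0\<close> by auto
  then have "2 * degree (coeff h i) \<le> d" for i
    using square_root_coeff_degree[OF h(2,1)] G(2) h(4) by blast
  then show ?thesis using h Hsupp by blast
qed

end

section \<open>Kronecker substitution\<close>

lemma coeff_pcompose_monom: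
  fixes p :: "'a::comm_ring_1 poly"
  assumes "w > 0"
  shows "coeff (pcompose p (monom 1 w)) n = (if w dvd n then coeff p (n div w) else 0)"
proof (induction p arbitrary: n)
  case 0
  then show ?case by simp
next
  case (pCons a p)
  have "coeff (pcompose (pCons a p) (monom 1 w)) n
      = (if n = 0 then a else 0) + (if n < w then 0 else coeff (pcompose p (monom 1 w)) (n - w))"
    by (cases n) (simp_all add: pcompose_pCons coeff_monom_mult)
  also have "\<dots> = (if w dvd n then coeff (pCons a p) (n div w) else 0)"
  proof (cases "n < w")
    case True
    then show ?thesis using assms by (auto dest: dvd_imp_le)
  next
    case False
    then have "w dvd n - w \<longleftrightarrow> w dvd n" "n div w = Suc ((n - w) div w)"
      using assms by (auto simp: le_div_geq intro: dvd_diffD1 dvd_minus_self[THEN iffD2] elim: dvd_diffD)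
    then show ?thesis using False assms pCons.IH by auto
  qed
  finally show ?case .
qed

text \<open>
  The substitution \<open>y = X\<^sup>w\<close> in a polynomial in \<open>X\<close> with coefficients in \<open>y\<close>. It is a ring homomorphism,
  and it loses no information on polynomials of degree less than \<open>w\<close> in \<open>X\<close> (\<open>coeff_flatten_digit\<close>).
\<close>

definition flatten :: "nat \<Rightarrow> 'a::comm_ring_1 poly poly \<Rightarrow> 'a poly"
  where "flatten w G = poly (map_poly (\<lambda>c. pcompose c (monom 1 w)) G) [:0, 1:]"

lemma flatten_0 [simp]: "flatten w 0 = 0"
  by (simp add: flatten_def)

lemma flatten_pCons: "flatten w (pCons c G) = pcompose c (monom 1 w) + [:0, 1:] * flatten w G"
  by (simp add: flatten_def map_poly_pCons)

lemma flatten_add: "flatten w (G + H) = flatten w G + flatten w H"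
proof (induction G H rule: poly_induct2)
  case (pCons a G b H)
  have "flatten w (pCons a G + pCons b H)
      = (pcompose a (monom 1 w) + pcompose b (monom 1 w)) + [:0, 1:] * (flatten w G + flatten w H)"
    by (simp only: add_pCons flatten_pCons pcompose_add pCons)
  then show ?case by (simp only: flatten_pCons distrib_left add_ac)
qed simp

lemma flatten_smult: "flatten w (smult c G) = pcompose c (monom 1 w) * flatten w G"
proof (induction G)
  case (pCons a G)
  then show ?case by (simp only: smult_pCons flatten_pCons pcompose_mult distrib_left mult.left_commute)
qed simp

lemma flatten_mult: "flatten w (G * H) = flatten w G * flatten w H"
proof (induction G)
  case (pCons a G)
  have "flatten w (pCons a G * H) = flatten w (smult a H) + flatten w (pCons 0 (G * H))"
    by (simp only: mult_pCons_left flatten_add)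
  also have "\<dots> = pcompose a (monom 1 w) * flatten w H + [:0, 1:] * (flatten w G * flatten w H)"
    by (simp only: flatten_smult flatten_pCons pCons pcompose_0 add_0_left)
  finally show ?case by (simp only: flatten_pCons distrib_right mult.assoc)
qed simp

lemma flatten_sum: "flatten w (sum f A) = (\<Sum>i\<in>A. flatten w (f i))"
  by (induction A rule: infinite_finite_induct) (simp_all add: flatten_add)

lemma flatten_monom: "flatten w (monom c n) = pcompose c (monom 1 w) * monom 1 n"
proof (induction n)
  case 0
  then show ?case by (simp add: monom_0 flatten_pCons one_pCons[symmetric])
next
  case (Suc n)
  have "monom (1::'a) (Suc n) = [:0, 1:] * monom 1 n" by (simp add: monom_Suc)
  then show ?case
    by (simp only: Suc monom_Suc[of c] flatten_pCons pcompose_0 add_0_left mult.left_commute)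
qed

lemma pcompose_monom_monom: "pcompose (monom c b) (monom (1::'a::comm_ring_1) w) = monom c (w * b)"
  by (induction b) (simp_all add: monom_0 monom_Suc pcompose_pCons mult_monom)

lemma coeff_flatten:
  assumes "w > 0"
  shows "coeff (flatten w G) n = (\<Sum>i\<le>degree G. if i \<le> n \<and> w dvd (n - i) then coeff (coeff G i) ((n - i) div w) else 0)"
proof -
  have "flatten w G = flatten w (\<Sum>i\<le>degree G. monom (coeff G i) i)" by (simp add: poly_as_sum_of_monoms)
  also have "\<dots> = (\<Sum>i\<le>degree G. monom 1 i * pcompose (coeff G i) (monom 1 w))"
    unfolding flatten_sum flatten_monom by (simp only: mult.commute)
  finally show ?thesis
    by (simp only: coeff_sum coeff_monom_mult coeff_pcompose_monom[OF assms]) (auto intro!: sum.cong)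
qed

lemma coeff_flatten_nonzero:
  assumes "w > 0" "coeff (flatten w G) n \<noteq> 0"
  shows "\<exists>i b. n = i + w * b \<and> coeff (coeff G i) b \<noteq> 0"
proof -
  obtain i where i: "(if i \<le> n \<and> w dvd (n - i) then coeff (coeff G i) ((n - i) div w) else 0) \<noteq> 0"
    using assms(2) unfolding coeff_flatten[OF assms(1)] by (rule sum.not_neutral_contains_not_neutral)
  then have "n = i + w * ((n - i) div w) \<and> coeff (coeff G i) ((n - i) div w) \<noteq> 0" by (auto split: if_splits)
  then show ?thesis by blast
qed

lemma coeff_flatten_digit:
  assumes "degree G < w" "i < w"
  shows "coeff (flatten w G) (i + w * b) = coeff (coeff G i) b"
proof -
  have w: "w > 0" using assms by simp
  have "coeff (flatten w G) (i + w * b)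
    = (\<Sum>j\<le>degree G. if j = i then coeff (coeff G i) b else 0)"
    unfolding coeff_flatten[OF w]
  proof (rule sum.cong)
    fix j assume "j \<in> {..degree G}"
    then have j: "j < w" using assms by simp
    have "j = i" if "j \<le> i + w * b" "w dvd (i + w * b - j)"
    proof -
      have "(i + w * b) mod w = j mod w" using that mod_eq_dvd_iff_nat[of j "i + w * b" w] by simp
      then show ?thesis using j assms(2) by simp
    qed
    then show "(if j \<le> i + w * b \<and> w dvd (i + w * b - j) then coeff (coeff G j) ((i + w * b - j) div w) else 0)
      = (if j = i then coeff (coeff G i) b else 0)" using w by auto
  qed simp
  also have "\<dots> = coeff (coeff G i) b" by (simp add: coeff_eq_0)
  finally show ?thesis .
qed

section \<open>Restrictions of the polynomial to the first variables\<close>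

text \<open>
  The form in which all exceptional sets are bounded: it suffices to bound their intersections with the
  lines parallel to one coordinate axis.
\<close>

lemma card_le_of_lines:
  assumes "finite I" "i \<in> I" "finite K" "S \<subseteq> I \<rightarrow>\<^sub>E K"
    and lines: "\<And>\<psi>. \<psi> \<in> (I - {i}) \<rightarrow>\<^sub>E K \<Longrightarrow> card {y\<in>K. \<psi>(i := y) \<in> S} \<le> c"
  shows "card S \<le> c * card K ^ (card I - 1)"
proof -
  define P where "P = (I - {i}) \<rightarrow>\<^sub>E K"
  define T where "T = (SIGMA \<psi>:P. {y\<in>K. \<psi>(i := y) \<in> S})"
  have finP: "finite P" unfolding P_def using assms by (intro finite_PiE) auto
  have upd: "(restrict \<phi> (I - {i}))(i := \<phi> i) = \<phi>" if "\<phi> \<in> I \<rightarrow>\<^sub>E K" for \<phi>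
    using that by (auto simp: fun_eq_iff PiE_def extensional_def)
  have "inj_on (\<lambda>\<phi>. (restrict \<phi> (I - {i}), \<phi> i)) S"
    using upd assms(4) by (intro inj_onI) (metis Pair_inject subsetD)
  moreover have "(\<lambda>\<phi>. (restrict \<phi> (I - {i}), \<phi> i)) ` S \<subseteq> T"
  proof
    fix z assume "z \<in> (\<lambda>\<phi>. (restrict \<phi> (I - {i}), \<phi> i)) ` S"
    then obtain \<phi> where \<phi>: "\<phi> \<in> S" "z = (restrict \<phi> (I - {i}), \<phi> i)" by blast
    then have I: "\<phi> \<in> I \<rightarrow>\<^sub>E K" using assms(4) by blast
    then have "restrict \<phi> (I - {i}) \<in> P" "\<phi> i \<in> K" unfolding P_def using assms(2) by auto
    then show "z \<in> T" unfolding T_def \<phi>(2) using upd[OF I] \<phi>(1) by simp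
  qed
  moreover have "finite T" unfolding T_def by (rule finite_SigmaI[OF finP]) (use assms(3) in simp)
  ultimately have "card S \<le> card T" by (rule card_inj_on_le)
  also have "card T = (\<Sum>\<psi>\<in>P. card {y\<in>K. \<psi>(i := y) \<in> S})"
    unfolding T_def by (rule card_SigmaI[OF finP]) (use assms(3) in simp)
  also have "\<dots> \<le> (\<Sum>\<psi>\<in>P. c)" using lines by (intro sum_mono) (auto simp: P_def)
  also have "\<dots> = c * card K ^ (card I - 1)"
    using assms(1,2) by (simp add: P_def card_PiE mult.commute)
  finally show ?thesis .
qed

text \<open>
  A symmetric primitive polynomial \<open>f\<close> with coefficients in \<open>K\<close>. The last assumption is primitivity: the polynomial in \<open>x\<^sub>1\<close> obtained by fixing the other
  variables in the algebraically closed field is not zero.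
\<close>

locale multi_poly = finite_field_idem e K q for e :: "'r::comm_ring_1" and K q +
  fixes k d :: nat and f :: "nat multiset \<Rightarrow> 'r"
  assumes k_ge_2: "k \<ge> 2"
    and f_finite: "finite {m. f m \<noteq> 0}"
    and f_vars: "f m \<noteq> 0 \<Longrightarrow> set_mset m \<subseteq> {1..k}"
    and f_degree: "f m \<noteq> 0 \<Longrightarrow> size m \<le> d"
    and f_K: "f m \<in> K"
    and f_sym: "\<pi> permutes {1..k} \<Longrightarrow> f (image_mset \<pi> m) = f m"
    and f_primitive: "(\<And>i. i \<in> {2..k} \<Longrightarrow> e * a i = a i) \<Longrightarrow>
      (\<Sum>m\<in>{m. f m \<noteq> 0}. monom (f m * (\<Prod>i\<in>{2..k}. a i ^ count m i)) (count m 1)) \<noteq> 0"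
begin

definition supp :: "nat multiset set" where "supp = {m. f m \<noteq> 0}"

definition mono_value :: "nat set \<Rightarrow> (nat \<Rightarrow> 'r) \<Rightarrow> nat multiset \<Rightarrow> 'r"
  where "mono_value I a m = (\<Prod>i\<in>I. a i ^ count m i)"

definition value_at :: "(nat \<Rightarrow> 'r) \<Rightarrow> 'r"
  where "value_at a = (\<Sum>m\<in>supp. f m * mono_value {1..k} a m)"

definition fibre :: "nat \<Rightarrow> (nat \<Rightarrow> 'r) \<Rightarrow> 'r poly"
  where "fibre i a = (\<Sum>m\<in>supp. monom (f m * mono_value ({1..k} - {i}) a m) (count m i))"

lemma supp_finite: "finite supp" using f_finite by (simp add: supp_def)

lemma count_le_d: "m \<in> supp \<Longrightarrow> count m i \<le> d"
  using f_degree[of m] by (auto simp: supp_def intro: le_trans[OF count_le_size])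

lemma mono_value_cong: "(\<And>i. i \<in> I \<Longrightarrow> a i = b i) \<Longrightarrow> mono_value I a m = mono_value I b m"
  by (simp add: mono_value_def)

lemma mono_value_insert: "i \<notin> I \<Longrightarrow> finite I \<Longrightarrow> mono_value (insert i I) a m = a i ^ count m i * mono_value I a m"
  by (simp add: mono_value_def)

lemma f_closed: "e * f m = f m" using f_K K_closed by blast

lemma fibre_closed: "smult e (fibre i a) = fibre i a"
  unfolding fibre_def smult_sum_right smult_monom mult.assoc[symmetric] f_closed ..

lemma degree_fibre: "degree (fibre i a) \<le> d"
  unfolding fibre_def using count_le_d supp_finite
  by (intro degree_sum_le) (auto intro: le_trans[OF degree_monom_le])

lemma fibre_cong: "(\<And>j. j \<in> {1..k} - {i} \<Longrightarrow> a j = b j) \<Longrightarrow> fibre i a = fibre i b"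
  unfolding fibre_def using mono_value_cong[of "{1..k} - {i}" a b] by (intro sum.cong) auto

lemma poly_fibre:
  assumes "i \<in> {1..k}" shows "poly (fibre i a) y = value_at (a(i := y))"
proof -
  have "mono_value {1..k} (a(i := y)) m = y ^ count m i * mono_value ({1..k} - {i}) a m" for m
  proof -
    have "mono_value (insert i ({1..k} - {i})) (a(i := y)) m = y ^ count m i * mono_value ({1..k} - {i}) (a(i := y)) m"
      by (subst mono_value_insert) auto
    moreover have "mono_value ({1..k} - {i}) (a(i := y)) m = mono_value ({1..k} - {i}) a m" by (rule mono_value_cong) auto
    ultimately show ?thesis using assms by (simp add: insert_absorb)
  qed
  then show ?thesis unfolding fibre_def value_at_def poly_sum poly_monom by (simp add: mult_ac)
qed

text \<open>
  By symmetry every variable can play the part of \<open>x\<^sub>1\<close>.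
\<close>

lemma fibre_swap:
  assumes i: "i \<in> {1..k}"
  shows "fibre i a = fibre 1 (a \<circ> Transposition.transpose 1 i)"
proof -
  define \<tau> where "\<tau> = Transposition.transpose (1::nat) i"
  have perm: "\<tau> permutes {1..k}" using i k_ge_2 unfolding \<tau>_def by (intro permutes_swap_id) auto
  have t1: "\<tau> 1 = i" by (simp add: \<tau>_def)
  have inj: "inj \<tau>" using perm permutes_inj by blast
  have inv: "\<tau> (\<tau> x) = x" for x by (simp add: \<tau>_def)
  have cnt: "count (image_mset \<tau> m) x = count m (\<tau> x)" for m x
  proof -
    have "count (image_mset \<tau> m) (\<tau> (\<tau> x)) = count m (\<tau> x)"
      by (induction m) (use inj in \<open>auto dest: injD\<close>)
    then show ?thesis by (simp add: inv)
  qed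
  have inv_ms: "image_mset \<tau> (image_mset \<tau> m) = m" for m
    by (rule multiset_eqI) (simp add: cnt inv)
  have S: "image_mset \<tau> m \<in> supp \<longleftrightarrow> m \<in> supp" for m using f_sym[OF perm] by (simp add: supp_def)
  have "fibre 1 (a \<circ> \<tau>) = (\<Sum>m\<in>supp. monom (f (image_mset \<tau> m) * mono_value ({1..k} - {1}) (a \<circ> \<tau>) (image_mset \<tau> m)) (count (image_mset \<tau> m) 1))"
    unfolding fibre_def
    by (rule sum.reindex_bij_witness[of _ "image_mset \<tau>" "image_mset \<tau>"]) (auto simp: S inv_ms)
  also have "\<dots> = fibre i a" unfolding fibre_def
  proof (rule sum.cong)
    fix m
    have "mono_value ({1..k} - {1}) (a \<circ> \<tau>) (image_mset \<tau> m) = mono_value ({1..k} - {i}) a m"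
      unfolding mono_value_def cnt
    proof (rule prod.reindex_bij_witness[of _ \<tau> \<tau>])
      fix j assume j: "j \<in> {1..k} - {i}"
      then have "j \<noteq> i" by simp
      then have "\<tau> j \<noteq> 1" using inv[of j] t1 by metis
      then show "\<tau> j \<in> {1..k} - {1}" using permutes_in_image[OF perm, of j] j by auto
    next
      fix j assume j: "j \<in> {1..k} - {1}"
      then have "\<tau> j \<noteq> i" using inv[of j] t1 inv[of 1] by auto
      then show "\<tau> j \<in> {1..k} - {i}" using permutes_in_image[OF perm, of j] j by auto
    qed (auto simp: inv)
    then show "monom (f (image_mset \<tau> m) * mono_value ({1..k} - {1}) (a \<circ> \<tau>) (image_mset \<tau> m)) (count (image_mset \<tau> m) 1)
      = monom (f m * mono_value ({1..k} - {i}) a m) (count m i)"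
      using f_sym[OF perm] by (simp add: cnt) (simp add: \<tau>_def)
  qed simp
  finally show ?thesis by (simp add: \<tau>_def)
qed

lemma Icc_minus_1: "{1..k} - {1} = {2..k}" by auto

lemma fibre_nonzero:
  assumes i: "i \<in> {1..k}" and a: "\<And>j. j \<in> {1..k} - {i} \<Longrightarrow> e * a j = a j"
  shows "fibre i a \<noteq> 0"
proof -
  let ?\<tau> = "Transposition.transpose (1::nat) i"
  have "e * (a \<circ> ?\<tau>) j = (a \<circ> ?\<tau>) j" if "j \<in> {2..k}" for j
    using a[of "?\<tau> j"] that i by (auto simp: Transposition.transpose_def)
  then have "fibre 1 (a \<circ> ?\<tau>) \<noteq> 0"
    using f_primitive[of "a \<circ> ?\<tau>"] unfolding fibre_def Icc_minus_1 mono_value_def supp_def by blast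
  then show ?thesis using fibre_swap[OF i] by simp
qed

text \<open>
  The exponent of the monomial \<open>m\<close> under the substitution of \<open>X\<close> to the power \<open>(d + 1)\<^bsup>i-1\<^esup>\<close> for \<open>x\<^sub>i\<close>,
  \<open>i \<le> j\<close>. Partial degrees are at most \<open>d\<close>, hence they are the digits of this number to base \<open>d + 1\<close>.
\<close>

definition kronecker_exp :: "nat \<Rightarrow> nat multiset \<Rightarrow> nat"
  where "kronecker_exp j m = (\<Sum>i<j. count m (Suc i) * (d + 1) ^ i)"

lemma kronecker_exp_less: "m \<in> supp \<Longrightarrow> kronecker_exp j m < (d + 1) ^ j"
proof (induction j)
  case (Suc j)
  have "count m (Suc j) * (d + 1) ^ j \<le> d * (d + 1) ^ j" using count_le_d[OF Suc.prems] by (intro mult_le_mono1)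
  then have "kronecker_exp (Suc j) m < (d + 1) ^ j + d * (d + 1) ^ j"
    unfolding kronecker_exp_def sum.lessThan_Suc using Suc unfolding kronecker_exp_def by (intro add_less_le_mono) auto
  then show ?case by simp
qed (simp add: kronecker_exp_def)

text \<open>
  The polynomial that \<open>f\<close> induces on \<open>x\<^sub>1, \<dots>, x\<^sub>j\<close> when the later variables are given by \<open>a\<close>, turned into
  a polynomial in one variable. In \<open>kronecker2\<close> the variable \<open>x\<^bsub>j+1\<^esub>\<close> is kept as a second variable.
\<close>

definition kronecker :: "nat \<Rightarrow> (nat \<Rightarrow> 'r) \<Rightarrow> 'r poly"
  where "kronecker j a = (\<Sum>m\<in>supp. monom (f m * mono_value {Suc j..k} a m) (kronecker_exp j m))"

definition kronecker2 :: "nat \<Rightarrow> (nat \<Rightarrow> 'r) \<Rightarrow> 'r poly poly"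
  where "kronecker2 j a = (\<Sum>m\<in>supp. monom (monom (f m * mono_value {Suc (Suc j)..k} a m) (count m (Suc j))) (kronecker_exp j m))"

lemma kronecker_cong: "(\<And>i. i \<in> {Suc j..k} \<Longrightarrow> a i = b i) \<Longrightarrow> kronecker j a = kronecker j b"
  unfolding kronecker_def using mono_value_cong[of "{Suc j..k}" a b] by (intro sum.cong) auto

lemma kronecker_1: "kronecker 1 a = fibre 1 a"
  unfolding kronecker_def fibre_def Icc_minus_1 by (simp add: kronecker_exp_def numeral_2_eq_2)

lemma eval_kronecker2:
  assumes "j < k" shows "eval_coeffs (kronecker2 j a) y = kronecker j (a(Suc j := y))"
proof (rule poly_eqI)
  fix n
  have "mono_value {Suc j..k} (a(Suc j := y)) m = y ^ count m (Suc j) * mono_value {Suc (Suc j)..k} a m" for m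
  proof -
    have "{Suc j..k} = insert (Suc j) {Suc (Suc j)..k}" using assms by auto
    moreover have "mono_value {Suc (Suc j)..k} (a(Suc j := y)) m = mono_value {Suc (Suc j)..k} a m" by (rule mono_value_cong) auto
    ultimately show ?thesis by (simp add: mono_value_insert)
  qed
  then show "coeff (eval_coeffs (kronecker2 j a) y) n = coeff (kronecker j (a(Suc j := y))) n"
    unfolding kronecker_def kronecker2_def coeff_eval_coeffs coeff_sum poly_sum
    by (intro sum.cong) (auto simp: poly_monom mult_ac)
qed

lemma flatten_kronecker2: "flatten ((d + 1) ^ j) (kronecker2 j a) = kronecker (Suc j) a"
  unfolding kronecker_def kronecker2_def flatten_sum flatten_monom pcompose_monom_monom mult_monom
  by (simp add: kronecker_exp_def mult.commute add.commute)

lemma degree_kronecker2: "degree (kronecker2 j a) < (d + 1) ^ j"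
  unfolding kronecker2_def
proof (rule degree_sum_less)
  fix m assume "m \<in> supp"
  then show "degree (monom (monom (f m * mono_value {Suc (Suc j)..k} a m) (count m (Suc j))) (kronecker_exp j m)) < (d + 1) ^ j"
    using le_less_trans[OF degree_monom_le kronecker_exp_less] by blast
qed simp

lemma degree_coeff_kronecker2: "degree (coeff (kronecker2 j a) i) \<le> d"
  unfolding kronecker2_def coeff_sum using supp_finite count_le_d
  by (intro degree_sum_le) (auto intro: le_trans[OF degree_monom_le])

lemma kronecker2_closed: "smult [:e:] (kronecker2 j a) = kronecker2 j a"
proof -
  have "e * (f m * x) = f m * x" for m x using mult_closed[OF f_closed] .
  then show ?thesis unfolding kronecker2_def smult_sum_right by (simp add: smult_monom)
qed

text \<open>
  If the polynomial in \<open>x\<^sub>1, \<dots>, x\<^bsub>j+1\<^esub>\<close> vanished, then so would its specialisations of \<open>x\<^bsub>j+1\<^esub>\<close>, down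
  to \<open>j = 1\<close>, where primitivity applies.
\<close>

lemma kronecker_nonzero:
  assumes "j \<ge> 1" "j \<le> k" "\<And>i. i \<in> {Suc j..k} \<Longrightarrow> e * a i = a i"
  shows "kronecker j a \<noteq> 0"
  using assms
proof (induction j arbitrary: a rule: dec_induct)
  case base
  then show ?case using fibre_nonzero[of 1 a] k_ge_2 unfolding kronecker_1 by auto
next
  case (step j)
  show ?case
  proof
    assume *: "kronecker (Suc j) a = 0"
    have "coeff (coeff (kronecker2 j a) i) b = 0" for i b
    proof (cases "i < (d + 1) ^ j")
      case True
      then show ?thesis using coeff_flatten_digit[OF degree_kronecker2[of j a] True, of b] * flatten_kronecker2 by simp
    next
      case False
      then show ?thesis using degree_kronecker2[of j a] by (simp add: coeff_eq_0)
    qed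
    then have "kronecker2 j a = 0" by (simp add: poly_eq_iff)
    then have "kronecker j (a(Suc j := 0)) = 0"
      using eval_kronecker2[of j a 0] step by (simp add: eval_coeffs_def)
    moreover have "kronecker j (a(Suc j := 0)) \<noteq> 0" using step.prems by (intro step.IH) auto
    ultimately show False by simp
  qed
qed

text \<open>
  The exponents of monomials in \<open>x\<^sub>1, \<dots>, x\<^sub>j\<close> whose partial degrees are at most \<open>d / 2\<close>. A square root
  supported on such exponents is squared without carries, and so comes from a square root in several
  variables.
\<close>

definition digits :: "nat \<Rightarrow> nat set"
  where "digits j = {N. \<exists>a. (\<forall>i. 2 * a i \<le> d) \<and> N = (\<Sum>i<j. a i * (d + 1) ^ i)}"

lemma digits_Suc:
  assumes "N \<in> digits j" "2 * b \<le> d" shows "N + (d + 1) ^ j * b \<in> digits (Suc j)"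
proof -
  obtain a where a: "\<forall>i. 2 * a i \<le> d" "N = (\<Sum>i<j. a i * (d + 1) ^ i)" using assms digits_def by auto
  then have "\<forall>i. 2 * (a(j := b)) i \<le> d" "N + (d + 1) ^ j * b = (\<Sum>i<Suc j. (a(j := b)) i * (d + 1) ^ i)"
    using assms(2) by auto
  then show ?thesis unfolding digits_def by blast
qed

definition square_on_first :: "nat \<Rightarrow> (nat \<Rightarrow> 'r) \<Rightarrow> bool"
  where "square_on_first j a \<longleftrightarrow> (\<exists>l h. e * l = l \<and> smult e h = h \<and> (\<forall>i. coeff h i \<noteq> 0 \<longrightarrow> i \<in> digits j) \<and> kronecker j a = smult l (h * h))"

lemma square_on_first_cong: "(\<And>i. i \<in> {Suc j..k} \<Longrightarrow> a i = b i) \<Longrightarrow> square_on_first j a \<longleftrightarrow> square_on_first j b"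
  using kronecker_cong[of j a b] by (simp add: square_on_first_def)

lemma square_on_first_1:
  assumes "const_square (fibre 1 a)" "fibre 1 a \<noteq> 0" shows "square_on_first 1 a"
proof -
  obtain l h where h: "e * l = l" "smult e h = h" "fibre 1 a = smult l (h * h)" using assms const_square_def by auto
  have hn: "h \<noteq> 0" "l \<noteq> 0" using h assms by auto
  have "smult e (h * h) = h * h" using h(2) by (metis mult_smult_left)
  then have "degree (fibre 1 a) = 2 * degree h"
    unfolding h(3) using degree_smult_nonzero[OF h(1) hn(2)] degree_mult[OF h(2) h(2) hn(1) hn(1)] by simp
  then have dh: "2 * degree h \<le> d" using degree_fibre[of 1 a] by simp
  have "i \<in> digits 1" if "coeff h i \<noteq> 0" for i
  proof -
    have "2 * i \<le> d" using le_degree[OF that] dh by simp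
    then show ?thesis unfolding digits_def by (intro CollectI exI[of _ "\<lambda>_. i"]) simp
  qed
  then show ?thesis unfolding square_on_first_def kronecker_1 using h by blast
qed

lemma two_e: "e + e \<noteq> 0"
  using e_neq_minus_e by (metis add_eq_0_iff)

text \<open>
  The result \<open>square_of_many_square_specialisations\<close> applies to \<open>kronecker2\<close>, with \<open>y\<close> in the
  part of \<open>x\<^bsub>j+1\<^esub>\<close>. The support condition and the degree bound \<open>d / 2\<close> in \<open>y\<close> keep the exponents of the
  new square root among the \<open>digits\<close>.
\<close>

lemma square_on_first_step:
  assumes j: "1 \<le> j" "j < k" and a: "\<And>i. i \<in> {Suc (Suc j)..k} \<Longrightarrow> e * a i = a i"
    and card: "card {y\<in>K. square_on_first j (a(Suc j := y))} > ((d + 1) ^ j + 2) * d"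
  shows "square_on_first (Suc j) a"
proof -
  let ?Y = "{y\<in>K. square_on_first j (a(Suc j := y))}"
  have "\<exists>l h. e * l = l \<and> smult [:e:] h = h \<and> (\<forall>i. coeff h i \<noteq> 0 \<longrightarrow> i \<in> digits j)
    \<and> kronecker2 j a = smult [:l:] (h * h) \<and> (\<forall>i. 2 * degree (coeff h i) \<le> d)"
  proof (rule square_of_many_square_specialisations[OF two_e kronecker2_closed, where Y = ?Y])
    show "degree (coeff (kronecker2 j a) i) \<le> d" for i by (rule degree_coeff_kronecker2)
    show "degree (kronecker2 j a) \<le> (d + 1) ^ j" using degree_kronecker2[of j a] by simp
    show "finite ?Y" using K_finite by simp
    show "e * y = y" if "y \<in> ?Y" for y using that K_closed by simp
    show "card ?Y > ((d + 1) ^ j + 2) * d" by (rule card)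
    show "\<exists>l h. e * l = l \<and> smult e h = h \<and> (\<forall>i. coeff h i \<noteq> 0 \<longrightarrow> i \<in> digits j) \<and> eval_coeffs (kronecker2 j a) y = smult l (h * h)"
      if "y \<in> ?Y" for y using that unfolding eval_kronecker2[OF j(2)] square_on_first_def by simp
    show "eval_coeffs (kronecker2 j a) y \<noteq> 0" if "e * y = y" for y
      unfolding eval_kronecker2[OF j(2)] using j a that by (intro kronecker_nonzero) auto
  qed
  then obtain l h where h: "e * l = l" "smult [:e:] h = h" "\<forall>i. coeff h i \<noteq> 0 \<longrightarrow> i \<in> digits j"
    "kronecker2 j a = smult [:l:] (h * h)" "\<forall>i. 2 * degree (coeff h i) \<le> d" by blast
  define w where "w = (d + 1) ^ j"
  have w: "w > 0" by (simp add: w_def)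
  have "kronecker (Suc j) a = smult l (flatten w h * flatten w h)"
    unfolding flatten_kronecker2[symmetric] h(4) w_def flatten_smult flatten_mult by simp
  moreover have "smult e (flatten w h) = flatten w h"
    using arg_cong[OF h(2), of "flatten w"] unfolding flatten_smult by simp
  moreover have "n \<in> digits (Suc j)" if nz: "coeff (flatten w h) n \<noteq> 0" for n
  proof -
    obtain i b where ib: "n = i + w * b" "coeff (coeff h i) b \<noteq> 0" using coeff_flatten_nonzero[OF w nz] by blast
    then have "coeff h i \<noteq> 0" by auto
    then have "i \<in> digits j" using h(3) by blast
    moreover have "2 * b \<le> d" using h(5) le_degree[OF ib(2)] by (meson le_trans mult_le_mono2)
    ultimately show ?thesis using digits_Suc ib(1) unfolding w_def by blast
  qed
  ultimately show ?thesis unfolding square_on_first_def using h(1) by blast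
qed

end

section \<open>The character sum over octahedra\<close>

definition sq_bound :: "nat \<Rightarrow> nat \<Rightarrow> nat"
  where "sq_bound k d = (k - 1) * (((d + 1) ^ k + 2) * d)"

definition bad_bound :: "nat \<Rightarrow> nat \<Rightarrow> nat"
  where "bad_bound k d = sq_bound k d + 2 ^ (k - 1) * (d * d)"

definition char_sum_const :: "nat \<Rightarrow> nat \<Rightarrow> real"
  where "char_sum_const k d = (9 * real (2 ^ (k - 1) * d) + 14) ^ 2 + real (bad_bound k d)"

context multi_poly
begin

text \<open>
  If the property holds for \<open>j = 1\<close> but not for \<open>j = k\<close>, it is lost at some step from \<open>j\<close> to \<open>j + 1\<close>. For
  fixed \<open>j\<close>, whether it fails at \<open>j + 1\<close> does not depend on the value of \<open>x\<^bsub>j+1\<^esub>\<close>, and if it does fail,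
  only boundedly many of these values satisfy it at \<open>j\<close>.
\<close>

lemma card_square_fibres:
  assumes nonsq: "\<And>a. \<not> square_on_first k a"
  shows "card {v \<in> {2..k} \<rightarrow>\<^sub>E K. square_on_first 1 v} \<le> sq_bound k d * q ^ (k - 2)"
proof -
  define c where "c = ((d + 1) ^ k + 2) * d"
  define T where "T j = {v \<in> {2..k} \<rightarrow>\<^sub>E K. square_on_first j v \<and> \<not> square_on_first (Suc j) v}" for j
  have cardI: "card {2..k} - 1 = k - 2" by simp
  have T_card: "card (T j) \<le> c * q ^ (k - 2)" if j: "j \<in> {1..<k}" for j
  proof -
    have "card (T j) \<le> c * card K ^ (card {2..k} - 1)"
    proof (rule card_le_of_lines[where i = "Suc j"])
      show "Suc j \<in> {2..k}" using j by auto
      fix \<psi> assume \<psi>: "\<psi> \<in> ({2..k} - {Suc j}) \<rightarrow>\<^sub>E K"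
      have indep: "square_on_first (Suc j) (\<psi>(Suc j := y)) \<longleftrightarrow> square_on_first (Suc j) \<psi>" for y by (rule square_on_first_cong) auto
      show "card {y \<in> K. \<psi>(Suc j := y) \<in> T j} \<le> c"
      proof (cases "square_on_first (Suc j) \<psi>")
        case True
        then have "{y \<in> K. \<psi>(Suc j := y) \<in> T j} = {}" using indep by (auto simp: T_def)
        then show ?thesis by (simp only: card.empty zero_le)
      next
        case False
        have "e * \<psi> i = \<psi> i" if "i \<in> {Suc (Suc j)..k}" for i
          using PiE_mem[OF \<psi>, of i] that j by (intro K_closed) auto
        then have "card {y\<in>K. square_on_first j (\<psi>(Suc j := y))} \<le> ((d + 1) ^ j + 2) * d"
          using square_on_first_step[of j \<psi>] False j by (meson atLeastLessThan_iff leI)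
        also have "\<dots> \<le> c" unfolding c_def using j by (intro mult_le_mono1 add_le_mono1 power_increasing) auto
        finally have 1: "card {y\<in>K. square_on_first j (\<psi>(Suc j := y))} \<le> c" .
        have "{y \<in> K. \<psi>(Suc j := y) \<in> T j} \<subseteq> {y\<in>K. square_on_first j (\<psi>(Suc j := y))}" by (auto simp: T_def)
        then have "card {y \<in> K. \<psi>(Suc j := y) \<in> T j} \<le> card {y\<in>K. square_on_first j (\<psi>(Suc j := y))}"
          using K_finite by (intro card_mono) auto
        then show ?thesis using 1 by (rule le_trans)
      qed
    qed (use K_finite in \<open>auto simp: T_def\<close>)
    then show ?thesis unfolding cardI K_card .
  qed
  have sub: "{v \<in> {2..k} \<rightarrow>\<^sub>E K. square_on_first 1 v} \<subseteq> (\<Union>j\<in>{1..<k}. T j)"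
  proof
    fix v assume v: "v \<in> {v \<in> {2..k} \<rightarrow>\<^sub>E K. square_on_first 1 v}"
    have "\<exists>j\<in>{1..<k}. square_on_first j v \<and> \<not> square_on_first (Suc j) v"
    proof (rule ccontr)
      assume "\<not> ?thesis"
      then have up: "square_on_first j v \<Longrightarrow> square_on_first (Suc j) v" if "1 \<le> j" "j < k" for j using that by auto
      have "j \<ge> 1 \<Longrightarrow> j \<le> k \<Longrightarrow> square_on_first j v" for j
      proof (induction j rule: dec_induct)
        case base then show ?case using v by simp
      next
        case (step j) then show ?case using up by simp
      qed
      from this[of k] show False using nonsq[of v] k_ge_2 by simp
    qed
    then show "v \<in> (\<Union>j\<in>{1..<k}. T j)" using v by (auto simp: T_def)
  qed
  have finT: "finite (T j)" for j unfolding T_def using K_finite by (simp add: finite_PiE)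
  have "card {v \<in> {2..k} \<rightarrow>\<^sub>E K. square_on_first 1 v} \<le> card (\<Union>j\<in>{1..<k}. T j)"
    using finT by (intro card_mono[OF _ sub]) auto
  also have "\<dots> \<le> (\<Sum>j\<in>{1..<k}. card (T j))" by (rule card_UN_le) simp
  also have "\<dots> \<le> (\<Sum>j\<in>{1..<k}. c * q ^ (k - 2))" by (rule sum_mono) (rule T_card)
  also have "\<dots> = sq_bound k d * q ^ (k - 2)" by (simp add: sq_bound_def c_def)
  finally show ?thesis .
qed

definition choices :: "nat set \<Rightarrow> (nat \<Rightarrow> bool) set" where "choices I = I \<rightarrow>\<^sub>E UNIV"

definition tuples :: "nat set \<Rightarrow> (nat \<times> bool \<Rightarrow> 'r) set" where "tuples I = (I \<times> UNIV) \<rightarrow>\<^sub>E K"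

definition pick :: "(nat \<times> bool \<Rightarrow> 'r) \<Rightarrow> (nat \<Rightarrow> bool) \<Rightarrow> nat \<Rightarrow> 'r" where "pick u \<epsilon> i = u (i, \<epsilon> i)"

text \<open>
  The polynomial \<open>P\<^sub>u\<close> whose character sum occurs twice, once for each copy of \<open>x\<^sub>1\<close>.
\<close>

definition fibre_prod :: "(nat \<times> bool \<Rightarrow> 'r) \<Rightarrow> 'r poly"
  where "fibre_prod u = (\<Prod>\<epsilon>\<in>choices {2..k}. fibre 1 (pick u \<epsilon>))"

lemma choices_finite: "finite I \<Longrightarrow> finite (choices I)" by (simp add: choices_def finite_PiE)

lemma choices_card: "finite I \<Longrightarrow> card (choices I) = 2 ^ card I" by (simp add: choices_def card_PiE)

lemma tuples_finite: "finite I \<Longrightarrow> finite (tuples I)" using K_finite by (simp add: tuples_def finite_PiE)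

lemma tuples_card: "finite I \<Longrightarrow> card (tuples I) = q ^ (2 * card I)"
  by (simp add: tuples_def card_PiE K_card card_cartesian_product mult.commute)

lemma pick_K: "u \<in> tuples I \<Longrightarrow> i \<in> I \<Longrightarrow> pick u \<epsilon> i \<in> K"
  by (auto simp: tuples_def pick_def dest: PiE_mem)

lemma fibre_over_K:
  assumes a: "\<And>j. j \<in> {1..k} - {i} \<Longrightarrow> a j \<in> K" shows "coeff (fibre i a) n \<in> K"
proof -
  have "mono_value I a m \<in> K1" if "I \<subseteq> {1..k} - {i}" for I m
  proof -
    have "a j ^ count m j \<in> K1" if "j \<in> I" for j
    proof -
      have "j \<in> {1..k} - {i}" using that \<open>I \<subseteq> {1..k} - {i}\<close> by blast
      then show ?thesis by (rule semiring_closed_power[OF K1_closed K_sub_K1[OF a]])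
    qed
    moreover have "finite I" using that finite_subset by auto
    ultimately show ?thesis unfolding mono_value_def
      by (induction I rule: infinite_finite_induct) (auto simp: semiring_closedD[OF K1_closed])
  qed
  then have "e * mono_value ({1..k} - {i}) a m \<in> K" for m by (auto simp: K1_def)
  then have "f m * mono_value ({1..k} - {i}) a m \<in> K" for m
    using K_mult[OF f_K[of m], of "e * mono_value ({1..k} - {i}) a m"] f_closed[of m] by (metis mult.assoc mult.commute)
  then have "(\<Sum>m\<in>S. coeff (monom (f m * mono_value ({1..k} - {i}) a m) (count m i)) n) \<in> K" for S
    by (induction S rule: infinite_finite_induct) (auto intro: K_add K_0)
  then show ?thesis unfolding fibre_def coeff_sum .
qed

lemma prod_closed_eq:
  assumes "finite I" "I \<noteq> {}" "\<And>i. i \<in> I \<Longrightarrow> smult e (g i) = g i"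
  shows "smult e (prod g I) = prod g I"
  using assms by (induction I rule: finite_ne_induct) (auto simp flip: mult_smult_left)

lemma prod_zero_imp:
  assumes "finite I" "\<And>i. i \<in> I \<Longrightarrow> e * g i = g i" "e * prod g I = 0"
  shows "\<exists>i\<in>I. g i = 0"
  using assms
proof (induction I rule: finite_induct)
  case empty
  then show ?case using e_nonzero by simp
next
  case (insert i I)
  have "g i * (e * prod g I) = 0" using insert by (simp add: mult.left_commute)
  then have "g i = 0 \<or> e * prod g I = 0" using no_zero_divisors[of "g i" "e * prod g I"] insert by simp
  then show ?case using insert by auto
qed

lemma choices_ne: "choices I \<noteq> {}" by (auto simp: choices_def PiE_eq_empty_iff)

lemma fibre_prod_closed: "smult e (fibre_prod u) = fibre_prod u"
  unfolding fibre_prod_def by (rule prod_closed_eq[OF choices_finite choices_ne fibre_closed]) simp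

lemma degree_fibre_prod: "degree (fibre_prod u) \<le> 2 ^ (k - 1) * d"
proof -
  have "degree (fibre_prod u) \<le> (\<Sum>\<epsilon>\<in>choices {2..k}. degree (fibre 1 (pick u \<epsilon>)))"
    unfolding fibre_prod_def using degree_prod_sum_le[OF choices_finite[of "{2..k}"]] by (simp add: comp_def)
  also have "\<dots> \<le> (\<Sum>\<epsilon>\<in>choices {2..k}. d)" by (rule sum_mono) (rule degree_fibre)
  finally show ?thesis using choices_card[of "{2..k}"] by simp
qed

lemma fibre_prod_over_K:
  assumes "u \<in> tuples {2..k}" shows "coeff (fibre_prod u) n \<in> K"
proof -
  note K1p = semiring_closed_polys_over[OF K1_closed]
  have "fibre 1 (pick u \<epsilon>) \<in> polys_over K1" for \<epsilon>
    using fibre_over_K[of 1 "pick u \<epsilon>"] pick_K[OF assms] K_sub_K1 unfolding polys_over_def Icc_minus_1 by auto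
  then have "prod (\<lambda>\<epsilon>. fibre 1 (pick u \<epsilon>)) I \<in> polys_over K1" for I
    by (induction I rule: infinite_finite_induct) (auto simp: semiring_closedD[OF K1p])
  then have "coeff (fibre_prod u) n \<in> K1" unfolding fibre_prod_def by (auto simp: polys_over_def)
  then show ?thesis using coeff_closed[OF fibre_prod_closed, of u n] by (simp add: K1_def)
qed

text \<open>
  If the factor of \<open>P\<^sub>u\<close> at \<open>\<epsilon> = 0\<close> had no root in common with the others, it would be a constant times
  a square by \<open>const_square_of_coprime_product\<close>.
\<close>

lemma bad_common_root:
  assumes u: "u \<in> tuples {2..k}" and sq: "const_square (fibre_prod u)" and n: "\<not> square_on_first 1 (pick u (\<lambda>_. False))"
  shows "\<exists>\<epsilon>\<in>choices {2..k}. (\<exists>i\<in>{2..k}. \<epsilon> i) \<and>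
    (\<exists>a. e * a = a \<and> poly (fibre 1 (pick u (\<lambda>_. False))) a = 0 \<and> poly (fibre 1 (pick u \<epsilon>)) a = 0)"
proof -
  define z where "z = restrict (\<lambda>_. False) {2..k}"
  have z: "z \<in> choices {2..k}" by (auto simp: z_def choices_def)
  have fz: "fibre 1 (pick u z) = fibre 1 (pick u (\<lambda>_. False))"
    by (rule fibre_cong) (auto simp: pick_def z_def)
  define A where "A = fibre 1 (pick u z)"
  define G where "G = (\<Prod>\<epsilon>\<in>choices {2..k} - {z}. fibre 1 (pick u \<epsilon>))"
  have AG: "fibre_prod u = A * G" unfolding fibre_prod_def A_def G_def
    by (rule prod.remove) (use z choices_finite in auto)
  have A: "smult e A = A" unfolding A_def by (rule fibre_closed)
  have "A \<noteq> 0" unfolding A_def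
    using fibre_nonzero[of 1 "pick u z"] pick_K[OF u] K_closed k_ge_2 by auto
  then have "\<not> const_square A" using n square_on_first_1 unfolding A_def fz by blast
  obtain c S where S: "e * c = c" "smult e S = S" "A * G = smult c (S * S)" using sq unfolding AG const_square_def by blast
  have "A * smult e G = smult c (S * S)" using S(3) A by (metis mult_smult_left mult_smult_right)
  then have "\<exists>a. e * a = a \<and> poly A a = 0 \<and> poly (smult e G) a = 0"
    using const_square_of_coprime_product[OF A smult_idem S(2,1), of G] \<open>\<not> const_square A\<close> by blast
  then obtain a where a: "e * a = a" "poly A a = 0" "e * (\<Prod>\<epsilon>\<in>choices {2..k} - {z}. poly (fibre 1 (pick u \<epsilon>)) a) = 0"
    unfolding G_def by (auto simp: poly_prod)
  have "\<exists>\<epsilon>\<in>choices {2..k} - {z}. poly (fibre 1 (pick u \<epsilon>)) a = 0"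
    by (rule prod_zero_imp[OF _ _ a(3)]) (use choices_finite poly_closed[OF fibre_closed] in auto)
  then obtain \<epsilon> where \<epsilon>: "\<epsilon> \<in> choices {2..k}" "\<epsilon> \<noteq> z" "poly (fibre 1 (pick u \<epsilon>)) a = 0" by blast
  have "\<exists>i\<in>{2..k}. \<epsilon> i"
  proof (rule ccontr)
    assume "\<not> ?thesis"
    then have "\<epsilon> = z" using \<epsilon>(1) z unfolding choices_def by (intro PiE_ext[OF \<epsilon>(1)[unfolded choices_def] z[unfolded choices_def]]) (auto simp: z_def)
    then show False using \<epsilon>(2) by simp
  qed
  then show ?thesis using \<epsilon> a unfolding A_def fz by blast
qed

lemma card_roots_line:
  assumes i: "i \<in> {1..k}" and a: "\<And>j. j \<in> {1..k} - {i} \<Longrightarrow> e * a j = a j"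
  shows "card {y\<in>K. value_at (a(i := y)) = 0} \<le> d"
proof -
  have "fibre i a \<noteq> 0" by (rule fibre_nonzero[OF i a])
  note rf = roots_finite_card[OF fibre_closed this]
  have "{y\<in>K. value_at (a(i := y)) = 0} \<subseteq> {x. e * x = x \<and> poly (fibre i a) x = 0}"
    using K_closed by (auto simp: poly_fibre[OF i])
  then have "card {y\<in>K. value_at (a(i := y)) = 0} \<le> card {x. e * x = x \<and> poly (fibre i a) x = 0}"
    using rf by (intro card_mono) auto
  then show ?thesis using rf degree_fibre[of i a] by linarith
qed

text \<open>
  Vary \<open>u\<^sub>i(1)\<close> for some \<open>i\<close> with \<open>\<epsilon>\<^sub>i = 1\<close>. The polynomial at \<open>\<epsilon> = 0\<close> stays the same and has at most \<open>d\<close>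
  roots; for each root \<open>a\<close>, the condition \<open>f(a, u\<^sub>\<epsilon>) = 0\<close> is a nonzero polynomial equation of degree at
  most \<open>d\<close> in \<open>u\<^sub>i(1)\<close>, because primitivity also covers values \<open>a\<close> outside \<open>K\<close>.
\<close>

lemma card_common_root:
  assumes \<epsilon>: "\<epsilon> \<in> choices {2..k}" and i: "i \<in> {2..k}" "\<epsilon> i"
  shows "card {u \<in> tuples {2..k}. \<exists>a. e * a = a \<and> poly (fibre 1 (pick u (\<lambda>_. False))) a = 0 \<and> poly (fibre 1 (pick u \<epsilon>)) a = 0}
    \<le> d * d * q ^ (2 * k - 3)" (is "card ?S \<le> _")
proof -
  have "card ?S \<le> d * d * card K ^ (card ({2..k} \<times> (UNIV::bool set)) - 1)"
  proof (rule card_le_of_lines[where i = "(i, True)"])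
    show "?S \<subseteq> {2..k} \<times> UNIV \<rightarrow>\<^sub>E K" by (auto simp: tuples_def)
    show "(i, True) \<in> {2..k} \<times> (UNIV::bool set)" using i by simp
    fix \<psi> assume \<psi>: "\<psi> \<in> ({2..k} \<times> UNIV - {(i, True)}) \<rightarrow>\<^sub>E K"
    define A where "A = fibre 1 (pick \<psi> (\<lambda>_. False))"
    have A: "fibre 1 (pick (\<psi>((i, True) := y)) (\<lambda>_. False)) = A" for y
      unfolding A_def by (rule fibre_cong) (auto simp: pick_def)
    have \<psi>K: "\<psi> (j, b) \<in> K" if "j \<in> {2..k}" "(j, b) \<noteq> (i, True)" for j b
      using PiE_mem[OF \<psi>, of "(j, b)"] that by simp
    have An: "A \<noteq> 0" unfolding A_def
    proof (rule fibre_nonzero)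
      show "1 \<in> {1..k}" using k_ge_2 by simp
      fix j assume "j \<in> {1..k} - {1}"
      then have "\<psi> (j, False) \<in> K" by (intro \<psi>K) auto
      then show "e * pick \<psi> (\<lambda>_. False) j = pick \<psi> (\<lambda>_. False) j" unfolding pick_def by (rule K_closed)
    qed
    define R where "R = {x. e * x = x \<and> poly A x = 0}"
    have "smult e A = A" unfolding A_def by (rule fibre_closed)
    then have R: "finite R" "card R \<le> d"
      using roots_finite_card[of A] An degree_fibre[of 1 "pick \<psi> (\<lambda>_. False)"] unfolding R_def A_def by auto
    define L where "L a = {y\<in>K. poly (fibre 1 (pick (\<psi>((i, True) := y)) \<epsilon>)) a = 0}" for a
    have L: "card (L a) \<le> d" if a: "a \<in> R" for a
    proof -
      define b where "b = (pick \<psi> \<epsilon>)(1 := a)"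
      have "poly (fibre 1 (pick (\<psi>((i, True) := y)) \<epsilon>)) a = value_at (b(i := y))" for y
      proof -
        have "(pick (\<psi>((i, True) := y)) \<epsilon>)(1 := a) = b(i := y)"
          using i by (auto simp: fun_eq_iff pick_def b_def)
        then show ?thesis using poly_fibre[of 1] k_ge_2 by simp
      qed
      then have "L a = {y\<in>K. value_at (b(i := y)) = 0}" by (simp add: L_def)
      moreover have "card {y\<in>K. value_at (b(i := y)) = 0} \<le> d"
      proof (rule card_roots_line)
        show "i \<in> {1..k}" using i by auto
        fix j assume j: "j \<in> {1..k} - {i}"
        show "e * b j = b j"
        proof (cases "j = 1")
          case True then show ?thesis using a by (simp add: b_def R_def)
        next
          case False
          then have "\<psi> (j, \<epsilon> j) \<in> K" using j by (intro \<psi>K) auto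
          then show ?thesis using False K_closed[of "\<psi> (j, \<epsilon> j)"] by (simp add: b_def pick_def)
        qed
      qed
      ultimately show ?thesis by simp
    qed
    have "{y\<in>K. \<psi>((i, True) := y) \<in> ?S} \<subseteq> (\<Union>a\<in>R. L a)"
      unfolding R_def L_def using A by auto
    then have "card {y\<in>K. \<psi>((i, True) := y) \<in> ?S} \<le> card (\<Union>a\<in>R. L a)"
      using R(1) K_finite by (intro card_mono) (auto simp: L_def)
    also have "\<dots> \<le> (\<Sum>a\<in>R. card (L a))" by (rule card_UN_le[OF R(1)])
    also have "\<dots> \<le> (\<Sum>a\<in>R. d)" by (rule sum_mono) (rule L)
    also have "\<dots> \<le> d * d" using R(2) by simp
    finally show "card {y\<in>K. \<psi>((i, True) := y) \<in> ?S} \<le> d * d" .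
  qed (use K_finite in auto)
  moreover have "card ({2..k} \<times> (UNIV::bool set)) - 1 = 2 * k - 3"
    by (simp add: card_cartesian_product)
  ultimately show ?thesis unfolding K_card by simp
qed

lemma card_bad:
  assumes nonsq: "\<And>a. \<not> square_on_first k a"
  shows "card {u \<in> tuples {2..k}. const_square (fibre_prod u)} \<le> bad_bound k d * q ^ (2 * k - 3)"
proof -
  define V where "V = {v \<in> {2..k} \<rightarrow>\<^sub>E K. square_on_first 1 v}"
  define S0 where "S0 = {u \<in> tuples {2..k}. square_on_first 1 (pick u (\<lambda>_. False))}"
  define S where "S \<epsilon> = {u \<in> tuples {2..k}. \<exists>a. e * a = a \<and> poly (fibre 1 (pick u (\<lambda>_. False))) a = 0 \<and> poly (fibre 1 (pick u \<epsilon>)) a = 0}" for \<epsilon>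
  define E1 where "E1 = {\<epsilon> \<in> choices {2..k}. \<exists>i\<in>{2..k}. \<epsilon> i}"
  have sub: "{u \<in> tuples {2..k}. const_square (fibre_prod u)} \<subseteq> S0 \<union> (\<Union>\<epsilon>\<in>E1. S \<epsilon>)"
    using bad_common_root unfolding S0_def S_def E1_def by blast
  have finU: "finite (tuples {2..k})" by (simp add: tuples_finite)
  have finE1: "finite E1" unfolding E1_def by (simp add: choices_finite)
  define \<pi> where "\<pi> u = (restrict (pick u (\<lambda>_. False)) {2..k}, restrict (pick u (\<lambda>_. True)) {2..k})"
    for u :: "nat \<times> bool \<Rightarrow> 'r"
  have inj: "inj_on \<pi> S0"
  proof (rule inj_onI)
    fix u u' assume u: "u \<in> S0" "u' \<in> S0" "\<pi> u = \<pi> u'"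
    have eq: "restrict (pick u (\<lambda>_. False)) {2..k} i = restrict (pick u' (\<lambda>_. False)) {2..k} i"
      "restrict (pick u (\<lambda>_. True)) {2..k} i = restrict (pick u' (\<lambda>_. True)) {2..k} i" for i
      using u(3) by (auto simp: \<pi>_def)
    show "u = u'"
    proof (rule PiE_ext)
      show "u \<in> ({2..k} \<times> UNIV) \<rightarrow>\<^sub>E K" "u' \<in> ({2..k} \<times> UNIV) \<rightarrow>\<^sub>E K" using u by (auto simp: S0_def tuples_def)
      fix p assume p: "p \<in> {2..k} \<times> (UNIV::bool set)"
      obtain i b where ib: "p = (i, b)" by (cases p)
      then show "u p = u' p" using eq[of i] p by (cases b) (auto simp: pick_def)
    qed
  qed
  have im: "\<pi> ` S0 \<subseteq> V \<times> ({2..k} \<rightarrow>\<^sub>E K)"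
  proof
    fix z assume "z \<in> \<pi> ` S0"
    then obtain u where u: "u \<in> S0" "z = \<pi> u" by blast
    have "restrict (pick u b) {2..k} \<in> {2..k} \<rightarrow>\<^sub>E K" for b
      using u pick_K[of u "{2..k}"] by (auto simp: S0_def)
    moreover have "square_on_first 1 (restrict (pick u (\<lambda>_. False)) {2..k})"
      using u square_on_first_cong[of 1 "restrict (pick u (\<lambda>_. False)) {2..k}" "pick u (\<lambda>_. False)"] by (auto simp: S0_def)
    ultimately show "z \<in> V \<times> ({2..k} \<rightarrow>\<^sub>E K)" unfolding u(2) \<pi>_def V_def by simp
  qed
  have finV: "finite (V \<times> ({2..k} \<rightarrow>\<^sub>E K))" unfolding V_def using K_finite by (simp add: finite_PiE)
  have "card S0 \<le> card (V \<times> ({2..k} \<rightarrow>\<^sub>E K))" by (rule card_inj_on_le[OF inj im finV])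
  also have "\<dots> = card V * q ^ (k - 1)" by (simp add: card_cartesian_product card_PiE K_card)
  also have "\<dots> \<le> (sq_bound k d * q ^ (k - 2)) * q ^ (k - 1)"
    unfolding V_def by (intro mult_le_mono1 card_square_fibres nonsq)
  also have "\<dots> = sq_bound k d * q ^ (2 * k - 3)"
  proof -
    have "2 * k - 3 = (k - 2) + (k - 1)" using k_ge_2 by simp
    then show ?thesis by (simp add: power_add)
  qed
  finally have S0: "card S0 \<le> sq_bound k d * q ^ (2 * k - 3)" .
  have "card (\<Union>\<epsilon>\<in>E1. S \<epsilon>) \<le> (\<Sum>\<epsilon>\<in>E1. card (S \<epsilon>))" by (rule card_UN_le[OF finE1])
  also have "\<dots> \<le> (\<Sum>\<epsilon>\<in>E1. d * d * q ^ (2 * k - 3))"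
    using card_common_root unfolding S_def E1_def by (intro sum_mono) blast
  also have "\<dots> = card E1 * (d * d * q ^ (2 * k - 3))" by simp
  also have "\<dots> \<le> 2 ^ (k - 1) * (d * d * q ^ (2 * k - 3))"
  proof (rule mult_le_mono1)
    have "card E1 \<le> card (choices {2..k})" unfolding E1_def by (intro card_mono choices_finite) auto
    then show "card E1 \<le> 2 ^ (k - 1)" by (simp add: choices_card)
  qed
  finally have S1: "card (\<Union>\<epsilon>\<in>E1. S \<epsilon>) \<le> 2 ^ (k - 1) * (d * d * q ^ (2 * k - 3))" .
  have "card {u \<in> tuples {2..k}. const_square (fibre_prod u)} \<le> card (S0 \<union> (\<Union>\<epsilon>\<in>E1. S \<epsilon>))"
    using finU finE1 by (intro card_mono[OF _ sub]) (auto simp: S0_def S_def)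
  also have "\<dots> \<le> card S0 + card (\<Union>\<epsilon>\<in>E1. S \<epsilon>)" by (rule card_Un_le)
  finally show ?thesis using S0 S1 by (simp add: bad_bound_def algebra_simps)
qed

definition char_sum :: int
  where "char_sum = (\<Sum>u\<in>tuples {1..k}. \<Prod>\<epsilon>\<in>choices {1..k}. chi (value_at (pick u \<epsilon>)))"

lemma Icc_insert_1: "{1..k} = insert 1 {2..k}" using k_ge_2 by auto

lemma prod_choices:
  "(\<Prod>\<epsilon>\<in>choices {1..k}. h \<epsilon>) = (\<Prod>\<epsilon>\<in>choices {2..k}. h (\<epsilon>(1 := False)) * h (\<epsilon>(1 := True)))"
  for h :: "(nat \<Rightarrow> bool) \<Rightarrow> 'c::comm_monoid_mult"
proof -
  have "(\<Prod>\<epsilon>\<in>choices {1..k}. h \<epsilon>) = (\<Prod>p\<in>choices {2..k} \<times> UNIV. h ((fst p)(1 := snd p)))"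
  proof (rule prod.reindex_bij_witness[of _ "\<lambda>p. (fst p)(1 := snd p)" "\<lambda>\<epsilon>. (restrict \<epsilon> {2..k}, \<epsilon> 1)"])
    fix \<epsilon> assume \<epsilon>: "\<epsilon> \<in> choices {1..k}"
    then show 1: "(fst (restrict \<epsilon> {2..k}, \<epsilon> 1))(1 := snd (restrict \<epsilon> {2..k}, \<epsilon> 1)) = \<epsilon>"
      unfolding choices_def Icc_insert_1 by (auto simp: fun_eq_iff PiE_def extensional_def)
    then show "h ((fst (restrict \<epsilon> {2..k}, \<epsilon> 1))(1 := snd (restrict \<epsilon> {2..k}, \<epsilon> 1))) = h \<epsilon>" by simp
    show "(restrict \<epsilon> {2..k}, \<epsilon> 1) \<in> choices {2..k} \<times> UNIV" by (auto simp: choices_def)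
  next
    fix p assume "p \<in> choices {2..k} \<times> (UNIV::bool set)"
    then show "(restrict ((fst p)(1 := snd p)) {2..k}, ((fst p)(1 := snd p)) 1) = p"
      "(fst p)(1 := snd p) \<in> choices {1..k}"
      unfolding choices_def Icc_insert_1 by (auto simp: fun_eq_iff PiE_def extensional_def prod_eq_iff)
  qed
  also have "\<dots> = (\<Prod>\<epsilon>\<in>choices {2..k}. \<Prod>b\<in>UNIV. h (\<epsilon>(1 := b)))"
    by (simp add: prod.cartesian_product case_prod_unfold)
  finally show ?thesis by (simp add: UNIV_bool mult.commute)
qed

lemma chi_fibre_prod:
  assumes u: "u \<in> tuples {2..k}" and x: "x \<in> K"
  shows "chi (poly (fibre_prod u) x) = (\<Prod>\<epsilon>\<in>choices {2..k}. chi (value_at ((pick u \<epsilon>)(1 := x))))"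
proof -
  have "poly (fibre 1 (pick u \<epsilon>)) x \<in> K" for \<epsilon>
    using poly_in_K[OF _ x] fibre_over_K[of 1 "pick u \<epsilon>"] pick_K[OF u] unfolding Icc_minus_1 by blast
  then have "chi (poly (fibre_prod u) x) = (\<Prod>\<epsilon>\<in>choices {2..k}. chi (poly (fibre 1 (pick u \<epsilon>)) x))"
    unfolding fibre_prod_def poly_prod by (intro chi_prod choices_finite choices_ne) auto
  then show ?thesis using poly_fibre[of 1] k_ge_2 by simp
qed

lemma char_sum_eq: "char_sum = (\<Sum>u\<in>tuples {2..k}. (\<Sum>x\<in>K. chi (poly (fibre_prod u) x)) ^ 2)"
proof -
  define ext where "ext z = (\<lambda>(i, b). if i = 1 then (if b then snd (snd z) else fst (snd z)) else fst z (i, b))"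
    for z :: "(nat \<times> bool \<Rightarrow> 'r) \<times> 'r \<times> 'r"
  define prj where "prj u = (restrict u ({2..k} \<times> UNIV), u (1, False), u (1, True))" for u :: "nat \<times> bool \<Rightarrow> 'r"
  have "char_sum = (\<Sum>z\<in>tuples {2..k} \<times> K \<times> K. chi (poly (fibre_prod (fst z)) (fst (snd z))) * chi (poly (fibre_prod (fst z)) (snd (snd z))))"
    unfolding char_sum_def
  proof (rule sum.reindex_bij_witness[of _ ext prj])
    fix u assume u: "u \<in> tuples {1..k}"
    have u0: "u (1, b) \<in> K" for b using u k_ge_2 by (auto simp: tuples_def dest: PiE_mem)
    show p: "prj u \<in> tuples {2..k} \<times> K \<times> K" using u u0 unfolding prj_def tuples_def Icc_insert_1 by auto
    show "ext (prj u) = u"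
      using u unfolding tuples_def Icc_insert_1 ext_def prj_def by (auto simp: fun_eq_iff PiE_def extensional_def)
    let ?v = "restrict u ({2..k} \<times> UNIV)"
    have v: "?v \<in> tuples {2..k}" using p by (simp add: prj_def)
    have pk: "value_at ((pick ?v \<epsilon>)(1 := u (1, b))) = value_at (pick u (\<epsilon>(1 := b)))" for \<epsilon> b
      unfolding value_at_def by (intro sum.cong refl arg_cong[of _ _ "(*) _"] mono_value_cong) (auto simp: pick_def)
    show "chi (poly (fibre_prod (fst (prj u))) (fst (snd (prj u)))) * chi (poly (fibre_prod (fst (prj u))) (snd (snd (prj u))))
        = (\<Prod>\<epsilon>\<in>choices {1..k}. chi (value_at (pick u \<epsilon>)))"
      unfolding prj_def fst_conv snd_conv chi_fibre_prod[OF v u0] pk prod_choices prod.distrib ..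
  next
    fix z assume z: "z \<in> tuples {2..k} \<times> K \<times> K"
    show "prj (ext z) = z"
      using z unfolding tuples_def ext_def prj_def by (auto simp: fun_eq_iff PiE_def extensional_def prod_eq_iff)
    show "ext z \<in> tuples {1..k}"
      using z unfolding tuples_def Icc_insert_1 ext_def by (auto simp: PiE_def extensional_def Pi_def)
  qed
  also have "\<dots> = (\<Sum>u\<in>tuples {2..k}. \<Sum>x\<in>K. \<Sum>y\<in>K. chi (poly (fibre_prod u) x) * chi (poly (fibre_prod u) y))"
    by (simp add: sum.cartesian_product case_prod_unfold)
  also have "\<dots> = (\<Sum>u\<in>tuples {2..k}. (\<Sum>x\<in>K. chi (poly (fibre_prod u) x)) ^ 2)"
    by (simp add: power2_eq_square sum_product)
  finally show ?thesis .
qed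

text \<open>
  At most \<open>q\<^bsup>2k-2\<^esup>\<close> terms contribute \<open>O(q)\<close> each, and the \<open>O(q\<^bsup>2k-3\<^esup>)\<close> bad ones at most \<open>q\<^sup>2\<close> each.
\<close>

theorem char_sum_bound:
  assumes nonsq: "\<And>a. \<not> square_on_first k a"
  shows "\<bar>real_of_int char_sum\<bar> \<le> char_sum_const k d * real q ^ (2 * k - 1)"
proof -
  define c where "c = 9 * real (2 ^ (k - 1) * d) + 14"
  define s where "s u = real_of_int (\<Sum>x\<in>K. chi (poly (fibre_prod u) x))" for u
  define Bad where "Bad = {u \<in> tuples {2..k}. const_square (fibre_prod u)}"
  have fin: "finite (tuples {2..k})" by (simp add: tuples_finite)
  have good: "(s u) ^ 2 \<le> c ^ 2 * real q" if "u \<in> tuples {2..k} - Bad" for u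
  proof -
    have "\<bar>s u\<bar> \<le> c * sqrt (real q)"
      unfolding s_def c_def using that
      by (intro weil fibre_prod_closed fibre_prod_over_K degree_fibre_prod) (auto simp: Bad_def)
    then have "\<bar>s u\<bar> ^ 2 \<le> (c * sqrt (real q)) ^ 2" by (intro power_mono) auto
    then show ?thesis by (simp add: power_mult_distrib)
  qed
  have bad: "(s u) ^ 2 \<le> real q ^ 2" for u
  proof -
    have "\<bar>s u\<bar> \<le> real q" unfolding s_def using sum_chi_trivial[of "poly (fibre_prod u)"] by linarith
    then show ?thesis by (simp add: abs_le_square_iff flip: abs_le_square_iff)
  qed
  have "real_of_int char_sum = (\<Sum>u\<in>tuples {2..k}. (s u) ^ 2)" unfolding char_sum_eq s_def by simp
  also have "\<dots> = (\<Sum>u\<in>tuples {2..k} - Bad. (s u) ^ 2) + (\<Sum>u\<in>Bad. (s u) ^ 2)"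
    by (rule sum.subset_diff) (use fin in \<open>auto simp: Bad_def\<close>)
  finally have eq: "real_of_int char_sum = (\<Sum>u\<in>tuples {2..k} - Bad. (s u) ^ 2) + (\<Sum>u\<in>Bad. (s u) ^ 2)" .
  have "(\<Sum>u\<in>tuples {2..k} - Bad. (s u) ^ 2) \<le> (\<Sum>u\<in>tuples {2..k} - Bad. c ^ 2 * real q)" by (rule sum_mono) (rule good)
  also have "\<dots> = real (card (tuples {2..k} - Bad)) * (c ^ 2 * real q)" by simp
  also have "\<dots> \<le> real (q ^ (2 * (k - 1))) * (c ^ 2 * real q)"
  proof (intro mult_right_mono)
    have "card (tuples {2..k} - Bad) \<le> card (tuples {2..k})" using fin by (intro card_mono) auto
    then show "real (card (tuples {2..k} - Bad)) \<le> real (q ^ (2 * (k - 1)))" using tuples_card[of "{2..k}"] by simp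
  qed simp
  also have "\<dots> = c ^ 2 * real q ^ (2 * k - 1)"
  proof -
    have "2 * k - 1 = Suc (2 * (k - 1))" using k_ge_2 by simp
    then show ?thesis by simp
  qed
  finally have 1: "(\<Sum>u\<in>tuples {2..k} - Bad. (s u) ^ 2) \<le> c ^ 2 * real q ^ (2 * k - 1)" .
  have "(\<Sum>u\<in>Bad. (s u) ^ 2) \<le> (\<Sum>u\<in>Bad. real q ^ 2)" by (rule sum_mono) (rule bad)
  also have "\<dots> = real (card Bad) * real q ^ 2" by simp
  also have "\<dots> \<le> real (bad_bound k d * q ^ (2 * k - 3)) * real q ^ 2"
  proof (intro mult_right_mono)
    show "real (card Bad) \<le> real (bad_bound k d * q ^ (2 * k - 3))"
      using card_bad[OF nonsq] unfolding Bad_def by (rule of_nat_mono)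
  qed simp
  also have "\<dots> = real (bad_bound k d) * real q ^ (2 * k - 1)"
  proof -
    have "2 * k - 1 = (2 * k - 3) + 2" using k_ge_2 by simp
    then show ?thesis by (simp add: power_add power2_eq_square)
  qed
  finally have 2: "(\<Sum>u\<in>Bad. (s u) ^ 2) \<le> real (bad_bound k d) * real q ^ (2 * k - 1)" .
  have "0 \<le> real_of_int char_sum" unfolding eq by (intro add_nonneg_nonneg sum_nonneg) auto
  then show ?thesis using 1 2 unfolding eq c_def char_sum_const_def by (simp add: algebra_simps)
qed

end

section \<open>Recovering a square root in several variables\<close>

lemma digits_unique:
  fixes a b :: "nat \<Rightarrow> nat"
  assumes "\<And>i. i < j \<Longrightarrow> a i \<le> d \<and> b i \<le> d"
    and "(\<Sum>i<j. a i * (d + 1) ^ i) = (\<Sum>i<j. b i * (d + 1) ^ i)" and "i < j"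
  shows "a i = b i"
  using assms
proof (induction j arbitrary: i)
  case (Suc j)
  have less: "(\<Sum>i<n. c i * (d + 1) ^ i) < (d + 1) ^ n" if "\<And>i. i < n \<Longrightarrow> c i \<le> d" for n and c :: "nat \<Rightarrow> nat"
    using that
  proof (induction n)
    case (Suc n)
    have "(\<Sum>i<Suc n. c i * (d + 1) ^ i) < (d + 1) ^ n + d * (d + 1) ^ n"
      unfolding sum.lessThan_Suc using Suc by (intro add_less_le_mono mult_le_mono1) auto
    then show ?case by simp
  qed simp
  define D where "D = (d + 1) ^ j"
  have D: "D > 0" by (simp add: D_def)
  have A: "(\<Sum>i<j. a i * (d + 1) ^ i) < D" and B: "(\<Sum>i<j. b i * (d + 1) ^ i) < D"
    unfolding D_def using less[of j a] less[of j b] Suc.prems(1) by auto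
  have eq: "(\<Sum>i<j. a i * (d + 1) ^ i) + a j * D = (\<Sum>i<j. b i * (d + 1) ^ i) + b j * D"
    using Suc.prems(2) by (simp add: D_def)
  then have "((\<Sum>i<j. a i * (d + 1) ^ i) + a j * D) div D = ((\<Sum>i<j. b i * (d + 1) ^ i) + b j * D) div D" by simp
  then have aj: "a j = b j" using A B D by simp
  then have "(\<Sum>i<j. a i * (d + 1) ^ i) = (\<Sum>i<j. b i * (d + 1) ^ i)" using eq by simp
  then show ?case using Suc.IH[of i] Suc.prems aj by (cases "i = j") auto
qed simp

lemma finite_submultisets: "finite {m'. m' \<subseteq># m}"
proof (induction m)
  case empty
  then show ?case by simp
next
  case (add x m)
  have "{m'. m' \<subseteq># add_mset x m} \<subseteq> {m'. m' \<subseteq># m} \<union> add_mset x ` {m'. m' \<subseteq># m}"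
  proof
    fix m' assume "m' \<in> {m'. m' \<subseteq># add_mset x m}"
    then have m': "m' \<subseteq># add_mset x m" by simp
    show "m' \<in> {m'. m' \<subseteq># m} \<union> add_mset x ` {m'. m' \<subseteq># m}"
    proof (cases "x \<in># m'")
      case True
      then have "m' = add_mset x (m' - {#x#})" by simp
      moreover have "m' - {#x#} \<subseteq># m" using m' by (simp add: subset_eq_diff_conv)
      ultimately show ?thesis by blast
    next
      case False
      have "count m' y \<le> count m y" for y
        using mset_subset_eq_count[OF m', of y] False by (cases "y = x") (auto simp: not_in_iff)
      then show ?thesis by (auto intro: mset_subset_eqI)
    qed
  qed
  then show ?case using add by (auto intro: finite_subset)
qed

context finite_field_idem
begin

lemma K_inverse:
  assumes "c \<in> K" "c \<noteq> 0" shows "\<exists>b\<in>K. c * b = e"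
proof -
  have pw: "c ^ Suc n \<in> K" for n by (induction n) (auto intro: K_mult assms)
  have q: "q - 2 = Suc (q - 3)" "q = Suc (Suc (q - 2))" using q_ge_3 by auto
  define b where "b = c ^ (q - 2)"
  have b: "b \<in> K" unfolding b_def q(1) by (rule pw)
  have "c = c * (c * b)" using K_pow[OF assms(1)] q(2) unfolding b_def by (metis power_Suc)
  moreover have "c = c * e" using K_closed[OF assms(1)] by (simp add: mult.commute)
  ultimately have "c * (c * b) = c * e" by simp
  then have "c * b = e"
    using cancel_left[of c "c * b" e] K_closed[OF assms(1)] assms(2) mult_closed[of c b] idem by blast
  then show ?thesis using b by blast
qed

text \<open>
  Squaring is two to one on the nonzero elements, so there are at least \<open>(q - 1)/2\<close> nonzero squares. All
  of them are roots of \<open>X\<^bsup>(q-1)/2\<^esup> - 1\<close>, which has no others.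
\<close>

lemma chi_eq_1_iff:
  assumes "x \<in> K" "x \<noteq> 0" shows "chi x = 1 \<longleftrightarrow> (\<exists>y\<in>K. x = y * y)"
proof -
  define N where "N = {x\<in>K. x \<noteq> 0}"
  define Q where "Q = (\<lambda>y. y * y) ` N"
  define P where "P = {x. e * x = x \<and> poly (monom e half - [:e:]) x = 0}"
  have "N = K - {0}" by (auto simp: N_def)
  then have finN: "finite N" "card N = q - 1"
    using K_finite K_card K_0 card_Diff_singleton[of 0 K] by simp_all
  have pn: "smult e (monom e half - [:e:]) = monom e half - [:e:]"
    by (simp add: smult_diff_right smult_monom idem)
  have "coeff (monom e half - [:e:]) half = e" using half_pos by (cases half) (auto)
  then have pn0: "monom e half - [:e:] \<noteq> 0" using e_nonzero by (metis coeff_0)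
  have "degree (monom e half - [:e:]) \<le> half" by (intro degree_diff_le) (auto intro: degree_monom_le)
  then have P: "finite P" "card P \<le> half" using roots_finite_card[OF pn pn0] unfolding P_def by auto
  have QN: "Q \<subseteq> N"
    unfolding Q_def N_def using K_mult no_zero_divisors K_closed by fastforce
  have QP: "Q \<subseteq> P"
  proof
    fix x assume "x \<in> Q"
    then obtain y where y: "y \<in> K" "y \<noteq> 0" "x = y * y" by (auto simp: Q_def N_def)
    have "x ^ half = y ^ half * y ^ half" unfolding y(3) by (simp add: power_mult_distrib)
    also have "\<dots> = e" using pow_half[OF y(1,2)] by (elim disjE) (simp_all add: idem)
    finally show "x \<in> P" using K_mult[OF y(1) y(1)] K_closed y(3) by (auto simp: P_def poly_monom idem)
  qed
  have "card N \<le> (\<Sum>x\<in>Q. card {y\<in>N. y * y = x})"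
  proof -
    have "N = (\<Union>x\<in>Q. {y\<in>N. y * y = x})" by (auto simp: Q_def)
    then have "card N = card (\<Union>x\<in>Q. {y\<in>N. y * y = x})" by simp
    also have "\<dots> \<le> (\<Sum>x\<in>Q. card {y\<in>N. y * y = x})" by (rule card_UN_le) (use finN in \<open>auto simp: Q_def\<close>)
    finally show ?thesis .
  qed
  also have "\<dots> \<le> (\<Sum>x\<in>Q. 2)"
  proof (rule sum_mono)
    fix x assume "x \<in> Q"
    then obtain y where y: "y \<in> K" "x = y * y" by (auto simp: Q_def N_def)
    have "{z\<in>N. z * z = x} \<subseteq> {y, - y}"
    proof
      fix z assume "z \<in> {z\<in>N. z * z = x}"
      then have z: "z \<in> K" "z * z = y * y" using y by (auto simp: N_def)
      then have "(z - y) * (z + y) = 0" by (simp add: algebra_simps)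
      then have "z - y = 0 \<or> z + y = 0"
        using no_zero_divisors[of "z - y" "z + y"] K_closed[OF K_diff[OF z(1) y(1)]] K_closed[OF K_add[OF z(1) y(1)]] by blast
      then show "z \<in> {y, - y}" by (auto simp: add_eq_0_iff2)
    qed
    then have "card {z\<in>N. z * z = x} \<le> card {y, - y}" by (intro card_mono) auto
    also have "\<dots> \<le> 2" by (simp add: card_insert_if)
    finally show "card {z\<in>N. z * z = x} \<le> 2" .
  qed
  finally have "q - 1 \<le> 2 * card Q" using finN by simp
  then have "half \<le> card Q" using q_odd unfolding half_def by linarith
  then have "Q = P" using QP P by (intro card_seteq) auto
  have "chi x = 1 \<longleftrightarrow> x ^ half = e" using assms by (simp add: chi_def)
  also have "\<dots> \<longleftrightarrow> x \<in> P" using pow_half_closed[OF assms(1)] K_closed[OF assms(1)] by (auto simp: P_def poly_monom)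
  also have "\<dots> \<longleftrightarrow> (\<exists>y\<in>K. x = y * y)"
    unfolding \<open>Q = P\<close>[symmetric] Q_def N_def using assms(2) by auto
  finally show ?thesis .
qed

text \<open>
  The coefficients of a monic square root are determined, from the top, by those of the square and
  division by \<open>2\<close>.
\<close>

lemma monic_root_over_K:
  assumes h: "smult e h = h" "degree h \<le> M" "coeff h M = e"
    and hh: "\<And>i. coeff (h * h) i \<in> K"
  shows "coeff h i \<in> K"
proof -
  have b: "coeff h (M - i) \<in> K" if "i \<le> M" for i
    using that
  proof (induction i rule: less_induct)
    case (less i)
    define b where "b a = coeff h (M - a)" for a
    show ?case
    proof (cases "i = 0")
      case True then show ?thesis using h(3) K_e by simp
    next
      case False
      have cl: "e * b i = b i" unfolding b_def by (rule coeff_closed[OF h(1)])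
      have "coeff (h * h) (2 * M - i) = (\<Sum>a\<le>i. b a * b (i - a))"
        unfolding b_def using coeff_square_monic[OF h(2) less.prems] .
      also have "{..i} = insert 0 (insert i {1..<i})" using False by auto
      also have "(\<Sum>a\<in>insert 0 (insert i {1..<i}). b a * b (i - a)) = b 0 * b i + (b i * b 0 + (\<Sum>a\<in>{1..<i}. b a * b (i - a)))"
        using False by simp
      also have "b 0 = e" unfolding b_def using h(3) by simp
      also have "e * b i + (b i * e + (\<Sum>a\<in>{1..<i}. b a * b (i - a))) = (e + e) * b i + (\<Sum>a\<in>{1..<i}. b a * b (i - a))"
        by (simp only: distrib_right mult.commute[of "b i" e] add.assoc)
      finally have eq: "(e + e) * b i = coeff (h * h) (2 * M - i) - (\<Sum>a\<in>{1..<i}. b a * b (i - a))" by simp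
      have "(\<Sum>a\<in>A. b a * b (i - a)) \<in> K" if "A \<subseteq> {1..<i}" for A
        using that
      proof (induction A rule: infinite_finite_induct)
        case (insert a A)
        have "b a \<in> K" unfolding b_def by (rule less.IH) (use insert.prems less.prems in auto)
        moreover have "b (i - a) \<in> K" unfolding b_def by (rule less.IH) (use insert.prems less.prems in auto)
        ultimately show ?case using insert by (auto intro: K_add K_mult)
      qed (auto intro: K_0)
      then have eb: "(e + e) * b i \<in> K" unfolding eq by (intro K_diff hh) auto
      have "e + e \<noteq> 0" using e_neq_minus_e by (metis add_eq_0_iff)
      then obtain z where z: "z \<in> K" "(e + e) * z = e" using K_inverse[of "e + e"] K_add[OF K_e K_e] by blast
      have "z * ((e + e) * b i) = (e + e) * z * b i" by (simp only: mult_ac)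
      then have "b i = z * ((e + e) * b i)" unfolding z(2) cl by simp
      then show ?thesis using K_mult[OF z(1) eb] unfolding b_def by simp
    qed
  qed
  show ?thesis
  proof (cases "i \<le> M")
    case True then show ?thesis using b[of "M - i"] by simp
  next
    case False then show ?thesis using h(2) K_0 by (simp add: coeff_eq_0)
  qed
qed

end

context multi_poly
begin

lemma kronecker_exp_add: "kronecker_exp j (m + m') = kronecker_exp j m + kronecker_exp j m'"
  by (simp add: kronecker_exp_def sum.distrib algebra_simps)

lemma kronecker_exp_inj:
  assumes "set_mset m \<subseteq> {1..k}" "set_mset m' \<subseteq> {1..k}" "\<And>i. count m i \<le> d" "\<And>i. count m' i \<le> d"
    and "kronecker_exp k m = kronecker_exp k m'"
  shows "m = m'"
proof (rule multiset_eqI)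
  fix x
  show "count m x = count m' x"
  proof (cases "x \<in> {1..k}")
    case True
    then obtain i where i: "x = Suc i" "i < k" by (cases x) auto
    show ?thesis unfolding i(1)
      by (rule digits_unique[of k "\<lambda>i. count m (Suc i)" d "\<lambda>i. count m' (Suc i)"])
        (use assms i in \<open>auto simp: kronecker_exp_def\<close>)
  next
    case False
    then have "x \<notin># m" "x \<notin># m'" using assms(1,2) by auto
    then show ?thesis by (simp add: not_in_iff)
  qed
qed

definition small :: "nat multiset \<Rightarrow> bool"
  where "small m \<longleftrightarrow> set_mset m \<subseteq> {1..k} \<and> (\<forall>i. 2 * count m i \<le> d)"

lemma digits_small:
  assumes "N \<in> digits k" obtains m where "small m" "kronecker_exp k m = N"
proof -
  obtain a where a: "\<forall>i. 2 * a i \<le> d" "N = (\<Sum>i<k. a i * (d + 1) ^ i)" using assms digits_def by auto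
  define m where "m = (\<Sum>i<k. replicate_mset (a i) (Suc i))"
  have cnt: "count m (Suc i) = (if i < k then a i else 0)" for i
    unfolding m_def by (auto simp: count_sum sum.delta if_distrib cong: if_cong)
  have cnt0: "count m 0 = 0" unfolding m_def by (auto simp: count_sum)
  have "small m"
    unfolding small_def
  proof (intro conjI allI subsetI)
    fix x assume x: "x \<in># m"
    show "x \<in> {1..k}"
    proof (cases x)
      case 0 then show ?thesis using x cnt0 by (simp add: count_eq_zero_iff)
    next
      case (Suc i) then show ?thesis using x cnt[of i] by (metis Suc_leI atLeastAtMost_iff count_eq_zero_iff le_add1 plus_1_eq_Suc)
    qed
  next
    fix i show "2 * count m i \<le> d" using a(1) cnt cnt0 by (cases i) auto
  qed
  moreover have "kronecker_exp k m = N" unfolding kronecker_exp_def a(2) by (rule sum.cong) (auto simp: cnt)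
  ultimately show ?thesis using that by blast
qed

lemma coeff_kronecker_at_exp:
  assumes "set_mset m \<subseteq> {1..k}" "\<And>i. count m i \<le> d"
  shows "coeff (kronecker k a) (kronecker_exp k m) = f m"
proof -
  have "coeff (kronecker k a) (kronecker_exp k m) = (\<Sum>m'\<in>supp. if m' = m then f m else 0)"
    unfolding kronecker_def coeff_sum coeff_monom
  proof (rule sum.cong)
    fix m' assume m': "m' \<in> supp"
    then have "kronecker_exp k m' = kronecker_exp k m \<longleftrightarrow> m' = m"
      using kronecker_exp_inj[of m' m] f_vars[of m'] count_le_d assms by (auto simp: supp_def)
    then show "(if kronecker_exp k m' = kronecker_exp k m then f m' * mono_value {Suc k..k} a m' else 0) = (if m' = m then f m else 0)"
      by (auto simp: mono_value_def)
  qed simp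
  also have "\<dots> = f m" using supp_finite by (simp add: supp_def)
  finally show ?thesis .
qed

text \<open>
  After the leading coefficient \<open>c \<in> K\<close> is taken out, the square root is monic and hence defined over \<open>K\<close>.
  Reading its exponents as digits gives the square root \<open>g\<close> in several variables.
\<close>

lemma square_on_all_imp_square:
  assumes "square_on_first k a"
  shows "\<exists>c\<in>K. \<exists>g. (\<forall>m. g m \<in> K) \<and> (\<forall>m. g m \<noteq> 0 \<longrightarrow> small m) \<and>
    (\<forall>m. f m = c * (\<Sum>m'\<in>{m'. m' \<subseteq># m}. g m' * g (m - m')))"
proof -
  obtain l h0 where h0: "e * l = l" "smult e h0 = h0" "\<forall>i. coeff h0 i \<noteq> 0 \<longrightarrow> i \<in> digits k" "kronecker k a = smult l (h0 * h0)"
    using assms square_on_first_def by auto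
  have Kn: "kronecker k a \<noteq> 0" using kronecker_nonzero[of k a] k_ge_2 by simp
  obtain h where h: "smult e h = h" "\<forall>i. coeff h0 i = 0 \<longrightarrow> coeff h i = 0" "coeff h (degree h) = e"
    "kronecker k a = smult (coeff (kronecker k a) (degree (kronecker k a))) (h * h)"
    using monic_square_root[OF h0(1,2,4) Kn] by blast
  define c where "c = coeff (kronecker k a) (degree (kronecker k a))"
  have coK: "coeff (kronecker k a) i \<in> K" for i
  proof -
    have "(\<Sum>m\<in>S. coeff (monom (f m * mono_value {Suc k..k} a m) (kronecker_exp k m)) i) \<in> K" for S
      by (induction S rule: infinite_finite_induct) (auto intro: K_add K_0 f_K simp: mono_value_def)
    then show ?thesis unfolding kronecker_def coeff_sum .
  qed
  have c: "c \<in> K" "c \<noteq> 0" using coK Kn by (auto simp: c_def)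
  obtain b where b: "b \<in> K" "c * b = e" using K_inverse[OF c] by blast
  have eq: "kronecker k a = smult c (h * h)" using h(4) unfolding c_def .
  have hhK: "coeff (h * h) i \<in> K" for i
  proof -
    have "smult e (h * h) = h * h" using h(1) by (metis mult_smult_left)
    then have "coeff (h * h) i = e * coeff (h * h) i" using coeff_closed by metis
    also have "\<dots> = b * (c * coeff (h * h) i)" unfolding b(2)[symmetric] by (simp only: mult_ac)
    also have "c * coeff (h * h) i = coeff (kronecker k a) i" unfolding eq by simp
    finally show ?thesis using K_mult[OF b(1) coK[of i]] by simp
  qed
  have hK: "coeff h i \<in> K" for i by (rule monic_root_over_K[OF h(1) le_refl h(3) hhK])
  have hsupp: "i \<in> digits k" if "coeff h i \<noteq> 0" for i using that h(2) h0(3) by blast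
  define g where "g m = (if small m then coeff h (kronecker_exp k m) else 0)" for m
  have "f m = c * (\<Sum>m'\<in>{m'. m' \<subseteq># m}. g m' * g (m - m'))" for m
  proof (cases "set_mset m \<subseteq> {1..k} \<and> (\<forall>i. count m i \<le> d)")
    case True
    then have m: "set_mset m \<subseteq> {1..k}" "\<And>i. count m i \<le> d" by auto
    define A where "A = {m'. m' \<subseteq># m \<and> small m' \<and> small (m - m')}"
    have kd: "kronecker_exp k (m - m') = kronecker_exp k m - kronecker_exp k m'" "kronecker_exp k m' \<le> kronecker_exp k m" if "m' \<subseteq># m" for m'
      using kronecker_exp_add[of k m' "m - m'"] that by auto
    have inj: "inj_on (kronecker_exp k) A"
    proof (rule inj_onI)
      fix m1 m2 assume "m1 \<in> A" "m2 \<in> A" "kronecker_exp k m1 = kronecker_exp k m2"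
      then show "m1 = m2"
        using m by (intro kronecker_exp_inj) (auto simp: A_def small_def intro: le_trans[OF mset_subset_eq_count])
    qed
    have "f m = c * coeff (h * h) (kronecker_exp k m)" using coeff_kronecker_at_exp[OF m, of a] unfolding eq by simp
    also have "coeff (h * h) (kronecker_exp k m) = (\<Sum>t\<le>kronecker_exp k m. coeff h t * coeff h (kronecker_exp k m - t))" by (rule coeff_mult)
    also have "\<dots> = (\<Sum>t\<in>kronecker_exp k ` A. coeff h t * coeff h (kronecker_exp k m - t))"
    proof (rule sum.mono_neutral_right)
      show "kronecker_exp k ` A \<subseteq> {..kronecker_exp k m}" using kd by (auto simp: A_def)
      show "\<forall>t\<in>{..kronecker_exp k m} - kronecker_exp k ` A. coeff h t * coeff h (kronecker_exp k m - t) = 0"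
      proof
        fix t assume t: "t \<in> {..kronecker_exp k m} - kronecker_exp k ` A"
        show "coeff h t * coeff h (kronecker_exp k m - t) = 0"
        proof (rule ccontr)
          assume "coeff h t * coeff h (kronecker_exp k m - t) \<noteq> 0"
          then have "coeff h t \<noteq> 0" "coeff h (kronecker_exp k m - t) \<noteq> 0" by auto
          then have "t \<in> digits k" "kronecker_exp k m - t \<in> digits k" by (simp_all add: hsupp)
          then obtain m1 m2 where m12: "small m1" "kronecker_exp k m1 = t" "small m2" "kronecker_exp k m2 = kronecker_exp k m - t"
            by (metis digits_small)
          have "kronecker_exp k (m1 + m2) = kronecker_exp k m" using m12 t by (simp add: kronecker_exp_add)
          moreover have "count (m1 + m2) i \<le> d" for i
          proof -
            have "2 * count m1 i \<le> d" "2 * count m2 i \<le> d" using m12 unfolding small_def by auto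
            then show ?thesis by simp
          qed
          ultimately have "m1 + m2 = m" using m12 m unfolding small_def by (intro kronecker_exp_inj) auto
          then have "m1 \<in> A" using m12 by (auto simp: A_def)
          then show False using t m12 by auto
        qed
      qed
    qed simp
    also have "\<dots> = (\<Sum>m'\<in>A. coeff h (kronecker_exp k m') * coeff h (kronecker_exp k m - kronecker_exp k m'))"
      using inj by (simp add: sum.reindex)
    also have "\<dots> = (\<Sum>m'\<in>A. g m' * g (m - m'))"
      by (rule sum.cong) (auto simp: A_def g_def kd)
    also have "\<dots> = (\<Sum>m'\<in>{m'. m' \<subseteq># m}. g m' * g (m - m'))"
      by (rule sum.mono_neutral_left) (auto simp: A_def g_def finite_submultisets)
    finally show ?thesis .
  next
    case False
    have "f m = 0"
    proof (rule ccontr)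
      assume "f m \<noteq> 0"
      then have "set_mset m \<subseteq> {1..k}" "\<forall>i. count m i \<le> d" using f_vars count_le_d by (auto simp: supp_def)
      then show False using False by blast
    qed
    moreover have "g m' * g (m - m') = 0" if sub: "m' \<subseteq># m" for m'
    proof (rule ccontr)
      assume "g m' * g (m - m') \<noteq> 0"
      then have s: "small m'" "small (m - m')" by (auto simp: g_def split: if_splits)
      have mm: "m = m' + (m - m')" using sub by simp
      have "set_mset m \<subseteq> {1..k}" using s unfolding small_def by (subst mm) simp
      moreover have "count m i \<le> d" for i
      proof -
        have "2 * count m' i \<le> d" "2 * count (m - m') i \<le> d" using s unfolding small_def by auto
        moreover have "count m i = count m' i + count (m - m') i" by (subst mm) (rule count_union)
        ultimately show ?thesis by linarith
      qed
      ultimately show False using False by blast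
    qed
    ultimately show ?thesis by simp
  qed
  then show ?thesis using c(1) hK K_0 by (intro bexI[OF _ c(1)] exI[of _ g]) (auto simp: g_def)
qed

section \<open>Counting even octahedra over the finite field\<close>

definition is_square :: "'r \<Rightarrow> bool" where "is_square x \<longleftrightarrow> (\<exists>y\<in>K. x = y * y)"

definition even_tuples :: "(nat \<times> bool \<Rightarrow> 'r) set"
  where "even_tuples = {u \<in> tuples {1..k}. inj_on u ({1..k} \<times> UNIV) \<and> even (card {\<epsilon> \<in> choices {1..k}. is_square (value_at (pick u \<epsilon>))})}"

lemma value_at_K: assumes "\<And>i. i \<in> {1..k} \<Longrightarrow> a i \<in> K" shows "value_at a \<in> K"
proof -
  have "value_at (a(1 := a 1)) = poly (fibre 1 a) (a 1)" using poly_fibre[of 1 a "a 1"] k_ge_2 by simp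
  then show ?thesis using poly_in_K[of "fibre 1 a" "a 1"] fibre_over_K[of 1 a] assms k_ge_2 by simp
qed

lemma card_zero_tuples:
  assumes "\<epsilon> \<in> choices {1..k}"
  shows "card {u \<in> tuples {1..k}. value_at (pick u \<epsilon>) = 0} \<le> d * q ^ (2 * k - 1)" (is "card ?S \<le> _")
proof -
  have "card ?S \<le> d * card K ^ (card ({1..k} \<times> (UNIV::bool set)) - 1)"
  proof (rule card_le_of_lines[where i = "(1, \<epsilon> 1)"])
    show "?S \<subseteq> {1..k} \<times> UNIV \<rightarrow>\<^sub>E K" by (auto simp: tuples_def)
    show "(1, \<epsilon> 1) \<in> {1..k} \<times> (UNIV::bool set)" using k_ge_2 by simp
    fix \<psi> assume \<psi>: "\<psi> \<in> ({1..k} \<times> UNIV - {(1, \<epsilon> 1)}) \<rightarrow>\<^sub>E K"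
    have eq: "pick (\<psi>((1, \<epsilon> 1) := y)) \<epsilon> = (pick \<psi> \<epsilon>)(1 := y)" for y by (auto simp: fun_eq_iff pick_def)
    have "e * pick \<psi> \<epsilon> j = pick \<psi> \<epsilon> j" if "j \<in> {1..k} - {1}" for j
      using PiE_mem[OF \<psi>, of "(j, \<epsilon> j)"] that unfolding pick_def by (intro K_closed) auto
    then have "card {y\<in>K. value_at ((pick \<psi> \<epsilon>)(1 := y)) = 0} \<le> d"
      using k_ge_2 by (intro card_roots_line) auto
    moreover have "card {y\<in>K. \<psi>((1, \<epsilon> 1) := y) \<in> ?S} \<le> card {y\<in>K. value_at ((pick \<psi> \<epsilon>)(1 := y)) = 0}"
      using K_finite by (intro card_mono) (auto simp: eq[unfolded One_nat_def])
    ultimately show "card {y\<in>K. \<psi>((1, \<epsilon> 1) := y) \<in> ?S} \<le> d" by simp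
  qed (use K_finite in auto)
  then show ?thesis unfolding K_card by (simp add: card_cartesian_product mult.commute)
qed

lemma card_coincident_tuples:
  assumes "p \<in> {1..k} \<times> UNIV" "p \<noteq> p'"
  shows "card {u \<in> tuples {1..k}. u p = u p'} \<le> q ^ (2 * k - 1)" (is "card ?S \<le> _")
proof -
  have "card ?S \<le> 1 * card K ^ (card ({1..k} \<times> (UNIV::bool set)) - 1)"
  proof (rule card_le_of_lines[where i = p])
    show "?S \<subseteq> {1..k} \<times> UNIV \<rightarrow>\<^sub>E K" by (auto simp: tuples_def)
    fix \<psi> :: "nat \<times> bool \<Rightarrow> 'r"
    have "card {y\<in>K. \<psi>(p := y) \<in> ?S} \<le> card {\<psi> p'}" using assms(2) by (intro card_mono) auto
    then show "card {y\<in>K. \<psi>(p := y) \<in> ?S} \<le> 1" by simp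
  qed (use K_finite assms in auto)
  then show ?thesis unfolding K_card by (simp add: card_cartesian_product mult.commute)
qed

text \<open>
  Every nonsquare contributes a sign; since the total number \<open>2\<^sup>k\<close> of factors is even, the number of
  nonsquares has the parity of the number of squares.
\<close>

lemma even_iff_prod_chi:
  assumes u: "u \<in> tuples {1..k}" and nz: "\<And>\<epsilon>. \<epsilon> \<in> choices {1..k} \<Longrightarrow> value_at (pick u \<epsilon>) \<noteq> 0"
  shows "(\<Prod>\<epsilon>\<in>choices {1..k}. chi (value_at (pick u \<epsilon>)))
    = (if even (card {\<epsilon> \<in> choices {1..k}. is_square (value_at (pick u \<epsilon>))}) then 1 else - 1)"
proof -
  let ?E = "choices {1..k}"
  let ?A = "{\<epsilon> \<in> ?E. is_square (value_at (pick u \<epsilon>))}"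
  have fin: "finite ?E" by (simp add: choices_finite)
  have "chi (value_at (pick u \<epsilon>)) = - 1 * (if \<epsilon> \<in> ?A then - 1 else 1)" if \<epsilon>: "\<epsilon> \<in> ?E" for \<epsilon>
  proof -
    have v: "value_at (pick u \<epsilon>) \<in> K" "value_at (pick u \<epsilon>) \<noteq> 0" using value_at_K pick_K[OF u] nz[OF \<epsilon>] by auto
    have "chi (value_at (pick u \<epsilon>)) = 1 \<longleftrightarrow> is_square (value_at (pick u \<epsilon>))"
      unfolding is_square_def by (rule chi_eq_1_iff[OF v])
    moreover have "chi (value_at (pick u \<epsilon>)) = 1 \<or> chi (value_at (pick u \<epsilon>)) = - 1" using v(2) by (simp add: chi_def)
    ultimately show ?thesis using \<epsilon> by auto
  qed
  then have "(\<Prod>\<epsilon>\<in>?E. chi (value_at (pick u \<epsilon>))) = (\<Prod>\<epsilon>\<in>?E. - 1 * (if \<epsilon> \<in> ?A then - 1 else 1))"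
    by (intro prod.cong) auto
  also have "\<dots> = (- 1) ^ card ?E * (\<Prod>\<epsilon>\<in>?E. if \<epsilon> \<in> ?A then - 1 else 1)"
    by (simp only: prod.distrib prod_constant)
  also have "(\<Prod>\<epsilon>\<in>?E. if \<epsilon> \<in> ?A then - 1 else (1::int)) = (\<Prod>\<epsilon>\<in>?A. - 1)"
    using fin by (intro prod.mono_neutral_cong_right) auto
  also have "\<dots> = (- 1) ^ card ?A" by simp
  also have "(- 1 :: int) ^ card ?E = 1" using k_ge_2 by (simp add: choices_card)
  finally show ?thesis by simp
qed

text \<open>
  The indicator of an even tuple is \<open>(1 + \<Prod>\<^sub>\<epsilon> \<chi>(f(u\<^sub>\<epsilon>))) / 2\<close>, except possibly at tuples with a repeated
  entry or a value \<open>0\<close>, where the two sides differ by at most \<open>1\<close>.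
\<close>

theorem even_tuples_count:
  assumes nonsq: "\<And>a. \<not> square_on_first k a"
  shows "\<bar>real (card even_tuples) - real q ^ (2 * k) / 2\<bar>
    \<le> (char_sum_const k d / 2 + real (2 ^ k * d + 4 * k * k)) * real q ^ (2 * k - 1)"
proof -
  define Z0 where "Z0 = (\<Union>\<epsilon>\<in>choices {1..k}. {u \<in> tuples {1..k}. value_at (pick u \<epsilon>) = 0})"
  define I where "I = {1..k} \<times> (UNIV::bool set)"
  define Z1 where "Z1 = (\<Union>z\<in>{z\<in>I \<times> I. fst z \<noteq> snd z}. {u \<in> tuples {1..k}. u (fst z) = u (snd z)})"
  define s where "s u = (\<Prod>\<epsilon>\<in>choices {1..k}. chi (value_at (pick u \<epsilon>)))" for u
  define t where "t u = (if u \<in> even_tuples then 1 else 0 :: real)" for u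
  have finU: "finite (tuples {1..k})" by (simp add: tuples_finite)
  have finI: "finite I" "card I = 2 * k" by (simp_all add: I_def card_cartesian_product)
  have "card Z0 \<le> (\<Sum>\<epsilon>\<in>choices {1..k}. card {u \<in> tuples {1..k}. value_at (pick u \<epsilon>) = 0})"
    unfolding Z0_def by (rule card_UN_le) (simp add: choices_finite)
  also have "\<dots> \<le> (\<Sum>\<epsilon>\<in>choices {1..k}. d * q ^ (2 * k - 1))" by (rule sum_mono) (rule card_zero_tuples)
  finally have Z0: "card Z0 \<le> 2 ^ k * d * q ^ (2 * k - 1)" by (simp add: choices_card)
  have "card Z1 \<le> (\<Sum>z\<in>{z\<in>I \<times> I. fst z \<noteq> snd z}. card {u \<in> tuples {1..k}. u (fst z) = u (snd z)})"
    unfolding Z1_def by (rule card_UN_le) (use finI in simp)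
  also have "\<dots> \<le> (\<Sum>z\<in>{z\<in>I \<times> I. fst z \<noteq> snd z}. q ^ (2 * k - 1))"
  proof (rule sum_mono)
    fix z assume "z \<in> {z\<in>I \<times> I. fst z \<noteq> snd z}"
    then have "fst z \<in> {1..k} \<times> UNIV" "fst z \<noteq> snd z" by (auto simp: I_def)
    then show "card {u \<in> tuples {1..k}. u (fst z) = u (snd z)} \<le> q ^ (2 * k - 1)" by (rule card_coincident_tuples)
  qed
  also have "\<dots> = card {z\<in>I \<times> I. fst z \<noteq> snd z} * q ^ (2 * k - 1)" by simp
  also have "\<dots> \<le> card (I \<times> I) * q ^ (2 * k - 1)" using finI by (intro mult_le_mono1 card_mono) auto
  finally have Z1: "card Z1 \<le> 4 * k * k * q ^ (2 * k - 1)" by (simp add: card_cartesian_product finI(2))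
  have ZU: "Z0 \<union> Z1 \<subseteq> tuples {1..k}" by (auto simp: Z0_def Z1_def)
  have s_abs: "\<bar>s u\<bar> \<le> 1" for u
    unfolding s_def abs_prod by (rule prod_le_1) (simp add: abs_chi_le)
  have dev: "\<bar>t u - (1 + real_of_int (s u)) / 2\<bar> \<le> (if u \<in> Z0 \<union> Z1 then 1 else 0)" if u: "u \<in> tuples {1..k}" for u
  proof (cases "u \<in> Z0 \<union> Z1")
    case True
    have "- 1 \<le> s u" "s u \<le> 1" using s_abs[of u] by (auto simp: abs_le_iff)
    then have "- 1 \<le> real_of_int (s u)" "real_of_int (s u) \<le> 1" by linarith+
    then show ?thesis using True by (simp add: t_def abs_le_iff)
  next
    case False
    have inj: "inj_on u ({1..k} \<times> UNIV)"
    proof (rule inj_onI, rule ccontr)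
      fix p p' assume "p \<in> {1..k} \<times> UNIV" "p' \<in> {1..k} \<times> UNIV" "u p = u p'" "p \<noteq> p'"
      then have "u \<in> Z1" unfolding Z1_def I_def using u by (intro UN_I[of "(p, p')"]) auto
      then show False using False by simp
    qed
    have nz: "value_at (pick u \<epsilon>) \<noteq> 0" if "\<epsilon> \<in> choices {1..k}" for \<epsilon> using False u that by (auto simp: Z0_def)
    have "s u = (if even (card {\<epsilon> \<in> choices {1..k}. is_square (value_at (pick u \<epsilon>))}) then 1 else - 1)"
      unfolding s_def by (rule even_iff_prod_chi[OF u nz])
    then have "s u = (if u \<in> even_tuples then 1 else - 1)" unfolding even_tuples_def using u inj by simp
    then show ?thesis using False by (simp add: t_def)
  qed
  have evU: "even_tuples \<subseteq> tuples {1..k}" by (auto simp: even_tuples_def)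
  have "real (card even_tuples) = (\<Sum>u\<in>tuples {1..k}. t u)"
    unfolding t_def using finU evU by (simp add: sum.If_cases Int_absorb1)
  moreover have "(\<Sum>u\<in>tuples {1..k}. (1 + real_of_int (s u)) / 2) = (real q ^ (2 * k) + real_of_int char_sum) / 2"
    unfolding char_sum_def s_def by (simp add: sum_divide_distrib[symmetric] sum.distrib tuples_card)
  ultimately have "\<bar>real (card even_tuples) - (real q ^ (2 * k) + real_of_int char_sum) / 2\<bar>
      = \<bar>\<Sum>u\<in>tuples {1..k}. t u - (1 + real_of_int (s u)) / 2\<bar>" unfolding sum_subtractf by (simp only:)
  also have "\<dots> \<le> (\<Sum>u\<in>tuples {1..k}. \<bar>t u - (1 + real_of_int (s u)) / 2\<bar>)" by (rule sum_abs)
  also have "\<dots> \<le> (\<Sum>u\<in>tuples {1..k}. if u \<in> Z0 \<union> Z1 then 1 else 0)" by (rule sum_mono) (rule dev)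
  also have "\<dots> = (\<Sum>u\<in>Z0 \<union> Z1. 1)"
    by (rule sum.mono_neutral_cong_right[OF finU ZU]) auto
  also have "\<dots> = real (card (Z0 \<union> Z1))" by simp
  also have "\<dots> \<le> real ((2 ^ k * d + 4 * k * k) * q ^ (2 * k - 1))"
  proof (rule of_nat_mono)
    have "card (Z0 \<union> Z1) \<le> card Z0 + card Z1" by (rule card_Un_le)
    then show "card (Z0 \<union> Z1) \<le> (2 ^ k * d + 4 * k * k) * q ^ (2 * k - 1)" using Z0 Z1 by (simp add: distrib_right)
  qed
  finally have 1: "\<bar>real (card even_tuples) - (real q ^ (2 * k) + real_of_int char_sum) / 2\<bar>
    \<le> real (2 ^ k * d + 4 * k * k) * real q ^ (2 * k - 1)" by simp
  have 2: "\<bar>real_of_int char_sum\<bar> \<le> char_sum_const k d * real q ^ (2 * k - 1)"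
    by (rule char_sum_bound[OF nonsq])
  have "\<bar>N - Q / 2\<bar> \<le> x / 2 + y" if "\<bar>N - (Q + T) / 2\<bar> \<le> y" "\<bar>T\<bar> \<le> x" for N Q T x y :: real
    using that by (auto simp: abs_le_iff field_simps)
  from this[OF 1 2] show ?thesis by (simp only: distrib_right times_divide_eq_left)
qed

end

section \<open>The product of all fields on a type\<close>

lemma field_closed:
  assumes "field F"
  shows "\<zero>\<^bsub>F\<^esub> \<in> carrier F" "\<one>\<^bsub>F\<^esub> \<in> carrier F"
    "x \<in> carrier F \<Longrightarrow> y \<in> carrier F \<Longrightarrow> x \<oplus>\<^bsub>F\<^esub> y \<in> carrier F"
    "x \<in> carrier F \<Longrightarrow> y \<in> carrier F \<Longrightarrow> x \<otimes>\<^bsub>F\<^esub> y \<in> carrier F"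
    "x \<in> carrier F \<Longrightarrow> \<ominus>\<^bsub>F\<^esub> x \<in> carrier F"
proof -
  interpret field F by fact
  show "\<zero>\<^bsub>F\<^esub> \<in> carrier F" "\<one>\<^bsub>F\<^esub> \<in> carrier F" by auto
  show "x \<in> carrier F \<Longrightarrow> y \<in> carrier F \<Longrightarrow> x \<oplus>\<^bsub>F\<^esub> y \<in> carrier F"
    "x \<in> carrier F \<Longrightarrow> y \<in> carrier F \<Longrightarrow> x \<otimes>\<^bsub>F\<^esub> y \<in> carrier F"
    "x \<in> carrier F \<Longrightarrow> \<ominus>\<^bsub>F\<^esub> x \<in> carrier F" by auto
qed

lemma field_laws:
  assumes "field F"
  shows "x \<in> carrier F \<Longrightarrow> y \<in> carrier F \<Longrightarrow> z \<in> carrier F \<Longrightarrow> (x \<oplus>\<^bsub>F\<^esub> y) \<oplus>\<^bsub>F\<^esub> z = x \<oplus>\<^bsub>F\<^esub> (y \<oplus>\<^bsub>F\<^esub> z)"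
    "x \<in> carrier F \<Longrightarrow> y \<in> carrier F \<Longrightarrow> x \<oplus>\<^bsub>F\<^esub> y = y \<oplus>\<^bsub>F\<^esub> x"
    "x \<in> carrier F \<Longrightarrow> \<zero>\<^bsub>F\<^esub> \<oplus>\<^bsub>F\<^esub> x = x"
    "x \<in> carrier F \<Longrightarrow> \<ominus>\<^bsub>F\<^esub> x \<oplus>\<^bsub>F\<^esub> x = \<zero>\<^bsub>F\<^esub>"
    "x \<in> carrier F \<Longrightarrow> y \<in> carrier F \<Longrightarrow> z \<in> carrier F \<Longrightarrow> (x \<otimes>\<^bsub>F\<^esub> y) \<otimes>\<^bsub>F\<^esub> z = x \<otimes>\<^bsub>F\<^esub> (y \<otimes>\<^bsub>F\<^esub> z)"
    "x \<in> carrier F \<Longrightarrow> y \<in> carrier F \<Longrightarrow> x \<otimes>\<^bsub>F\<^esub> y = y \<otimes>\<^bsub>F\<^esub> x"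
    "x \<in> carrier F \<Longrightarrow> \<one>\<^bsub>F\<^esub> \<otimes>\<^bsub>F\<^esub> x = x"
    "x \<in> carrier F \<Longrightarrow> y \<in> carrier F \<Longrightarrow> z \<in> carrier F \<Longrightarrow> (x \<oplus>\<^bsub>F\<^esub> y) \<otimes>\<^bsub>F\<^esub> z = x \<otimes>\<^bsub>F\<^esub> z \<oplus>\<^bsub>F\<^esub> y \<otimes>\<^bsub>F\<^esub> z"
    "x \<in> carrier F \<Longrightarrow> \<zero>\<^bsub>F\<^esub> \<otimes>\<^bsub>F\<^esub> x = \<zero>\<^bsub>F\<^esub>"
    "x \<in> carrier F \<Longrightarrow> x \<oplus>\<^bsub>F\<^esub> \<zero>\<^bsub>F\<^esub> = x"
    "x \<in> carrier F \<Longrightarrow> x \<otimes>\<^bsub>F\<^esub> \<zero>\<^bsub>F\<^esub> = \<zero>\<^bsub>F\<^esub>"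
    "\<ominus>\<^bsub>F\<^esub> \<zero>\<^bsub>F\<^esub> = \<zero>\<^bsub>F\<^esub>"
proof -
  interpret field F by fact
  show "x \<in> carrier F \<Longrightarrow> y \<in> carrier F \<Longrightarrow> z \<in> carrier F \<Longrightarrow> (x \<oplus>\<^bsub>F\<^esub> y) \<oplus>\<^bsub>F\<^esub> z = x \<oplus>\<^bsub>F\<^esub> (y \<oplus>\<^bsub>F\<^esub> z)"
    "x \<in> carrier F \<Longrightarrow> y \<in> carrier F \<Longrightarrow> x \<oplus>\<^bsub>F\<^esub> y = y \<oplus>\<^bsub>F\<^esub> x"
    "x \<in> carrier F \<Longrightarrow> \<zero>\<^bsub>F\<^esub> \<oplus>\<^bsub>F\<^esub> x = x"
    "x \<in> carrier F \<Longrightarrow> \<ominus>\<^bsub>F\<^esub> x \<oplus>\<^bsub>F\<^esub> x = \<zero>\<^bsub>F\<^esub>"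
    "x \<in> carrier F \<Longrightarrow> y \<in> carrier F \<Longrightarrow> z \<in> carrier F \<Longrightarrow> (x \<otimes>\<^bsub>F\<^esub> y) \<otimes>\<^bsub>F\<^esub> z = x \<otimes>\<^bsub>F\<^esub> (y \<otimes>\<^bsub>F\<^esub> z)"
    "x \<in> carrier F \<Longrightarrow> y \<in> carrier F \<Longrightarrow> x \<otimes>\<^bsub>F\<^esub> y = y \<otimes>\<^bsub>F\<^esub> x"
    "x \<in> carrier F \<Longrightarrow> \<one>\<^bsub>F\<^esub> \<otimes>\<^bsub>F\<^esub> x = x"
    "x \<in> carrier F \<Longrightarrow> y \<in> carrier F \<Longrightarrow> z \<in> carrier F \<Longrightarrow> (x \<oplus>\<^bsub>F\<^esub> y) \<otimes>\<^bsub>F\<^esub> z = x \<otimes>\<^bsub>F\<^esub> z \<oplus>\<^bsub>F\<^esub> y \<otimes>\<^bsub>F\<^esub> z"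
    "x \<in> carrier F \<Longrightarrow> \<zero>\<^bsub>F\<^esub> \<otimes>\<^bsub>F\<^esub> x = \<zero>\<^bsub>F\<^esub>"
    "x \<in> carrier F \<Longrightarrow> x \<oplus>\<^bsub>F\<^esub> \<zero>\<^bsub>F\<^esub> = x"
    "x \<in> carrier F \<Longrightarrow> x \<otimes>\<^bsub>F\<^esub> \<zero>\<^bsub>F\<^esub> = \<zero>\<^bsub>F\<^esub>"
    "\<ominus>\<^bsub>F\<^esub> \<zero>\<^bsub>F\<^esub> = \<zero>\<^bsub>F\<^esub>"
    by (auto simp: a_assoc m_assoc l_distr l_neg intro: a_comm m_comm)
qed

text \<open>
  The product of all fields whose elements have type \<open>'b\<close>. The factor \<open>int\<close> ensures \<open>0 \<noteq> 1\<close> even when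
  there is no such field.
\<close>

typedef 'b field_prod = "{p :: int \<times> ('b ring \<Rightarrow> 'b). \<forall>F. if field F then snd p F \<in> carrier F else snd p F = undefined}"
  by (rule exI[of _ "(0, \<lambda>F. if field F then \<zero>\<^bsub>F\<^esub> else undefined)"]) (auto simp: field_closed)

setup_lifting type_definition_field_prod

instantiation field_prod :: (type) comm_ring_1
begin

lift_definition zero_field_prod :: "'a field_prod" is
  "(0, \<lambda>F. if field F then \<zero>\<^bsub>F\<^esub> else undefined)" by (auto simp: field_closed)

lift_definition one_field_prod :: "'a field_prod" is
  "(1, \<lambda>F. if field F then \<one>\<^bsub>F\<^esub> else undefined)" by (auto simp: field_closed)

lift_definition plus_field_prod :: "'a field_prod \<Rightarrow> 'a field_prod \<Rightarrow> 'a field_prod" is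
  "\<lambda>p q. (fst p + fst q, \<lambda>F. if field F then snd p F \<oplus>\<^bsub>F\<^esub> snd q F else undefined)" by (auto simp: field_closed)

lift_definition times_field_prod :: "'a field_prod \<Rightarrow> 'a field_prod \<Rightarrow> 'a field_prod" is
  "\<lambda>p q. (fst p * fst q, \<lambda>F. if field F then snd p F \<otimes>\<^bsub>F\<^esub> snd q F else undefined)" by (auto simp: field_closed)

lift_definition uminus_field_prod :: "'a field_prod \<Rightarrow> 'a field_prod" is
  "\<lambda>p. (- fst p, \<lambda>F. if field F then \<ominus>\<^bsub>F\<^esub> snd p F else undefined)" by (auto simp: field_closed)

definition minus_field_prod :: "'a field_prod \<Rightarrow> 'a field_prod \<Rightarrow> 'a field_prod"
  where "minus_field_prod p q = p + - q"

instance
proof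
  fix a b c :: "'a field_prod"
  show "a + b + c = a + (b + c)" by transfer (auto simp: fun_eq_iff field_laws(1))
  show "a + b = b + a" by transfer (auto simp: fun_eq_iff field_laws(2))
  show "0 + a = a" by transfer (auto simp: fun_eq_iff prod_eq_iff field_laws(3))
  show "- a + a = 0" by transfer (auto simp: fun_eq_iff field_laws(4))
  show "a - b = a + - b" by (rule minus_field_prod_def)
  show "a * b * c = a * (b * c)" by transfer (auto simp: fun_eq_iff field_laws(5))
  show "a * b = b * a" by transfer (auto simp: fun_eq_iff field_laws(6))
  show "1 * a = a" by transfer (auto simp: fun_eq_iff prod_eq_iff field_laws(7))
  show "(a + b) * c = a * c + b * c" by transfer (auto simp: fun_eq_iff field_laws(8) distrib_right)
  show "(0::'a field_prod) \<noteq> 1" by transfer simp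
qed

end

text \<open>
  The inclusion of the factor \<open>L\<close>, extended by \<open>0\<close> to elements outside the carrier.
\<close>

lift_definition emb :: "'b ring \<Rightarrow> 'b \<Rightarrow> 'b field_prod" is
  "\<lambda>L x. (0, \<lambda>G. if field G then if G = L \<and> x \<in> carrier G then x else \<zero>\<^bsub>G\<^esub> else undefined)"
  by (auto simp: field_closed)

lift_definition component :: "'b ring \<Rightarrow> 'b field_prod \<Rightarrow> 'b" is "\<lambda>L p. snd p L" .

context
  fixes L :: "'b ring"
  assumes L: "field L"
begin

lemma component_closed: "component L p \<in> carrier L"
  using L by transfer auto

lemma component_emb: "x \<in> carrier L \<Longrightarrow> component L (emb L x) = x"
  using L by transfer auto

lemma emb_add: "x \<in> carrier L \<Longrightarrow> y \<in> carrier L \<Longrightarrow> emb L (x \<oplus>\<^bsub>L\<^esub> y) = emb L x + emb L y"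
  using L by transfer (auto simp: fun_eq_iff field_laws(3) field_closed)

lemma emb_mult: "x \<in> carrier L \<Longrightarrow> y \<in> carrier L \<Longrightarrow> emb L (x \<otimes>\<^bsub>L\<^esub> y) = emb L x * emb L y"
  using L by transfer (auto simp: fun_eq_iff field_laws(9) field_closed)

lemma emb_zero: "emb L \<zero>\<^bsub>L\<^esub> = 0"
  using L by transfer (auto simp: fun_eq_iff field_closed)

lemma emb_inj: "x \<in> carrier L \<Longrightarrow> y \<in> carrier L \<Longrightarrow> emb L x = emb L y \<longleftrightarrow> x = y"
  by (metis component_emb)

lemma emb_one_mult: "emb L \<one>\<^bsub>L\<^esub> * p = emb L (component L p)"
  using L by transfer (auto simp: fun_eq_iff field_laws(7,9) field_closed)

lemma emb_closed: "emb L \<one>\<^bsub>L\<^esub> * emb L x = emb L x"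
proof (cases "x \<in> carrier L")
  case True
  then show ?thesis by (simp add: emb_one_mult component_emb)
next
  case False
  then have "emb L x = 0" using L by transfer (auto simp: fun_eq_iff)
  then show ?thesis by simp
qed

end

section \<open>Transfer of fields and polynomials\<close>

text \<open>
  Embeddings of a field into a commutative ring that preserve sums and products and send the unit to an
  idempotent. They transport the polynomial values of the theorem to sums and products in the type
  class.
\<close>

locale idem_hom = field R for R :: "'x ring" (structure) +
  fixes h :: "'x \<Rightarrow> 'r::comm_ring_1" and e :: 'r
  assumes h_add: "x \<in> carrier R \<Longrightarrow> y \<in> carrier R \<Longrightarrow> h (x \<oplus> y) = h x + h y"
    and h_mult: "x \<in> carrier R \<Longrightarrow> y \<in> carrier R \<Longrightarrow> h (x \<otimes> y) = h x * h y"
    and h_zero: "h \<zero> = 0" and h_one: "h \<one> = e"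
begin

lemma h_closed: "x \<in> carrier R \<Longrightarrow> e * h x = h x"
  using h_mult[of \<one> x] h_one by simp

lemma h_idem: "e * e = e"
  using h_closed[of \<one>] h_one by simp

lemma h_pow: "x \<in> carrier R \<Longrightarrow> h (x [^] (n::nat)) = e * h x ^ n"
proof (induction n)
  case 0 then show ?case by (simp add: h_one)
next
  case (Suc n) then show ?case by (simp add: h_mult mult_ac)
qed

lemma h_finsum: "finite A \<Longrightarrow> g \<in> A \<rightarrow> carrier R \<Longrightarrow> h (finsum R g A) = (\<Sum>i\<in>A. h (g i))"
proof (induction A rule: finite_induct)
  case empty then show ?case by (simp add: h_zero)
next
  case (insert i A)
  then have "finsum R g (insert i A) = g i \<oplus> finsum R g A" by (intro finsum_insert) auto
  moreover have "finsum R g A \<in> carrier R" using insert by (intro finsum_closed) auto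
  ultimately show ?case using insert h_add by auto
qed

lemma h_finprod:
  assumes "finite A" "g \<in> A \<rightarrow> carrier R" "\<And>i. i \<in> A \<Longrightarrow> h (g i) = e * y i"
  shows "h (finprod R g A) = e * (\<Prod>i\<in>A. y i)"
  using assms
proof (induction A rule: finite_induct)
  case empty then show ?case by (simp add: h_one)
next
  case (insert i A)
  then have "finprod R g (insert i A) = g i \<otimes> finprod R g A" by (intro finprod_insert) auto
  moreover have "finprod R g A \<in> carrier R" using insert by (intro finprod_closed) auto
  ultimately have "h (finprod R g (insert i A)) = (e * y i) * (e * (\<Prod>i\<in>A. y i))"
    using insert h_mult by auto
  also have "\<dots> = (e * e) * (y i * (\<Prod>i\<in>A. y i))" by (simp only: mult_ac)
  finally show ?case using insert h_idem by simp
qed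

lemma h_eval:
  assumes fin: "finite {m. f m \<noteq> \<zero>}" and car: "\<And>m. f m \<in> carrier R"
    and vars: "\<And>m. f m \<noteq> \<zero> \<Longrightarrow> set_mset m \<subseteq> I" and I: "finite I" and a: "\<And>i. i \<in> I \<Longrightarrow> a i \<in> carrier R"
  shows "h (mpoly_eval R f a) = (\<Sum>m\<in>{m. f m \<noteq> \<zero>}. h (f m) * (\<Prod>i\<in>I. h (a i) ^ count m i))"
    and "mpoly_eval R f a \<in> carrier R"
proof -
  have pc: "(\<Otimes>i\<in>set_mset m. a i [^] count m i) \<in> carrier R" if "f m \<noteq> \<zero>" for m
    using vars[OF that] a by (intro finprod_closed) auto
  then have tc: "f m \<otimes> (\<Otimes>i\<in>set_mset m. a i [^] count m i) \<in> carrier R" if "f m \<noteq> \<zero>" for m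
    using car that by simp
  have "h (f m \<otimes> (\<Otimes>i\<in>set_mset m. a i [^] count m i)) = h (f m) * (\<Prod>i\<in>I. h (a i) ^ count m i)" if m: "f m \<noteq> \<zero>" for m
  proof -
    have "h (\<Otimes>i\<in>set_mset m. a i [^] count m i) = e * (\<Prod>i\<in>set_mset m. h (a i) ^ count m i)"
      using vars[OF m] a by (intro h_finprod) (auto simp: h_pow)
    moreover have "(\<Prod>i\<in>set_mset m. h (a i) ^ count m i) = (\<Prod>i\<in>I. h (a i) ^ count m i)"
      using vars[OF m] I by (intro prod.mono_neutral_left) (auto simp: not_in_iff)
    ultimately have "h (f m \<otimes> (\<Otimes>i\<in>set_mset m. a i [^] count m i)) = (e * h (f m)) * (\<Prod>i\<in>I. h (a i) ^ count m i)"
      using h_mult[OF car pc[OF m]] by (simp add: mult_ac)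
    then show ?thesis using h_closed[OF car] by simp
  qed
  then show "h (mpoly_eval R f a) = (\<Sum>m\<in>{m. f m \<noteq> \<zero>}. h (f m) * (\<Prod>i\<in>I. h (a i) ^ count m i))"
    unfolding mpoly_eval_def using tc by (subst h_finsum[OF fin]) (auto intro!: sum.cong)
  show "mpoly_eval R f a \<in> carrier R" unfolding mpoly_eval_def using tc by (intro finsum_closed) auto
qed

end

lemma idem_hom_emb: "field L \<Longrightarrow> idem_hom L (emb L) (emb L \<one>\<^bsub>L\<^esub>)"
  by (intro idem_hom.intro idem_hom_axioms.intro) (auto simp: emb_add emb_mult emb_zero)

lemma emb_eval:
  assumes L: "field L" and "\<And>a. a \<in> set as \<Longrightarrow> emb L \<one>\<^bsub>L\<^esub> * a = a" and x: "x \<in> carrier L"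
  shows "emb L (ring.eval L (map (component L) as) x) = poly (Poly (rev as)) (emb L x)
    \<and> ring.eval L (map (component L) as) x \<in> carrier L"
proof -
  interpret field L by fact
  interpret idem_hom L "emb L" "emb L \<one>\<^bsub>L\<^esub>" by (rule idem_hom_emb[OF L])
  show ?thesis using assms(2)
  proof (induction as)
    case Nil then show ?case by (simp add: emb_zero[OF L])
  next
    case (Cons a as)
    define c where "c = component L a"
    have c: "c \<in> carrier L" "emb L c = a"
      using component_closed[OF L] emb_one_mult[OF L, of a] Cons.prems[of a] by (auto simp: c_def)
    have ev: "ring.eval L (map (component L) (a # as)) x
      = c \<otimes>\<^bsub>L\<^esub> x [^]\<^bsub>L\<^esub> length as \<oplus>\<^bsub>L\<^esub> ring.eval L (map (component L) as) x"
      by (simp add: c_def)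
    have IH: "emb L (ring.eval L (map (component L) as) x) = poly (Poly (rev as)) (emb L x)"
      "ring.eval L (map (component L) as) x \<in> carrier L" using Cons by auto
    have "emb L (c \<otimes>\<^bsub>L\<^esub> x [^]\<^bsub>L\<^esub> length as) = a * (emb L \<one>\<^bsub>L\<^esub> * emb L x ^ length as)"
      using c x by (simp add: h_mult h_pow)
    also have "\<dots> = (emb L \<one>\<^bsub>L\<^esub> * a) * emb L x ^ length as" by (simp only: mult_ac)
    also have "\<dots> = a * emb L x ^ length as" using Cons.prems[of a] by simp
    finally have "emb L (ring.eval L (map (component L) (a # as)) x)
      = a * emb L x ^ length as + poly (Poly (rev as)) (emb L x)"
      unfolding ev using IH c x by (simp add: h_add)
    moreover have "poly (Poly (rev (a # as))) (emb L x) = a * emb L x ^ length as + poly (Poly (rev as)) (emb L x)"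
      by (simp add: Poly_append poly_monom mult.commute add.commute)
    moreover have "ring.eval L (map (component L) (a # as)) x \<in> carrier L" unfolding ev using IH c x by simp
    ultimately show ?case by simp
  qed
qed

text \<open>
  A polynomial over the factor \<open>L\<close> is, componentwise, a list of coefficients in \<open>L\<close>, and a root of that
  list is embedded as a root of the polynomial.
\<close>

lemma closed_idem_emb:
  assumes "algebraically_closed L"
  shows "closed_idem (emb L \<one>\<^bsub>L\<^esub>)"
proof -
  interpret algebraically_closed L by fact
  note L = field_axioms
  let ?e = "emb L \<one>\<^bsub>L\<^esub>"
  show ?thesis
  proof
    show "?e * ?e = ?e" by (rule emb_closed[OF L])
    show "?e \<noteq> 0" using emb_inj[OF L, of "\<one>\<^bsub>L\<^esub>" "\<zero>\<^bsub>L\<^esub>"] emb_zero[OF L] by simp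
    fix x assume x: "?e * x = x" "x \<noteq> 0"
    define c where "c = component L x"
    have c: "c \<in> carrier L" "emb L c = x" using component_closed[OF L] emb_one_mult[OF L, of x] x by (auto simp: c_def)
    have "c \<noteq> \<zero>\<^bsub>L\<^esub>" using c x emb_zero[OF L] by auto
    then have "c \<in> Units L" using c field_Units by auto
    then have "x * emb L (inv\<^bsub>L\<^esub> c) = ?e" "inv\<^bsub>L\<^esub> c \<in> carrier L"
      using emb_mult[OF L, of c "inv\<^bsub>L\<^esub> c"] c by auto
    then show "\<exists>y. ?e * y = y \<and> x * y = ?e" using emb_closed[OF L] by blast
  next
    fix p assume p: "smult ?e p = p" "degree p > 0"
    define as where "as = rev (coeffs p)"
    define P where "P = map (component L) as"
    have pn: "p \<noteq> 0" using p(2) by auto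
    have as_cl: "?e * a = a" if "a \<in> set as" for a
    proof -
      have "a \<in> range (poly.coeff p)" using that range_coeff[of p] by (auto simp: as_def)
      then show ?thesis using p(1) by (metis coeff_smult rangeE)
    qed
    have len: "length P = Suc (degree p)" by (simp add: P_def as_def length_coeffs_degree[OF pn])
    have asne: "as \<noteq> []" using pn by (simp add: as_def)
    have hd: "hd as = poly.coeff p (degree p)" using pn by (simp add: as_def hd_rev last_coeffs_eq_coeff_degree)
    have "component L (hd as) \<noteq> \<zero>\<^bsub>L\<^esub>"
    proof
      assume "component L (hd as) = \<zero>\<^bsub>L\<^esub>"
      then have "?e * hd as = 0" using emb_one_mult[OF L, of "hd as"] emb_zero[OF L] by simp
      then have "hd as = 0" using as_cl asne by simp
      then show False using hd pn by simp
    qed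
    then have Pc: "P \<in> carrier (poly_ring L)"
      using component_closed[OF L] asne by (auto simp: univ_poly_def polynomial_def P_def hd_map)
    then have "splitted P" by (rule roots_over_carrier)
    then have "size (roots P) = degree p" unfolding splitted_def using len by simp
    then have "roots P \<noteq> {#}" using p(2) by auto
    then obtain x where "x \<in># roots P" by blast
    then have "is_root P x" using roots_mem_iff_is_root[OF Pc] by auto
    then have x: "x \<in> carrier L" "eval P x = \<zero>\<^bsub>L\<^esub>" by (auto simp: is_root_def)
    have "poly (Poly (rev as)) (emb L x) = 0"
      using emb_eval[OF L _ x(1), of as] as_cl x(2) emb_zero[OF L] unfolding P_def by simp
    then have "poly p (emb L x) = 0" by (simp add: as_def)
    then show "\<exists>a. ?e * a = a \<and> poly p a = 0" using emb_closed[OF L] by blast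
  qed
qed

lemma finite_field_pow_card:
  assumes "field F" "finite (carrier F)" "x \<in> carrier F"
  shows "x [^]\<^bsub>F\<^esub> card (carrier F) = x"
proof -
  interpret field F by fact
  have pos: "card (carrier F) > 0" using assms by (auto simp: card_gt_0_iff)
  show ?thesis
  proof (cases "x = \<zero>\<^bsub>F\<^esub>")
    case True
    then show ?thesis using pos by (simp add: nat_pow_zero)
  next
    case False
    then have xm: "x \<in> carrier (Multiplicative_Group.mult_of F)" using assms by simp
    have "x [^]\<^bsub>Multiplicative_Group.mult_of F\<^esub> Coset.order (Multiplicative_Group.mult_of F) = \<one>\<^bsub>Multiplicative_Group.mult_of F\<^esub>"
      by (rule group.pow_order_eq_1[OF field_mult_group xm])
    then have "x [^]\<^bsub>F\<^esub> (card (carrier F) - 1) = \<one>\<^bsub>F\<^esub>"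
      using order_mult_of[OF assms(2)] by (simp add: Multiplicative_Group.nat_pow_mult_of Coset.order_def)
    moreover have "x [^]\<^bsub>F\<^esub> Suc (card (carrier F) - 1) = x [^]\<^bsub>F\<^esub> (card (carrier F) - 1) \<otimes>\<^bsub>F\<^esub> x" by simp
    ultimately show ?thesis using pos assms(3) by simp
  qed
qed

text \<open>
  Together with \<open>mpolysI\<close> this characterises the inductively defined polynomials as the finitely
  supported coefficient functions on monomials in \<open>x\<^sub>1, \<dots>, x\<^sub>k\<close>.
\<close>

lemma mpolys_properties:
  assumes "ring R" "f \<in> mpolys R k"
  shows "finite {m. f m \<noteq> \<zero>\<^bsub>R\<^esub>} \<and> (\<forall>m. f m \<in> carrier R) \<and> (\<forall>m. f m \<noteq> \<zero>\<^bsub>R\<^esub> \<longrightarrow> set_mset m \<subseteq> {1..k})"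
proof -
  interpret ring R by fact
  show ?thesis using assms(2)
  proof (induction rule: indexed_pset.induct)
    case (indexed_const c)
    have "{m. indexed_const c m \<noteq> \<zero>\<^bsub>R\<^esub>} \<subseteq> {{#}}" by (auto simp: indexed_const_def)
    then have "finite {m. indexed_const c m \<noteq> \<zero>\<^bsub>R\<^esub>}" by (rule finite_subset) simp
    then show ?case using indexed_const by (auto simp: indexed_const_def split: if_splits)
  next
    case (indexed_padd P Q)
    have "{m. indexed_padd P Q m \<noteq> \<zero>\<^bsub>R\<^esub>} \<subseteq> {m. P m \<noteq> \<zero>\<^bsub>R\<^esub>} \<union> {m. Q m \<noteq> \<zero>\<^bsub>R\<^esub>}"
      by (auto simp: indexed_padd_def)
    then have "finite {m. indexed_padd P Q m \<noteq> \<zero>\<^bsub>R\<^esub>}" using indexed_padd by (auto intro: finite_subset)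
    moreover have "set_mset m \<subseteq> {1..k}" if "indexed_padd P Q m \<noteq> \<zero>\<^bsub>R\<^esub>" for m
    proof -
      have "P m \<noteq> \<zero>\<^bsub>R\<^esub> \<or> Q m \<noteq> \<zero>\<^bsub>R\<^esub>" using that by (auto simp: indexed_padd_def)
      then show ?thesis using indexed_padd by blast
    qed
    ultimately show ?case using indexed_padd by (auto simp: indexed_padd_def)
  next
    case (indexed_pmult P i)
    have "{m. indexed_pmult P i m \<noteq> \<zero>\<^bsub>R\<^esub>} \<subseteq> add_mset i ` {m. P m \<noteq> \<zero>\<^bsub>R\<^esub>}"
    proof
      fix m assume "m \<in> {m. indexed_pmult P i m \<noteq> \<zero>\<^bsub>R\<^esub>}"
      then have "i \<in># m" "P (m - {#i#}) \<noteq> \<zero>\<^bsub>R\<^esub>" by (auto simp: indexed_pmult_def split: if_splits)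
      then show "m \<in> add_mset i ` {m. P m \<noteq> \<zero>\<^bsub>R\<^esub>}" by (intro image_eqI[of _ _ "m - {#i#}"]) auto
    qed
    then have "finite {m. indexed_pmult P i m \<noteq> \<zero>\<^bsub>R\<^esub>}" using indexed_pmult by (auto intro: finite_subset)
    moreover have "set_mset m \<subseteq> {1..k}" if "indexed_pmult P i m \<noteq> \<zero>\<^bsub>R\<^esub>" for m
    proof -
      have m: "i \<in># m" "P (m - {#i#}) \<noteq> \<zero>\<^bsub>R\<^esub>" using that by (auto simp: indexed_pmult_def split: if_splits)
      then have "set_mset (m - {#i#}) \<subseteq> {1..k}" using indexed_pmult by blast
      moreover have "m = add_mset i (m - {#i#})" using m by simp
      ultimately show ?thesis using indexed_pmult by (metis insert_subset set_mset_add_mset_insert)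
    qed
    ultimately show ?case using indexed_pmult by (auto simp: indexed_pmult_def)
  qed
qed

lemma mpolysI:
  assumes "ring R" "finite {m. f m \<noteq> \<zero>\<^bsub>R\<^esub>}" "\<And>m. f m \<in> carrier R" "\<And>m. f m \<noteq> \<zero>\<^bsub>R\<^esub> \<Longrightarrow> set_mset m \<subseteq> {1..k}"
  shows "f \<in> mpolys R k"
proof -
  interpret ring R by fact
  have mono: "(\<lambda>m'. if m' = m then c else \<zero>\<^bsub>R\<^esub>) \<in> mpolys R k" if "c \<in> carrier R" "set_mset m \<subseteq> {1..k}" for c m
    using that
  proof (induction m)
    case empty
    have eq: "(\<lambda>m'. if m' = {#} then c else \<zero>\<^bsub>R\<^esub>) = indexed_const c" by (simp add: indexed_const_def)
    show ?case unfolding eq by (rule indexed_pset.indexed_const) (use empty in auto)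
  next
    case (add x m)
    have "(\<lambda>m'. if m' = add_mset x m then c else \<zero>\<^bsub>R\<^esub>) = indexed_pmult (\<lambda>m'. if m' = m then c else \<zero>\<^bsub>R\<^esub>) x"
      by (auto simp: indexed_pmult_def fun_eq_iff)
    then show ?case using indexed_pset.indexed_pmult[OF add.IH, of x] add.prems by simp
  qed
  have "f \<in> mpolys R k" if "finite S" "{m. f m \<noteq> \<zero>\<^bsub>R\<^esub>} \<subseteq> S" "\<And>m. f m \<in> carrier R" "\<And>m. f m \<noteq> \<zero>\<^bsub>R\<^esub> \<Longrightarrow> set_mset m \<subseteq> {1..k}" for S f
    using that
  proof (induction S arbitrary: f rule: finite_induct)
    case empty
    then have eq: "f = indexed_const \<zero>\<^bsub>R\<^esub>" by (auto simp: indexed_const_def fun_eq_iff)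
    show ?case unfolding eq by (rule indexed_pset.indexed_const) simp
  next
    case (insert m S)
    define f' where "f' = f(m := \<zero>\<^bsub>R\<^esub>)"
    have f': "f' \<in> mpolys R k" using insert.prems insert.hyps by (intro insert.IH) (auto simp: f'_def split: if_splits)
    show ?case
    proof (cases "f m = \<zero>\<^bsub>R\<^esub>")
      case True
      then have "f' = f" by (auto simp: f'_def)
      then show ?thesis using f' by simp
    next
      case False
      then have "(\<lambda>m'. if m' = m then f m else \<zero>\<^bsub>R\<^esub>) \<in> mpolys R k" using insert.prems by (intro mono) auto
      moreover have "f = indexed_padd f' (\<lambda>m'. if m' = m then f m else \<zero>\<^bsub>R\<^esub>)"
        using insert.prems(2) by (auto simp: indexed_padd_def f'_def fun_eq_iff)
      ultimately show ?thesis using indexed_pset.indexed_padd[OF f'] by metis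
    qed
  qed
  then show ?thesis using assms(2-4) by blast
qed

lemma mpoly_degree_size:
  assumes "finite {m. f m \<noteq> \<zero>\<^bsub>R\<^esub>}" "f m \<noteq> \<zero>\<^bsub>R\<^esub>" shows "size m \<le> mpoly_degree R f"
  unfolding mpoly_degree_def using assms by (intro Max_ge) auto

context multi_poly
begin

lemma finite_small: "finite {m. small m}"
proof -
  have "{m. small m} \<subseteq> {m. m \<subseteq># (\<Sum>i\<in>{1..k}. replicate_mset d i)}"
  proof
    fix m assume "m \<in> {m. small m}"
    then have m: "set_mset m \<subseteq> {1..k}" "\<And>i. 2 * count m i \<le> d" by (auto simp: small_def)
    have "count m i \<le> count (\<Sum>i\<in>{1..k}. replicate_mset d i) i" for i
    proof (cases "i \<in> {1..k}")
      case True
      then have "count (\<Sum>i\<in>{1..k}. replicate_mset d i) i = d" by (simp add: count_sum)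
      then show ?thesis using m(2)[of i] by simp
    next
      case False
      then have "i \<notin># m" using m(1) by auto
      then show ?thesis by (simp add: not_in_iff)
    qed
    then show "m \<in> {m. m \<subseteq># (\<Sum>i\<in>{1..k}. replicate_mset d i)}" by (simp add: mset_subset_eqI)
  qed
  then show ?thesis using finite_submultisets finite_subset by blast
qed

lemma value_at_cong: "(\<And>i. i \<in> {1..k} \<Longrightarrow> a i = b i) \<Longrightarrow> value_at a = value_at b"
  unfolding value_at_def using mono_value_cong[of "{1..k}" a b] by (intro sum.cong) auto

lemma value_at_permute:
  assumes \<pi>: "\<pi> permutes {1..k}" shows "value_at (a \<circ> \<pi>) = value_at a"
proof -
  have inj: "inj \<pi>" using \<pi> permutes_inj by blast
  have cnt: "count (image_mset \<pi> m) (\<pi> x) = count m x" for m x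
    by (induction m) (use inj in \<open>auto dest: injD\<close>)
  have "mono_value {1..k} (a \<circ> \<pi>) m = mono_value {1..k} a (image_mset \<pi> m)" for m
  proof -
    have "mono_value {1..k} (a \<circ> \<pi>) m = (\<Prod>i\<in>{1..k}. a (\<pi> i) ^ count (image_mset \<pi> m) (\<pi> i))"
      unfolding mono_value_def cnt by simp
    also have "\<dots> = (\<Prod>i\<in>\<pi> ` {1..k}. a i ^ count (image_mset \<pi> m) i)"
      using inj by (subst prod.reindex) (auto simp: inj_on_def dest: injD)
    finally show ?thesis unfolding mono_value_def permutes_image[OF \<pi>] .
  qed
  then have "value_at (a \<circ> \<pi>) = (\<Sum>m\<in>supp. f (image_mset \<pi> m) * mono_value {1..k} a (image_mset \<pi> m))"
    unfolding value_at_def using f_sym[OF \<pi>] by simp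
  also have "\<dots> = value_at a" unfolding value_at_def
  proof (rule sum.reindex_bij_witness[of _ "image_mset (inv_into UNIV \<pi>)" "image_mset \<pi>"])
    note bij = permutes_bij[OF \<pi>]
    fix m
    show inv1: "image_mset (inv_into UNIV \<pi>) (image_mset \<pi> m) = m" using bij by (simp add: image_mset.compositionality comp_def bij_is_inj inv_f_f)
    show inv2: "image_mset \<pi> (image_mset (inv_into UNIV \<pi>) m) = m" using bij by (simp add: image_mset.compositionality comp_def bij_is_surj surj_f_inv_f)
    show "image_mset \<pi> m \<in> supp" if "m \<in> supp" using that f_sym[OF \<pi>] by (simp add: supp_def)
    show "image_mset (inv_into UNIV \<pi>) m \<in> supp" if "m \<in> supp"
      using that f_sym[OF \<pi>, of "image_mset (inv_into UNIV \<pi>) m"] unfolding inv2 by (simp add: supp_def)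
  qed simp
  finally show ?thesis .
qed

end

section \<open>Admissible polynomials\<close>

locale admissible_poly =
  fixes F :: "'a ring" and f :: "nat multiset \<Rightarrow> 'a" and k d :: nat
  assumes F: "odd_finite_field F" and adm: "admissible F k f" and deg: "mpoly_degree F f = d" and k2: "k \<ge> 2"
begin

lemma fieldF: "field F" and finF: "finite (carrier F)" and oddF: "odd (card (carrier F))"
  using F by (auto simp: odd_finite_field_def)

lemma ringF: "ring F" using fieldF by (simp add: field.is_ring)

definition L where "L = field.alg_closure F"
definition \<iota> :: "'a \<Rightarrow> ('a list \<times> nat) multiset \<Rightarrow> 'a" where "\<iota> = ring.indexed_const F"
definition J :: "'a \<Rightarrow> (('a list \<times> nat) multiset \<Rightarrow> 'a) field_prod" where "J x = emb L (\<iota> x)"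
definition e where "e = emb L \<one>\<^bsub>L\<^esub>"
definition K where "K = J ` carrier F"
definition q where "q = card (carrier F)"

lemma closedL: "algebraically_closed L"
proof -
  interpret algebraic_closure L "\<iota> ` carrier F"
    unfolding L_def \<iota>_def by (rule field.alg_closureE(1)[OF fieldF])
  show ?thesis by (rule algebraically_closed_axioms)
qed

lemma fieldL: "field L"
  using closedL by (simp add: algebraically_closed_def)

lemma \<iota>_hom: "\<iota> \<in> ring_hom F L"
  unfolding L_def \<iota>_def by (rule field.alg_closureE(2)[OF fieldF])

lemma \<iota>_closed: "x \<in> carrier F \<Longrightarrow> \<iota> x \<in> carrier L"
  by (rule ring_hom_closed[OF \<iota>_hom])

lemma \<iota>_zero: "\<iota> \<zero>\<^bsub>F\<^esub> = \<zero>\<^bsub>L\<^esub>"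
  by (rule ring_hom_zero[OF \<iota>_hom ringF]) (rule field.is_ring[OF fieldL])

lemma \<iota>_inj: "\<iota> x = \<iota> y \<longleftrightarrow> x = y"
  unfolding \<iota>_def ring.indexed_const_def[OF ringF] by (metis (full_types))

lemma idem_hom_J: "idem_hom F J e"
proof (intro idem_hom.intro idem_hom_axioms.intro fieldF)
  show "J (x \<oplus>\<^bsub>F\<^esub> y) = J x + J y" if "x \<in> carrier F" "y \<in> carrier F" for x y
    unfolding J_def ring_hom_add[OF \<iota>_hom that] by (rule emb_add[OF fieldL \<iota>_closed[OF that(1)] \<iota>_closed[OF that(2)]])
  show "J (x \<otimes>\<^bsub>F\<^esub> y) = J x * J y" if "x \<in> carrier F" "y \<in> carrier F" for x y
    unfolding J_def ring_hom_mult[OF \<iota>_hom that] by (rule emb_mult[OF fieldL \<iota>_closed[OF that(1)] \<iota>_closed[OF that(2)]])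
  show "J \<zero>\<^bsub>F\<^esub> = 0" unfolding J_def \<iota>_zero by (rule emb_zero[OF fieldL])
  show "J \<one>\<^bsub>F\<^esub> = e" unfolding J_def e_def ring_hom_one[OF \<iota>_hom] ..
qed

sublocale J: idem_hom F J e by (rule idem_hom_J)

lemma J_inj: "x \<in> carrier F \<Longrightarrow> y \<in> carrier F \<Longrightarrow> J x = J y \<longleftrightarrow> x = y"
  unfolding J_def using emb_inj[OF fieldL \<iota>_closed \<iota>_closed] \<iota>_inj by simp

lemma J_eq_0: "x \<in> carrier F \<Longrightarrow> J x = 0 \<longleftrightarrow> x = \<zero>\<^bsub>F\<^esub>"
  using J_inj[of x "\<zero>\<^bsub>F\<^esub>"] J.h_zero by simp

lemma f_props: "finite {m. f m \<noteq> \<zero>\<^bsub>F\<^esub>}" "f m \<in> carrier F" "f m \<noteq> \<zero>\<^bsub>F\<^esub> \<Longrightarrow> set_mset m \<subseteq> {1..k}"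
  "f m \<noteq> \<zero>\<^bsub>F\<^esub> \<Longrightarrow> size m \<le> d"
proof -
  have "f \<in> mpolys F k" using adm by (simp add: admissible_def)
  note p = mpolys_properties[OF ringF this]
  show "finite {m. f m \<noteq> \<zero>\<^bsub>F\<^esub>}" "f m \<in> carrier F" "f m \<noteq> \<zero>\<^bsub>F\<^esub> \<Longrightarrow> set_mset m \<subseteq> {1..k}" using p by auto
  show "f m \<noteq> \<zero>\<^bsub>F\<^esub> \<Longrightarrow> size m \<le> d" using p mpoly_degree_size[of f F m] deg by auto
qed

lemma supp_J: "{m. J (f m) \<noteq> 0} = {m. f m \<noteq> \<zero>\<^bsub>F\<^esub>}"
  using J_eq_0 f_props(2) by auto

lemma finite_field_J: "finite_field_idem e K q"
proof -
  have ci: "closed_idem e" unfolding e_def by (rule closed_idem_emb[OF closedL])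
  have inj: "inj_on J (carrier F)" using J_inj by (auto simp: inj_on_def)
  have qpos: "q > 0" using oddF unfolding q_def by (cases "card (carrier F)") auto
  show ?thesis
  proof (intro finite_field_idem.intro finite_field_idem_axioms.intro ci)
    show "finite K" "odd q" using finF oddF by (auto simp: K_def q_def)
    show "card K = q" unfolding K_def q_def by (rule card_image[OF inj])
    show "e * x = x" if "x \<in> K" for x using that J.h_closed by (auto simp: K_def)
    show "x + y \<in> K" if "x \<in> K" "y \<in> K" for x y
      using that J.h_add[symmetric] by (auto simp: K_def)
    show "x * y \<in> K" if "x \<in> K" "y \<in> K" for x y
      using that J.h_mult[symmetric] by (auto simp: K_def)
    show "- x \<in> K" if x: "x \<in> K" for x
    proof -
      obtain y where y: "y \<in> carrier F" "x = J y" using x by (auto simp: K_def)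
      have "J (\<ominus>\<^bsub>F\<^esub> y) + J y = 0" using J.h_add[of "\<ominus>\<^bsub>F\<^esub> y" y] y(1) J.h_zero by (simp add: J.l_neg)
      then have "- x = J (\<ominus>\<^bsub>F\<^esub> y)" unfolding y(2) by (simp add: neg_eq_iff_add_eq_0 add.commute)
      then show ?thesis using y(1) by (auto simp: K_def)
    qed
    show "0 \<in> K" using J.h_zero by (auto simp: K_def image_iff intro!: bexI[of _ "\<zero>\<^bsub>F\<^esub>"])
    show "e \<in> K" using J.h_one by (auto simp: K_def image_iff intro!: bexI[of _ "\<one>\<^bsub>F\<^esub>"])
    show "x ^ q = x" if x: "x \<in> K" for x
    proof -
      obtain y where y: "y \<in> carrier F" "x = J y" using x by (auto simp: K_def)
      have "x = J (y [^]\<^bsub>F\<^esub> q)" using finite_field_pow_card[OF fieldF finF y(1)] y(2) by (simp add: q_def)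
      also have "\<dots> = e * x ^ q" using J.h_pow[OF y(1)] y(2) by simp
      also have "\<dots> = x ^ q"
      proof -
        have "e * x = x" using J.h_closed[OF y(1)] y(2) by simp
        then show ?thesis using qpos by (cases q) (auto simp flip: mult.assoc)
      qed
      finally show ?thesis by simp
    qed
  qed
qed

text \<open>
  The coefficient of \<open>x\<^sub>1\<^sup>j\<close> in the sum is the value of \<open>H\<^sub>j\<close>, and primitivity provides a \<open>j\<close> for which it
  is not zero.
\<close>

lemma primitive_J:
  assumes a: "\<And>i. i \<in> {2..k} \<Longrightarrow> e * a i = a i"
  shows "(\<Sum>m\<in>{m. J (f m) \<noteq> 0}. monom (J (f m) * (\<Prod>i\<in>{2..k}. a i ^ count m i)) (count m 1)) \<noteq> 0"
proof -
  interpret EL: idem_hom L "emb L" e unfolding e_def by (rule idem_hom_emb[OF fieldL])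
  define b where "b i = component L (a i)" for i
  have b: "b i \<in> carrier L" for i unfolding b_def by (rule component_closed[OF fieldL])
  have ba: "emb L (b i) = a i" if "i \<in> {2..k}" for i
    unfolding b_def using emb_one_mult[OF fieldL, of "a i"] a[OF that] by (simp add: e_def)
  define g where "g j m = \<iota> (x1_coeff F f j m)" for j m
  have "primitive_mpoly F k f" using adm by (simp add: admissible_def)
  moreover have "b \<in> {2..k} \<rightarrow> carrier L" using b by auto
  ultimately obtain j where j: "mpoly_eval L (g j) b \<noteq> \<zero>\<^bsub>L\<^esub>"
    unfolding primitive_mpoly_def g_def[abs_def] L_def[symmetric] \<iota>_def[symmetric] by blast
  define r where "r = replicate_mset j (1::nat)"
  have x1: "x1_coeff F f j m \<in> carrier F" for m using f_props(2) field_closed(1)[OF fieldF] by (simp add: x1_coeff_def)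
  have gsupp: "{m. g j m \<noteq> \<zero>\<^bsub>L\<^esub>} = {m. 1 \<notin># m \<and> f (m + r) \<noteq> \<zero>\<^bsub>F\<^esub>}"
    using \<iota>_inj[of _ "\<zero>\<^bsub>F\<^esub>"] by (auto simp: g_def x1_coeff_def r_def \<iota>_zero)
  have g_val: "g j m = \<iota> (f (m + r))" if "1 \<notin># m" for m using that by (simp add: g_def x1_coeff_def r_def)
  have fin: "finite {m. g j m \<noteq> \<zero>\<^bsub>L\<^esub>}"
  proof (rule finite_imageD)
    show "finite ((\<lambda>m. m + r) ` {m. g j m \<noteq> \<zero>\<^bsub>L\<^esub>})"
      by (rule finite_subset[OF _ f_props(1)]) (auto simp: gsupp)
    show "inj_on (\<lambda>m. m + r) {m. g j m \<noteq> \<zero>\<^bsub>L\<^esub>}" by (auto simp: inj_on_def)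
  qed
  have vars: "set_mset m \<subseteq> {2..k}" if "g j m \<noteq> \<zero>\<^bsub>L\<^esub>" for m
  proof
    fix x assume x: "x \<in># m"
    have m: "1 \<notin># m" "f (m + r) \<noteq> \<zero>\<^bsub>F\<^esub>" using that gsupp by auto
    then have "x \<in> {1..k}" using f_props(3)[OF m(2)] x by auto
    then show "x \<in> {2..k}" using x m(1) by (cases "x = 1") auto
  qed
  have "emb L (mpoly_eval L (g j) b) = (\<Sum>m\<in>{m. g j m \<noteq> \<zero>\<^bsub>L\<^esub>}. emb L (g j m) * (\<Prod>i\<in>{2..k}. emb L (b i) ^ count m i))"
    by (rule EL.h_eval(1)[OF fin _ vars]) (use \<iota>_closed[OF x1] b in \<open>auto simp: g_def\<close>)
  also have "\<dots> = (\<Sum>m\<in>{m. g j m \<noteq> \<zero>\<^bsub>L\<^esub>}. J (f (m + r)) * (\<Prod>i\<in>{2..k}. a i ^ count (m + r) i))"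
  proof (rule sum.cong)
    fix m assume "m \<in> {m. g j m \<noteq> \<zero>\<^bsub>L\<^esub>}"
    then have m: "1 \<notin># m" using gsupp by auto
    have "(\<Prod>i\<in>{2..k}. emb L (b i) ^ count m i) = (\<Prod>i\<in>{2..k}. a i ^ count (m + r) i)"
      by (rule prod.cong) (auto simp: ba r_def)
    then show "emb L (g j m) * (\<Prod>i\<in>{2..k}. emb L (b i) ^ count m i) = J (f (m + r)) * (\<Prod>i\<in>{2..k}. a i ^ count (m + r) i)"
      by (simp add: g_val[OF m] J_def)
  qed simp
  also have "\<dots> = (\<Sum>m\<in>{m\<in>{m. J (f m) \<noteq> 0}. count m 1 = j}. J (f m) * (\<Prod>i\<in>{2..k}. a i ^ count m i))"
  proof (rule sum.reindex_bij_witness[of _ "\<lambda>m. m - r" "\<lambda>m. m + r"])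
    fix m assume "m \<in> {m. g j m \<noteq> \<zero>\<^bsub>L\<^esub>}"
    then show "m + r \<in> {m\<in>{m. J (f m) \<noteq> 0}. count m 1 = j}"
      unfolding supp_J gsupp by (auto simp: r_def not_in_iff)
  next
    fix m assume "m \<in> {m\<in>{m. J (f m) \<noteq> 0}. count m 1 = j}"
    then have m: "f m \<noteq> \<zero>\<^bsub>F\<^esub>" "count m 1 = j" unfolding supp_J by auto
    have "r \<subseteq># m" using m(2) by (auto simp: r_def count_le_replicate_mset_subset_eq[symmetric])
    then show 1: "m - r + r = m" by simp
    have "1 \<notin># m - r" using m(2) by (simp add: r_def not_in_iff)
    then show "m - r \<in> {m. g j m \<noteq> \<zero>\<^bsub>L\<^esub>}" unfolding gsupp using 1 m(1) by simp
  qed auto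
  also have "\<dots> = coeff (\<Sum>m\<in>{m. J (f m) \<noteq> 0}. monom (J (f m) * (\<Prod>i\<in>{2..k}. a i ^ count m i)) (count m 1)) j"
    unfolding coeff_sum coeff_monom using f_props(1) by (subst sum.inter_filter) (auto simp: supp_J)
  finally have eq: "emb L (mpoly_eval L (g j) b) = coeff (\<Sum>m\<in>{m. J (f m) \<noteq> 0}. monom (J (f m) * (\<Prod>i\<in>{2..k}. a i ^ count m i)) (count m 1)) j" .
  have "mpoly_eval L (g j) b \<in> carrier L"
    by (rule EL.h_eval(2)[OF fin _ vars]) (use \<iota>_closed[OF x1] b in \<open>auto simp: g_def\<close>)
  then have "emb L (mpoly_eval L (g j) b) \<noteq> 0"
    using j emb_inj[OF fieldL, of _ "\<zero>\<^bsub>L\<^esub>"] emb_zero[OF fieldL] field_closed(1)[OF fieldL] by metis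
  then show ?thesis unfolding eq by (metis coeff_0)
qed

sublocale M: multi_poly e K q k d "\<lambda>m. J (f m)"
proof (intro multi_poly.intro multi_poly_axioms.intro finite_field_J)
  show "k \<ge> 2" by (rule k2)
  show "finite {m. J (f m) \<noteq> 0}" unfolding supp_J by (rule f_props(1))
  show "set_mset m \<subseteq> {1..k}" "size m \<le> d" if "J (f m) \<noteq> 0" for m
    using that f_props(3,4) J_eq_0 f_props(2) by auto
  show "J (f m) \<in> K" for m using f_props(2) by (simp add: K_def)
  show "J (f (image_mset \<pi> m)) = J (f m)" if "\<pi> permutes {1..k}" for \<pi> m
    using adm that by (simp add: admissible_def symmetric_mpoly_def)
  show "(\<Sum>m\<in>{m. J (f m) \<noteq> 0}. monom (J (f m) * (\<Prod>i\<in>{2..k}. a i ^ count m i)) (count m 1)) \<noteq> 0"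
    if "\<And>i. i \<in> {2..k} \<Longrightarrow> e * a i = a i" for a using that by (rule primitive_J)
qed

text \<open>
  A square root over \<open>K\<close> pulls back to one over \<open>F\<close>, against admissibility.
\<close>

lemma not_square_on_all: "\<not> M.square_on_first k a"
proof
  assume "M.square_on_first k a"
  then obtain c g where cg: "c \<in> K" "\<And>m. g m \<in> K" "\<And>m. g m \<noteq> 0 \<Longrightarrow> M.small m"
    "\<And>m. J (f m) = c * (\<Sum>m'\<in>{m'. m' \<subseteq># m}. g m' * g (m - m'))"
    using M.square_on_all_imp_square by meson
  obtain c0 where c0: "c0 \<in> carrier F" "J c0 = c" using cg(1) by (auto simp: K_def)
  define g0 where "g0 m = (SOME x. x \<in> carrier F \<and> J x = g m)" for m
  have g0: "g0 m \<in> carrier F" "J (g0 m) = g m" for m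
  proof -
    have "\<exists>x. x \<in> carrier F \<and> J x = g m" using cg(2)[of m] by (auto simp: K_def)
    from someI_ex[OF this] show "g0 m \<in> carrier F" "J (g0 m) = g m" by (auto simp: g0_def)
  qed
  have sm: "M.small m" if "g0 m \<noteq> \<zero>\<^bsub>F\<^esub>" for m using cg(3)[of m] g0[of m] J_eq_0[of "g0 m"] that by auto
  have "g0 \<in> mpolys F k"
  proof (rule mpolysI[OF ringF])
    show "finite {m. g0 m \<noteq> \<zero>\<^bsub>F\<^esub>}" by (rule finite_subset[OF _ M.finite_small]) (use sm in auto)
    show "set_mset m \<subseteq> {1..k}" if "g0 m \<noteq> \<zero>\<^bsub>F\<^esub>" for m using sm[OF that] by (simp add: M.small_def)
  qed (rule g0)
  moreover have "f = (\<lambda>m. c0 \<otimes>\<^bsub>F\<^esub> mpoly_mult F g0 g0 m)"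
  proof
    fix m
    have mc: "mpoly_mult F g0 g0 m \<in> carrier F"
      unfolding mpoly_mult_def using g0(1) by (intro J.finsum_closed) auto
    have "J (mpoly_mult F g0 g0 m) = (\<Sum>m'\<in>{m'. m' \<subseteq># m}. J (g0 m' \<otimes>\<^bsub>F\<^esub> g0 (m - m')))"
      unfolding mpoly_mult_def using g0(1) by (intro J.h_finsum finite_submultisets) auto
    also have "\<dots> = (\<Sum>m'\<in>{m'. m' \<subseteq># m}. g m' * g (m - m'))" using g0 by (simp add: J.h_mult)
    finally have "J (c0 \<otimes>\<^bsub>F\<^esub> mpoly_mult F g0 g0 m) = J (f m)"
      using cg(4)[of m] c0 mc by (simp add: J.h_mult)
    then show "f m = c0 \<otimes>\<^bsub>F\<^esub> mpoly_mult F g0 g0 m" using J_inj f_props(2) c0(1) mc by simp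
  qed
  ultimately have "constant_multiple_of_square F k f" unfolding constant_multiple_of_square_def using c0(1) by blast
  then show False using adm by (simp add: admissible_def)
qed

lemma J_eval:
  assumes "\<And>i. i \<in> {1..k} \<Longrightarrow> a i \<in> carrier F"
  shows "J (mpoly_eval F f a) = M.value_at (\<lambda>i. J (a i))" "mpoly_eval F f a \<in> carrier F"
proof -
  show "mpoly_eval F f a \<in> carrier F" by (rule J.h_eval(2)[OF f_props(1,2,3)]) (use assms in auto)
  have "J (mpoly_eval F f a) = (\<Sum>m\<in>{m. f m \<noteq> \<zero>\<^bsub>F\<^esub>}. J (f m) * (\<Prod>i\<in>{1..k}. J (a i) ^ count m i))"
    by (rule J.h_eval(1)[OF f_props(1,2,3)]) (use assms in auto)
  then show "J (mpoly_eval F f a) = M.value_at (\<lambda>i. J (a i))"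
    unfolding M.value_at_def M.supp_def M.mono_value_def supp_J .
qed

lemma square_J:
  assumes "x \<in> carrier F" shows "square_in F x \<longleftrightarrow> M.is_square (J x)"
proof -
  have "J x = J y * J y \<longleftrightarrow> x = y \<otimes>\<^bsub>F\<^esub> y" if "y \<in> carrier F" for y
    using J_inj[OF assms, of "y \<otimes>\<^bsub>F\<^esub> y"] J.h_mult[of y y] that by auto
  then show ?thesis unfolding square_in_def M.is_square_def by (auto simp: K_def)
qed

text \<open>
  Two enumerations of the same vertex set differ by a permutation of the variables.
\<close>

lemma eval_symmetric:
  assumes a: "inj_on a {1..k}" "a \<in> {1..k} \<rightarrow> carrier F" and b: "inj_on b {1..k}" "b \<in> {1..k} \<rightarrow> carrier F"
    and im: "a ` {1..k} = b ` {1..k}"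
  shows "mpoly_eval F f a = mpoly_eval F f b"
proof -
  define \<pi> where "\<pi> i = (if i \<in> {1..k} then inv_into {1..k} b (a i) else i)" for i
  have b\<pi>: "b (\<pi> i) = a i" "\<pi> i \<in> {1..k}" if "i \<in> {1..k}" for i
  proof -
    have "a i \<in> b ` {1..k}" using im that by blast
    then show "b (\<pi> i) = a i" "\<pi> i \<in> {1..k}"
      using that f_inv_into_f[of "a i" b "{1..k}"] inv_into_into[of "a i" b "{1..k}"] unfolding \<pi>_def by simp_all
  qed
  have inj: "inj_on \<pi> {1..k}" by (rule inj_onI) (metis b\<pi>(1) a(1) inj_onD)
  have "\<pi> ` {1..k} = {1..k}" using b\<pi>(2) inj by (intro endo_inj_surj) auto
  then have perm: "\<pi> permutes {1..k}" using inj by (intro bij_imp_permutes) (auto simp: bij_betw_def \<pi>_def)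
  have "J (mpoly_eval F f a) = M.value_at (\<lambda>i. J (a i))" using a(2) by (intro J_eval) auto
  also have "\<dots> = M.value_at ((\<lambda>i. J (b i)) \<circ> \<pi>)" by (rule M.value_at_cong) (simp add: b\<pi>)
  also have "\<dots> = M.value_at (\<lambda>i. J (b i))" by (rule M.value_at_permute[OF perm])
  also have "\<dots> = J (mpoly_eval F f b)" using b(2) by (intro J_eval(1)[symmetric]) auto
  finally show ?thesis using J_inj J_eval(2)[of a] J_eval(2)[of b] a(2) b(2) by (auto simp: Pi_iff)
qed

definition even_maps :: "(nat \<times> bool \<Rightarrow> 'a) set"
  where "even_maps = {\<phi> \<in> ({1..k} \<times> UNIV) \<rightarrow>\<^sub>E carrier F. inj_on \<phi> ({1..k} \<times> UNIV) \<and>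
    even (card {\<epsilon> \<in> {1..k} \<rightarrow>\<^sub>E UNIV. square_in F (mpoly_eval F f (\<lambda>i. \<phi> (i, \<epsilon> i)))})}"

lemma card_even_maps: "card even_maps = card M.even_tuples"
proof -
  let ?I = "{1..k} \<times> (UNIV :: bool set)"
  define T where "T \<phi> = restrict (\<lambda>p. J (\<phi> p)) ?I" for \<phi>
  have inj: "inj_on T (?I \<rightarrow>\<^sub>E carrier F)"
  proof (rule inj_onI)
    fix \<phi> \<psi> assume *: "\<phi> \<in> ?I \<rightarrow>\<^sub>E carrier F" "\<psi> \<in> ?I \<rightarrow>\<^sub>E carrier F" "T \<phi> = T \<psi>"
    show "\<phi> = \<psi>"
    proof (rule PiE_ext[OF *(1,2)])
      fix p assume p: "p \<in> ?I"
      then have "J (\<phi> p) = J (\<psi> p)" using fun_cong[OF *(3), of p] by (simp add: T_def)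
      then show "\<phi> p = \<psi> p" using J_inj PiE_mem[OF *(1) p] PiE_mem[OF *(2) p] by blast
    qed
  qed
  have iff: "T \<phi> \<in> M.even_tuples \<longleftrightarrow> \<phi> \<in> even_maps" if \<phi>: "\<phi> \<in> ?I \<rightarrow>\<^sub>E carrier F" for \<phi>
  proof -
    have U: "T \<phi> \<in> M.tuples {1..k}" unfolding M.tuples_def T_def using \<phi> by (auto simp: K_def)
    have "inj_on (T \<phi>) ?I \<longleftrightarrow> inj_on \<phi> ?I"
    proof -
      have "T \<phi> p = T \<phi> p' \<longleftrightarrow> \<phi> p = \<phi> p'" if "p \<in> ?I" "p' \<in> ?I" for p p'
        using that J_inj PiE_mem[OF \<phi>] by (simp add: T_def)
      then show ?thesis unfolding inj_on_def by blast
    qed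
    moreover have "M.is_square (M.value_at (M.pick (T \<phi>) \<epsilon>)) \<longleftrightarrow> square_in F (mpoly_eval F f (\<lambda>i. \<phi> (i, \<epsilon> i)))" for \<epsilon>
    proof -
      have car: "\<phi> (i, \<epsilon> i) \<in> carrier F" if "i \<in> {1..k}" for i using PiE_mem[OF \<phi>] that by auto
      have "M.value_at (M.pick (T \<phi>) \<epsilon>) = M.value_at (\<lambda>i. J (\<phi> (i, \<epsilon> i)))"
        by (rule M.value_at_cong) (simp add: M.pick_def T_def)
      then show ?thesis using J_eval[of "\<lambda>i. \<phi> (i, \<epsilon> i)"] car square_J by simp
    qed
    ultimately show ?thesis using \<phi> U unfolding M.even_tuples_def even_maps_def M.choices_def by simp
  qed
  have "T ` even_maps = M.even_tuples"
  proof
    show "T ` even_maps \<subseteq> M.even_tuples" using iff by (auto simp: even_maps_def)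
    show "M.even_tuples \<subseteq> T ` even_maps"
    proof
      fix u assume u: "u \<in> M.even_tuples"
      then have uK: "u \<in> ?I \<rightarrow>\<^sub>E K" by (auto simp: M.even_tuples_def M.tuples_def)
      define \<phi> where "\<phi> = restrict (\<lambda>p. SOME x. x \<in> carrier F \<and> J x = u p) ?I"
      have \<phi>p: "\<phi> p \<in> carrier F \<and> J (\<phi> p) = u p" if p: "p \<in> ?I" for p
      proof -
        have "\<exists>x. x \<in> carrier F \<and> J x = u p" using PiE_mem[OF uK p] by (auto simp: K_def)
        from someI_ex[OF this] show ?thesis using p by (simp add: \<phi>_def)
      qed
      have \<phi>: "\<phi> \<in> ?I \<rightarrow>\<^sub>E carrier F" using \<phi>p by (auto simp: \<phi>_def PiE_def extensional_def Pi_def)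
      have "T \<phi> = u" using \<phi>p uK by (auto simp: T_def fun_eq_iff PiE_def extensional_def)
      then show "u \<in> T ` even_maps" using iff[OF \<phi>] u by auto
    qed
  qed
  moreover have "inj_on T even_maps" by (rule inj_on_subset[OF inj]) (auto simp: even_maps_def)
  ultimately show ?thesis using card_image by metis
qed

end

section \<open>Even partial octahedra\<close>

lemma sum_card_fibres:
  assumes "finite A" "finite B"
  shows "(\<Sum>y\<in>B. card {x\<in>A. g x = y}) = card {x\<in>A. g x \<in> B}"
proof -
  have "card (\<Union>y\<in>B. {x\<in>A. g x = y}) = (\<Sum>y\<in>B. card {x\<in>A. g x = y})"
    by (rule card_UN_disjoint) (use assms in auto)
  moreover have "(\<Union>y\<in>B. {x\<in>A. g x = y}) = {x\<in>A. g x \<in> B}" by auto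
  ultimately show ?thesis by simp
qed

lemma finite_even_partial_octahedra: "finite (even_partial_octahedra k)"
proof (rule finite_subset)
  let ?V = "verts (octahedron k)"
  show "even_partial_octahedra k \<subseteq> (\<lambda>E. \<lparr>verts = ?V, edges = E\<rparr>) ` Pow (Pow ?V)"
  proof
    fix H assume H: "H \<in> even_partial_octahedra k"
    then have "H = \<lparr>verts = ?V, edges = edges H\<rparr>" by (simp add: even_partial_octahedra_def)
    moreover have "edges H \<in> Pow (Pow ?V)" using H by (auto simp: even_partial_octahedra_def uniform_hypergraph_def)
    ultimately show "H \<in> (\<lambda>E. \<lparr>verts = ?V, edges = E\<rparr>) ` Pow (Pow ?V)" by (rule image_eqI)
  qed
  show "finite ((\<lambda>E. \<lparr>verts = ?V, edges = E\<rparr>) ` Pow (Pow ?V))" by (simp add: octahedron_def)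
qed

definition transversal :: "nat \<Rightarrow> (nat \<Rightarrow> bool) \<Rightarrow> (nat \<times> bool) set"
  where "transversal k \<epsilon> = (\<lambda>i. (i, \<epsilon> i)) ` {1..k}"

lemma card_transversal: "card (transversal k \<epsilon>) = k"
  unfolding transversal_def by (subst card_image) (auto simp: inj_on_def)

lemma inj_transversal: "inj_on (transversal k) ({1..k} \<rightarrow>\<^sub>E UNIV)"
proof (rule inj_onI)
  fix \<epsilon> \<epsilon>' assume *: "\<epsilon> \<in> {1..k} \<rightarrow>\<^sub>E (UNIV::bool set)" "\<epsilon>' \<in> {1..k} \<rightarrow>\<^sub>E UNIV" "transversal k \<epsilon> = transversal k \<epsilon>'"
  show "\<epsilon> = \<epsilon>'"
  proof (rule PiE_ext[OF *(1,2)])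
    fix i assume "i \<in> {1..k}"
    then have "(i, \<epsilon> i) \<in> transversal k \<epsilon>'" unfolding *(3)[symmetric] by (auto simp: transversal_def)
    then show "\<epsilon> i = \<epsilon>' i" by (auto simp: transversal_def)
  qed
qed

lemma edges_octahedron: "edges (octahedron k) = transversal k ` ({1..k} \<rightarrow>\<^sub>E UNIV)"
proof -
  have "transversal k \<epsilon> = transversal k (restrict \<epsilon> {1..k})" for \<epsilon> by (simp add: transversal_def)
  then have "transversal k \<epsilon> \<in> transversal k ` ({1..k} \<rightarrow>\<^sub>E UNIV)" for \<epsilon> by (metis UNIV_I image_eqI restrict_PiE_iff)
  then show ?thesis unfolding octahedron_def transversal_def[symmetric] by auto
qed

lemma uniform_square_hypergraph:
  assumes "finite (carrier F)" shows "uniform_hypergraph k (square_hypergraph F k f)"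
  unfolding uniform_hypergraph_def square_hypergraph_def using assms by (auto simp: card_image)

context admissible_poly
begin

abbreviation G where "G \<equiv> square_hypergraph F k f"

lemma edge_iff:
  assumes \<phi>: "\<phi> \<in> ({1..k} \<times> UNIV) \<rightarrow>\<^sub>E carrier F" "inj_on \<phi> ({1..k} \<times> UNIV)"
  shows "\<phi> ` transversal k \<epsilon> \<in> edges G \<longleftrightarrow> square_in F (mpoly_eval F f (\<lambda>i. \<phi> (i, \<epsilon> i)))"
proof -
  define b where "b i = \<phi> (i, \<epsilon> i)" for i
  have im: "\<phi> ` transversal k \<epsilon> = b ` {1..k}" by (simp add: transversal_def b_def image_image)
  have b: "b \<in> {1..k} \<rightarrow> carrier F" using PiE_mem[OF \<phi>(1)] by (auto simp: b_def)
  have inj: "inj_on b {1..k}"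
  proof (rule inj_onI)
    fix i j assume "i \<in> {1..k}" "j \<in> {1..k}" "b i = b j"
    then have "(i, \<epsilon> i) = (j, \<epsilon> j)" unfolding b_def by (intro inj_onD[OF \<phi>(2)]) auto
    then show "i = j" by simp
  qed
  have "\<phi> ` transversal k \<epsilon> \<in> edges G \<longleftrightarrow>
    (\<exists>a. b ` {1..k} = a ` {1..k} \<and> a \<in> {1..k} \<rightarrow> carrier F \<and> inj_on a {1..k} \<and> square_in F (mpoly_eval F f a))"
    unfolding im square_hypergraph_def by auto
  also have "\<dots> \<longleftrightarrow> square_in F (mpoly_eval F f b)"
    using b inj eval_symmetric[OF _ _ inj b] by metis
  finally show ?thesis unfolding b_def .
qed

text \<open>
  An injective map of the octahedron's vertices is an induced occurrence of exactly one hypergraph,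
  namely of the one whose edges are the sets with an edge as image. So the count is that of the maps for
  which this hypergraph is an even partial octahedron.
\<close>

lemma epo_count_eq: "epo_count k G = card even_maps"
proof -
  let ?V = "{1..k} \<times> (UNIV :: bool set)"
  have V: "verts (octahedron k) = ?V" by (simp add: octahedron_def)
  define A where "A = {\<phi> \<in> ?V \<rightarrow>\<^sub>E carrier F. inj_on \<phi> ?V}"
  define pull where "pull \<phi> = \<lparr>verts = ?V, edges = {e. e \<subseteq> ?V \<and> card e = k \<and> \<phi> ` e \<in> edges G}\<rparr>" for \<phi>
  have finA: "finite A" unfolding A_def using finF by (simp add: finite_PiE)
  have ind: "induced_count k G H = card {\<phi>\<in>A. pull \<phi> = H}" if H: "H \<in> even_partial_octahedra k" for H
  proof -
    have vH: "verts H = ?V" and "uniform_hypergraph k H"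
      using H V unfolding even_partial_octahedra_def by auto
    then have eH: "e \<subseteq> ?V \<and> card e = k" if "e \<in> edges H" for e
      using that unfolding uniform_hypergraph_def by metis
    have "(\<forall>e. e \<subseteq> ?V \<and> card e = k \<longrightarrow> (e \<in> edges H \<longleftrightarrow> \<phi> ` e \<in> edges G)) \<longleftrightarrow> pull \<phi> = H" for \<phi>
    proof -
      have "pull \<phi> = H" if "edges (pull \<phi>) = edges H"
        by (rule hypergraph.equality) (use that vH in \<open>simp_all add: pull_def\<close>)
      then have "pull \<phi> = H \<longleftrightarrow> edges (pull \<phi>) = edges H" by blast
      also have "\<dots> \<longleftrightarrow> {e. e \<subseteq> ?V \<and> card e = k \<and> \<phi> ` e \<in> edges G} = edges H"
        by (simp only: pull_def hypergraph.select_convs)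
      also have "\<dots> \<longleftrightarrow> (\<forall>e. e \<subseteq> ?V \<and> card e = k \<longrightarrow> (e \<in> edges H \<longleftrightarrow> \<phi> ` e \<in> edges G))" using eH by blast
      finally show ?thesis by simp
    qed
    then have "{\<phi> \<in> verts H \<rightarrow>\<^sub>E verts G. inj_on \<phi> (verts H) \<and>
      (\<forall>e. e \<subseteq> verts H \<and> card e = k \<longrightarrow> (e \<in> edges H \<longleftrightarrow> \<phi> ` e \<in> edges G))} = {\<phi>\<in>A. pull \<phi> = H}"
      unfolding vH A_def by (auto simp: square_hypergraph_def)
    then show ?thesis unfolding induced_count_def by simp
  qed
  have "epo_count k G = (\<Sum>H\<in>even_partial_octahedra k. card {\<phi>\<in>A. pull \<phi> = H})"
    unfolding epo_count_def by (rule sum.cong[OF refl ind])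
  also have "\<dots> = card {\<phi>\<in>A. pull \<phi> \<in> even_partial_octahedra k}"
    by (rule sum_card_fibres[OF finA finite_even_partial_octahedra])
  also have "{\<phi>\<in>A. pull \<phi> \<in> even_partial_octahedra k} = even_maps"
  proof -
    have "pull \<phi> \<in> even_partial_octahedra k \<longleftrightarrow>
      even (card {\<epsilon> \<in> {1..k} \<rightarrow>\<^sub>E UNIV. square_in F (mpoly_eval F f (\<lambda>i. \<phi> (i, \<epsilon> i)))})" if "\<phi> \<in> A" for \<phi>
    proof -
      let ?E = "{\<epsilon> \<in> {1..k} \<rightarrow>\<^sub>E (UNIV::bool set). square_in F (mpoly_eval F f (\<lambda>i. \<phi> (i, \<epsilon> i)))}"
      have \<phi>: "\<phi> \<in> ?V \<rightarrow>\<^sub>E carrier F" "inj_on \<phi> ?V" using that by (auto simp: A_def)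
      have "uniform_hypergraph k (pull \<phi>)" by (simp add: uniform_hypergraph_def pull_def)
      then have "pull \<phi> \<in> even_partial_octahedra k \<longleftrightarrow> even (card (edges (pull \<phi>) \<inter> edges (octahedron k)))"
        unfolding even_partial_octahedra_def V by (simp add: pull_def)
      also have "edges (pull \<phi>) \<inter> edges (octahedron k) = transversal k ` ?E"
      proof -
        have "transversal k \<epsilon> \<subseteq> ?V" for \<epsilon> by (auto simp: transversal_def)
        then have "transversal k \<epsilon> \<in> edges (pull \<phi>) \<longleftrightarrow> square_in F (mpoly_eval F f (\<lambda>i. \<phi> (i, \<epsilon> i)))" for \<epsilon>
          using edge_iff[OF \<phi>, of \<epsilon>] card_transversal[of k \<epsilon>] by (simp add: pull_def)
        then show ?thesis unfolding edges_octahedron by auto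
      qed
      also have "card (transversal k ` ?E) = card ?E"
        by (rule card_image) (rule inj_on_subset[OF inj_transversal], auto)
      finally show ?thesis .
    qed
    then show ?thesis unfolding even_maps_def A_def by blast
  qed
  finally show ?thesis .
qed

theorem epo_count_bound:
  "\<bar>real (epo_count k G) - real (card (carrier F)) ^ (2 * k) / 2\<bar>
    \<le> (char_sum_const k d / 2 + real (2 ^ k * d + 4 * k * k)) * real (card (carrier F)) ^ (2 * k - 1)"
  using M.even_tuples_count[OF not_square_on_all] unfolding epo_count_eq card_even_maps q_def .

end

section \<open>Large members of the family and the theorem\<close>

text \<open>
  The integers modulo a large prime, transported to a subset of the given infinite type.
\<close>

lemma exists_large_odd_field:
  "\<exists>F :: ('a::infinite) ring. odd_finite_field F \<and> card (carrier F) > N"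
proof -
  obtain p :: nat where p: "prime p" "p > N + 2" using bigger_prime by blast
  have pi: "prime (int p)" using p by simp
  interpret residues_prime p "residue_ring (int p)" by unfold_locales (use p in auto)
  let ?R = "residue_ring (int p)"
  have carR: "carrier ?R = {0..int p - 1}" by (rule res_carrier_eq)
  have finR: "finite (carrier ?R)" "card (carrier ?R) = p" unfolding carR by auto
  obtain B :: "'a set" where B: "finite B" "card B = p"
    using infinite_arbitrarily_large[OF infinite_UNIV] by blast
  obtain t where t: "bij_betw t (carrier ?R) B" using finite_same_card_bij[OF finR(1) B(1)] finR(2) B(2) by auto
  define F where "F = image_ring t ?R"
  have inj: "inj_on t (carrier ?R)" using t by (simp add: bij_betw_def)
  have "field F" unfolding F_def by (rule field.inj_imp_image_ring_is_field[OF is_field inj])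
  moreover have "carrier F = B" using t by (simp add: F_def image_ring_carrier bij_betw_def)
  moreover have "odd p" using p by (intro prime_odd_nat) auto
  ultimately show ?thesis using B p by (intro exI[of _ F]) (auto simp: odd_finite_field_def)
qed

text \<open>
  The polynomial is the sum of all \<open>x\<^sub>i\<close> and all \<open>x\<^sub>i\<^sup>d\<close>, each monomial counted once, which for \<open>d = 1\<close> is
  \<open>x\<^sub>1 + \<dots> + x\<^sub>k\<close>. Its constant coefficient is \<open>0\<close> and the coefficient of \<open>x\<^sub>1\<close> is \<open>1\<close>; in \<open>c g\<^sup>2\<close> the former
  forces \<open>c = 0\<close> or \<open>g(0) = 0\<close> and then the latter would vanish. It is primitive because \<open>H\<^sub>d = 1\<close>.
\<close>

lemma exists_admissible:
  assumes F: "field F" and k: "k \<ge> 1" and d: "d \<ge> 1"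
  shows "\<exists>f. admissible F k f \<and> mpoly_degree F f = d"
proof -
  interpret field F by fact
  define S where "S = (\<lambda>i. {#i#}) ` {1..k} \<union> (\<lambda>i. replicate_mset d i) ` {1..k}"
  define f where "f m = (if m \<in> S then \<one>\<^bsub>F\<^esub> else \<zero>\<^bsub>F\<^esub>)" for m
  have supp: "{m. f m \<noteq> \<zero>\<^bsub>F\<^esub>} = S" by (auto simp: f_def)
  have finS: "finite S" by (simp add: S_def)
  have sizeS: "size m = 1 \<or> size m = d" if "m \<in> S" for m using that by (auto simp: S_def)
  have dS: "replicate_mset d 1 \<in> S" using k by (auto simp: S_def)
  have deg: "mpoly_degree F f = d"
    unfolding mpoly_degree_def supp
  proof (rule Max_eqI)
    show "finite (insert 0 (size ` S))" using finS by simp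
    show "y \<le> d" if "y \<in> insert 0 (size ` S)" for y
    proof -
      have "y = 0 \<or> y = 1 \<or> y = d" using that sizeS by blast
      then show ?thesis using d by auto
    qed
    show "d \<in> insert 0 (size ` S)" using dS by (intro insertI2 image_eqI[of _ _ "replicate_mset d 1"]) auto
  qed
  have poly: "f \<in> mpolys F k"
  proof (rule mpolysI[OF ring_axioms])
    show "finite {m. f m \<noteq> \<zero>\<^bsub>F\<^esub>}" unfolding supp by (rule finS)
    show "f m \<in> carrier F" for m by (simp add: f_def)
    show "set_mset m \<subseteq> {1..k}" if "f m \<noteq> \<zero>\<^bsub>F\<^esub>" for m
    proof -
      have "m \<in> S" using that supp by blast
      then show ?thesis by (auto simp: S_def split: if_splits)
    qed
  qed
  have sym: "symmetric_mpoly k f"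
    unfolding symmetric_mpoly_def
  proof (intro allI impI)
    fix \<pi> m assume \<pi>: "\<pi> permutes {1..k}"
    have fwd: "image_mset \<sigma> m \<in> S" if "\<sigma> permutes {1..k}" "m \<in> S" for \<sigma> m
      using that permutes_in_image[OF that(1)] unfolding S_def by auto
    have "inv_into UNIV \<pi> permutes {1..k}" by (rule permutes_inv[OF \<pi>])
    moreover have "image_mset (inv_into UNIV \<pi>) (image_mset \<pi> m) = m"
      using permutes_bij[OF \<pi>] by (simp add: image_mset.compositionality comp_def bij_is_inj inv_f_f)
    ultimately have "image_mset \<pi> m \<in> S \<longleftrightarrow> m \<in> S" using fwd \<pi> by metis
    then show "f (image_mset \<pi> m) = f m" by (simp add: f_def)
  qed
  have e0: "{#} \<notin> S" using d by (auto simp: S_def)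
  have e1: "{#1#} \<in> S" using k by (auto simp: S_def)
  have nonsq: "\<not> constant_multiple_of_square F k f"
  proof
    assume "constant_multiple_of_square F k f"
    then obtain c g where cg: "c \<in> carrier F" "g \<in> mpolys F k" "f = (\<lambda>m. c \<otimes>\<^bsub>F\<^esub> mpoly_mult F g g m)"
      unfolding constant_multiple_of_square_def by auto
    have g: "g m \<in> carrier F" for m using mpolys_properties[OF ring_axioms cg(2)] by blast
    have s0: "{m'. m' \<subseteq># {#}} = {{#} :: nat multiset}" by auto
    have "m' = {#} \<or> m' = {#1#}" if sub: "m' \<subseteq># {#1#}" for m' :: "nat multiset"
    proof (cases "1 \<in># m'")
      case True
      then have "{#1#} \<subseteq># m'" by simp
      then show ?thesis using subset_mset.antisym[OF sub] by simp
    next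
      case False
      have "set_mset m' \<subseteq> {1}" using set_mset_mono[OF sub] by simp
      then have "set_mset m' = {}" using False by auto
      then show ?thesis by simp
    qed
    then have s1: "{m'. m' \<subseteq># {#1#}} = {{#}, {#1 :: nat#}}" by auto
    have m0: "mpoly_mult F g g {#} = g {#} \<otimes>\<^bsub>F\<^esub> g {#}"
      unfolding mpoly_mult_def s0 using g by simp
    have m1: "mpoly_mult F g g {#1#} = g {#} \<otimes>\<^bsub>F\<^esub> g {#1#} \<oplus>\<^bsub>F\<^esub> g {#1#} \<otimes>\<^bsub>F\<^esub> g {#}"
      unfolding mpoly_mult_def s1 using g by simp
    have "c \<otimes>\<^bsub>F\<^esub> (g {#} \<otimes>\<^bsub>F\<^esub> g {#}) = \<zero>\<^bsub>F\<^esub>"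
      using fun_cong[OF cg(3), of "{#}"] e0 m0 by (simp add: f_def)
    then have "c = \<zero>\<^bsub>F\<^esub> \<or> g {#} = \<zero>\<^bsub>F\<^esub>" using integral_iff g cg(1) by auto
    moreover have "c \<otimes>\<^bsub>F\<^esub> (g {#} \<otimes>\<^bsub>F\<^esub> g {#1#} \<oplus>\<^bsub>F\<^esub> g {#1#} \<otimes>\<^bsub>F\<^esub> g {#}) = \<one>\<^bsub>F\<^esub>"
      using fun_cong[OF cg(3), of "{#1#}"] e1 m1 by (simp add: f_def)
    ultimately show False using g[of "{#1#}"] g[of "{#}"] cg(1) by auto
  qed
  have prim: "primitive_mpoly F k f"
    unfolding primitive_mpoly_def
  proof (rule notI, elim bexE)
    let ?L = "field.alg_closure F"
    let ?c = "ring.indexed_const F"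
    fix b assume "\<forall>j\<le>mpoly_degree F f. mpoly_eval ?L (\<lambda>m. ?c (x1_coeff F f j m)) b = \<zero>\<^bsub>?L\<^esub>"
    then have z: "mpoly_eval ?L (\<lambda>m. ?c (x1_coeff F f d m)) b = \<zero>\<^bsub>?L\<^esub>" using deg by simp
    interpret L: algebraic_closure ?L "?c ` carrier F" by (rule alg_closureE(1))
    note hom = alg_closureE(2)
    have c1: "?c \<one>\<^bsub>F\<^esub> = \<one>\<^bsub>?L\<^esub>" by (rule ring_hom_one[OF hom])
    have c0: "?c \<zero>\<^bsub>F\<^esub> = \<zero>\<^bsub>?L\<^esub>" by (rule ring_hom_zero[OF hom ring_axioms L.ring_axioms])
    have "m + replicate_mset d 1 \<in> S \<longleftrightarrow> m = {#}" if "1 \<notin># m" for m :: "nat multiset"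
    proof
      assume mS: "m + replicate_mset d 1 \<in> S"
      have "size m = 0"
      proof -
        have "size m + d = 1 \<or> size m + d = d" using sizeS[OF mS] by simp
        then show ?thesis using d by linarith
      qed
      then show "m = {#}" by simp
    qed (use dS in simp)
    then have x1: "x1_coeff F f d m = (if m = {#} then \<one>\<^bsub>F\<^esub> else \<zero>\<^bsub>F\<^esub>)" for m
      using dS by (auto simp: x1_coeff_def f_def)
    have val: "?c (x1_coeff F f d m) = (if m = {#} then \<one>\<^bsub>?L\<^esub> else \<zero>\<^bsub>?L\<^esub>)" for m
      unfolding x1 using c0 c1 by simp
    have "{m. ?c (x1_coeff F f d m) \<noteq> \<zero>\<^bsub>?L\<^esub>} = {{#}}" unfolding val by auto
    then have "mpoly_eval ?L (\<lambda>m. ?c (x1_coeff F f d m)) b = \<one>\<^bsub>?L\<^esub>"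
      unfolding mpoly_eval_def by (simp add: val)
    then show False using z by simp
  qed
  show ?thesis using poly sym nonsq prim deg unfolding admissible_def by blast
qed

theorem theorem1p3:
  fixes k d :: nat
  assumes "k \<ge> 2" and "d \<ge> 1"
  shows "(\<exists>C::real. \<forall>(F :: ('a::infinite) ring) f.
            odd_finite_field F \<and> admissible F k f \<and> mpoly_degree F f = d \<longrightarrow>
              \<bar>real (epo_count k (square_hypergraph F k f)) - real (card (carrier F)) ^ (2 * k) / 2\<bar>
                \<le> C * real (card (carrier F)) ^ (2 * k - 1))
       \<and> quasi_random k (square_hypergraph_family k d :: 'a hypergraph set)"
proof -
  define C where "C = char_sum_const k d / 2 + real (2 ^ k * d + 4 * k * k)"
  have bound: "\<bar>real (epo_count k (square_hypergraph F k f)) - real (card (carrier F)) ^ (2 * k) / 2\<bar>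
      \<le> C * real (card (carrier F)) ^ (2 * k - 1)"
    if "odd_finite_field F" "admissible F k f" "mpoly_degree F f = d" for F :: "'a ring" and f
  proof -
    interpret admissible_poly F f k d by unfold_locales (use that assms in auto)
    show ?thesis unfolding C_def by (rule epo_count_bound)
  qed
  have "quasi_random k (square_hypergraph_family k d :: 'a hypergraph set)"
    unfolding quasi_random_def
  proof (intro conjI)
    show "\<forall>G \<in> (square_hypergraph_family k d :: 'a hypergraph set). uniform_hypergraph k G"
      by (auto simp: square_hypergraph_family_def odd_finite_field_def intro: uniform_square_hypergraph)
    show "\<forall>N. \<exists>G \<in> (square_hypergraph_family k d :: 'a hypergraph set). card (verts G) > N"
    proof
      fix N
      obtain F :: "'a ring" where F: "odd_finite_field F" "card (carrier F) > N" using exists_large_odd_field by blast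
      obtain f where f: "admissible F k f" "mpoly_degree F f = d"
        using exists_admissible[of F k d] F assms by (auto simp: odd_finite_field_def)
      then show "\<exists>G \<in> (square_hypergraph_family k d :: 'a hypergraph set). card (verts G) > N"
        using F by (intro bexI[of _ "square_hypergraph F k f"]) (auto simp: square_hypergraph_family_def square_hypergraph_def)
    qed
    show "\<exists>\<delta> :: nat \<Rightarrow> real. \<delta> \<longlonglongrightarrow> 0 \<and>
      (\<forall>G \<in> (square_hypergraph_family k d :: 'a hypergraph set). real (epo_count k G)
         \<le> (1 + \<delta> (card (verts G))) * (real (card (verts G)) ^ (2 * k) / 2))"
    proof (intro exI conjI ballI)
      show "(\<lambda>n. (2 * C) / real n) \<longlonglongrightarrow> 0" by (rule lim_const_over_n)
      fix G :: "'a hypergraph" assume "G \<in> square_hypergraph_family k d"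
      then obtain F f where Ff: "odd_finite_field F" "admissible F k f" "mpoly_degree F f = d" "G = square_hypergraph F k f"
        by (auto simp: square_hypergraph_family_def)
      define n where "n = real (card (carrier F))"
      have n: "n > 0" using Ff(1) unfolding n_def odd_finite_field_def by (cases "card (carrier F)") auto
      have v: "card (verts G) = card (carrier F)" by (simp add: Ff(4) square_hypergraph_def)
      have "2 * k = Suc (2 * k - 1)" using assms by simp
      then have pw: "n ^ (2 * k) = n * n ^ (2 * k - 1)" by (metis power_Suc)
      have "real (epo_count k G) \<le> n ^ (2 * k) / 2 + C * n ^ (2 * k - 1)"
        using bound[OF Ff(1-3)] unfolding Ff(4) n_def by linarith
      also have "\<dots> = (1 + 2 * C / n) * (n ^ (2 * k) / 2)" using n unfolding pw by (simp add: field_simps)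
      finally show "real (epo_count k G)
         \<le> (1 + 2 * C / real (card (verts G))) * (real (card (verts G)) ^ (2 * k) / 2)"
        unfolding v n_def .
    qed
  qed
  then show ?thesis using bound by blast
qed

end
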